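(* Let $N\ge2$, $\omega_1,\dots,\omega_N\in\mathbb{R}$, $\kappa>0$ and $\varepsilon\in(0,1]$ with $\kappa>(2+\varepsilon)\|\Omega\|_\infty$, where $\|\Omega\|_\infty=\max_i|\omega_i|$. For initial data $(\theta_i^0)$ let $(\theta_i(t))$ solve \[ \dot\theta_i=\omega_i-\frac{\kappa}{N}\sum_{j=1}^N(1+\cos\theta_j)\sin\theta_i,\qquad\theta_i(0)=\theta_i^0, \] with $R(t)=\frac1N\sum_j(1+\cos\theta_j(t))$, and let $m$ be the normalized Lebesgue measure on $[-\pi,\pi]^N$. Let $T_0=\frac{25}{\kappa N\varepsilon(5-\varepsilon)}\log\Big(\big(1+\frac2N\big)\big(\frac{2\sqrt5}{\sqrt{\pi\varepsilon}\,e^{1/2+\varepsilon^2/25}}\big)^N-\frac2N\Big)$. For each $T>0$, let $E_T$ be the set of $(\theta_i^0)\in[-\pi,\pi]^N$ such that: $R(t)\ge\frac1{\sqrt2}-\frac{3\varepsilon}{20}$ for all $t\ge T$; $\sup_{t\ge T}\theta_i(t)-\inf_{t\ge T}\theta_i(t)<2\pi$ for all $i$; and for every $i$ and every $t_0\ge T$ with $\cos\theta_i(t_0)\ge-\frac1{\sqrt2}$, one has $\cos\theta_i(t)\ge-\frac1{\sqrt2}$ for $t\ge t_0$ and $\cos\theta_i(t)\ge\frac1{\sqrt2}$ for $t\ge t_0+\frac{(2+\varepsilon)\pi}{\kappa-(2+\varepsilon)\|\Omega\|_\infty}$. Then \[ m(E_T)\ge\begin{cases}1-\frac{1}{N/2+1}\Big(\frac{\sqrt{\pi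 e\varepsilon}}{2\sqrt5}\Big)^N\Big(1-e^{-\frac{\kappa N\varepsilon(5-\varepsilon)T}{25}}\Big)-\exp\Big(-\frac{N\varepsilon^2}{25}-\frac{\kappa N\varepsilon(5-\varepsilon)T}{25}\Big),& T\le T_0,\\[2mm] 1-\Big(\frac{20}{\pi e\varepsilon}+\frac{4\kappa(5-\varepsilon)}{5\pi e}(T-T_0)\Big)^{-N/2},& T>T_0.\end{cases} \] If in addition $\kappa>8\|\Omega\|_\infty$, then for each $T>0$ \[ m\Big\{(\theta_i^0)\in[-\pi,\pi]^N:\sup_{t\ge T}\theta_i(t)-\inf_{t\ge T}\theta_i(t)<2\pi\ \forall i\Big\}\ge\begin{cases}1-\Big(e^{1/2}+\frac{3\kappa T}{\pi e}\Big)^{-N/2},&8\|\Omega\|_\infty<\kappa\le16\sqrt2\|\Omega\|_\infty,\\[1mm] 1-\Big(\frac4{\pi e}\big(\frac{\kappa}{2\sqrt2\|\Omega\|_\infty}\big)^{2/3}+\frac{3\kappa T}{\pi e}\Big)^{-N/2},&\kappa>16\sqrt2\|\Omega\|_\infty,\end{cases} \] where the probability is $1$ if $\|\Omega\|_\infty=0$. *)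

theory Defs
  imports "HOL-Analysis.Analysis"
begin

definition cube :: "(real^'n) set" where
  "cube = {x. \<forall>i. x $ i \<in> {-pi..pi}}"

definition nmeas :: "(real^'n) set \<Rightarrow> real" where
  "nmeas S = measure lebesgue S / (2 * pi) ^ CARD('n)"

definition omega_norm :: "real^'n \<Rightarrow> real" where
  "omega_norm w = Max (range (\<lambda>i. \<bar>w $ i\<bar>))"

definition kfield :: "real^'n \<Rightarrow> real \<Rightarrow> real^'n \<Rightarrow> real^'n" where
  "kfield w \<kappa> \<theta> = (\<chi> i. w $ i - \<kappa> / real CARD('n) *
      (\<Sum>j\<in>UNIV. 1 + cos (\<theta> $ j)) * sin (\<theta> $ i))"

definition orderR :: "real^'n \<Rightarrow> real" where
  "orderR \<theta> = (\<Sum>j\<in>UNIV. 1 + cos (\<theta> $ j)) / real CARD('n)"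

definition osc_lt_2pi :: "(real \<Rightarrow> real) \<Rightarrow> real \<Rightarrow> bool" where
  "osc_lt_2pi f T \<longleftrightarrow> bdd_above (f ` {T..}) \<and> bdd_below (f ` {T..}) \<and>
     (SUP t\<in>{T..}. f t) - (INF t\<in>{T..}. f t) < 2 * pi"

end

theory Submission
  imports Defs "HOL-Real_Asymp.Real_Asymp" "HOL-Probability.Distributions"
begin

text \<open>
  Write \<open>R\<close> for the order parameter. The divergence of the vector field is
  \<open>\<kappa> N R (1 - R) + (\<kappa> / N) (\<Sum>i. sin\<^sup>2 \<theta>\<^sub>i)\<close>, so the flow expands volume on \<open>{R < 1}\<close>. Transporting the set of
  initial data with \<open>R \<le> a < 1\<close> on all of \<open>[0, T]\<close>, whose image always stays in \<open>{R \<le> a}\<close>, its volume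
  grows along the flow but remains bounded by that of \<open>{R \<le> a}\<close>; hence it was small initially. Points with
  small \<open>R\<close>, where the expansion is weak, are controlled by the Chernoff bound
  \<open>m {R \<le> s} \<le> (\<pi> e s / 4) powr (N / 2)\<close>, which gives an exponential rate first and a power law for
  late times.

  Conversely, once \<open>R\<close> exceeds the threshold it can only drop a little: \<open>cos \<theta>\<^sub>i\<close> is nondecreasing
  while \<open>|cos \<theta>\<^sub>i| < c\<close>, so each \<open>cos \<theta>\<^sub>i\<close> loses at most \<open>1 - c\<close>. All remaining
  assertions follow from the resulting lower bound on \<open>R\<close>.

  No differentiability of the flow in the initial data is needed: volumes are followed along the Euler maps
  \<open>x + h F x\<close>, whose Jacobian is explicit and which converge uniformly to the flow. They commute with
  translations by \<open>2 \<pi>\<close>, so their images can be folded back into one period.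
\<close>

section \<open>Trapping in arcs\<close>

text \<open>The expansion rate \<open>R * (1 - R)\<close> vanishes at \<open>R = 0\<close>, so it
  has no positive lower bound on a slow set \<open>R \<le> 1 - \<mu>\<close>. It is at least
  \<open>(1 - \<mu>) * min R s\<close> for any \<open>s \<le> \<mu>\<close>, and the integral of
  \<open>min R s\<close> over any set of normalized volume \<open>M\<close> is, after normalization,
  at least \<open>s * (M - d)\<close> with \<open>d = cap_deficit N s\<close>, wherever the set
  lies. For the volume \<open>M\<close> of the initial data that are slow up to time
  \<open>t\<close> this gives, in integrated form,
  \<open>M' \<le> - \<kappa> N (1 - \<mu>) s (M - d)\<close> for every \<open>s \<le> \<mu>\<close>.
  The fixed choice \<open>s = \<mu> = \<epsilon> / 5\<close> yields the exponential phase;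
  \<open>s\<close> proportional to \<open>M powr (2 / N)\<close> yields the power law.
  \<open>T0\<close> is the time at which the first bound has come down to the Chernoff bound of
  \<open>R \<le> \<epsilon> / 5\<close>, the value from which the power law starts. The threshold
  \<open>1 - \<epsilon> / 5\<close> less the possible drop \<open>1 - c\<close>, where
  \<open>c = 1 / sqrt 2 + \<epsilon> / 20\<close>, is the bound
  \<open>1 / sqrt 2 - 3 * \<epsilon> / 20\<close> of the theorem.\<close>

lemma upper_level_invariant:
  fixes g g' :: "real \<Rightarrow> real"
  assumes der: "\<And>t. u \<le> t \<Longrightarrow> t \<le> v \<Longrightarrow> (g has_real_derivative g' t) (at t within {u..v})"
    and mono: "\<And>t. u \<le> t \<Longrightarrow> t \<le> v \<Longrightarrow> \<bar>g t\<bar> < c \<Longrightarrow> g' t \<ge> 0"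
    and a: "- c < a" "a \<le> c" and "g u \<ge> a" and uv: "u \<le> v"
  shows "g v \<ge> a"
proof (rule ccontr)
  assume "\<not> g v \<ge> a"
  then have gv: "g v < a" by simp
  have cont: "continuous_on {u..v} g"
    by (rule DERIV_continuous_on[of _ _ g']) (use der in auto)
  \<comment> \<open>A level strictly below \<open>a\<close> but above both \<open>- c\<close> and
    \<open>g v\<close>. The path down to \<open>g v\<close> has to cross the strip between
    \<open>b\<close> and \<open>a\<close>, which lies inside the band
    \<open>\<bar>g\<bar> < c\<close> where \<open>g\<close> cannot decrease.\<close>
  define b where "b = (max (g v) (- c) + a) / 2"
  have b: "- c < b" "b < a" "g v < b" using a gv by (auto simp: b_def)
  \<comment> \<open>\<open>s\<close> is the last time with \<open>g \<ge> a\<close>, and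
    \<open>r\<close> below is the first later time with \<open>g \<le> b\<close>; between them
    \<open>g\<close> stays in the strip.\<close>
  define A where "A = {u..v} \<inter> g -` {a..}"
  have "closed A" unfolding A_def by (rule continuous_closed_preimage[OF cont]) auto
  then have "compact A" unfolding A_def by (metis bounded_closed_interval bounded_Int compact_eq_bounded_closed)
  moreover have "u \<in> A" using assms by (auto simp: A_def)
  ultimately obtain s where s: "s \<in> A" "\<And>t. t \<in> A \<Longrightarrow> t \<le> s"
    by (metis compact_attains_sup empty_iff)
  have suv: "u \<le> s" "s \<le> v" "g s \<ge> a" using s(1) by (auto simp: A_def)
  have "s < v" using suv gv by (metis leD le_less)
  have below: "g t < a" if "s < t" "t \<le> v" for t
    using s(2)[of t] that suv by (force simp: A_def)
  have cs: "continuous_on {s..v} g" using cont by (rule continuous_on_subset) (use suv in auto)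
  define B where "B = {s..v} \<inter> g -` {..b}"
  have "closed B" unfolding B_def by (rule continuous_closed_preimage[OF cs]) auto
  then have "compact B" unfolding B_def by (metis bounded_closed_interval bounded_Int compact_eq_bounded_closed)
  moreover have "v \<in> B" using b suv by (auto simp: B_def)
  ultimately obtain r where r: "r \<in> B" "\<And>t. t \<in> B \<Longrightarrow> r \<le> t"
    by (metis compact_attains_inf empty_iff)
  have rs: "s < r" "r \<le> v" "g r \<le> b" using r(1) b suv by (auto simp: B_def le_less)
  have "g s \<le> g r"
  proof (rule DERIV_nonneg_imp_increasing_open[of s r g])
    show "s \<le> r" using rs by simp
    fix x assume x: "s < x" "x < r"
    have "\<bar>g x\<bar> < c"
      using below[of x] r(2)[of x] x rs b a by (force simp: B_def)
    then have "g' x \<ge> 0" using mono[of x] x suv rs by auto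
    moreover have "(g has_real_derivative g' x) (at x)"
      using der[of x] x suv rs at_within_interior[of x "{u..v}"] by auto
    ultimately show "\<exists>y. (g has_real_derivative y) (at x) \<and> 0 \<le> y" by auto
  next
    show "continuous_on {s..r} g" using cs by (rule continuous_on_subset) (use rs in auto)
  qed
  then show False using suv rs b by linarith
qed

text \<open>Above \<open>c\<close> nothing is known about the sign of the derivative, but there
  \<open>g\<close> has at most \<open>1 - c\<close> to lose before it reaches the monotone band.
  Below \<open>- c\<close> the floor \<open>- 1\<close> limits the loss in the same way.\<close>

lemma drop_bounded:
  fixes g g' :: "real \<Rightarrow> real"
  assumes der: "\<And>t. u \<le> t \<Longrightarrow> t \<le> v \<Longrightarrow> (g has_real_derivative g' t) (at t within {u..v})"
    and mono: "\<And>t. u \<le> t \<Longrightarrow> t \<le> v \<Longrightarrow> \<bar>g t\<bar> < c \<Longrightarrow> g' t \<ge> 0"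
    and g: "\<bar>g u\<bar> \<le> 1" "\<bar>g v\<bar> \<le> 1" and c: "0 < c" "c < 1" and uv: "u \<le> v"
  shows "g v \<ge> g u - (1 - c)"
proof (cases "g u > - c")
  case True
  have "g v \<ge> min (g u) c"
    by (rule upper_level_invariant[OF der mono]) (use True c uv in auto)
  then show ?thesis using g c by (auto simp: min_def split: if_splits)
next
  case False
  then show ?thesis using g by linarith
qed

text \<open>Leaving the arc would force the distance to its centre through values between
  \<open>\<alpha>\<close> and \<open>pi\<close>, where the cosine is below
  \<open>cos \<alpha>\<close>.\<close>

lemma cos_arc_trap:
  fixes f :: "real \<Rightarrow> real"
  assumes cont: "continuous_on {u..} f" and al: "0 \<le> \<alpha>" "\<alpha> < pi"
    and start: "\<bar>f u - 2 * pi * of_int k\<bar> \<le> \<alpha>"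
    and inv: "\<And>t. t \<ge> u \<Longrightarrow> cos (f t) \<ge> cos \<alpha>" and t: "t \<ge> u"
  shows "\<bar>f t - 2 * pi * of_int k\<bar> \<le> \<alpha>"
proof (rule ccontr)
  define h where "h = (\<lambda>t. \<bar>f t - 2 * pi * of_int k\<bar>)"
  assume "\<not> ?thesis"
  then have gt: "h t > \<alpha>" by (simp add: h_def)
  \<comment> \<open>Capped below \<open>pi\<close>: the distance at time \<open>t\<close> may exceed
    \<open>pi\<close>, where the cosine grows again.\<close>
  define b where "b = min (h t) ((\<alpha> + pi) / 2)"
  have b: "\<alpha> < b" "b < pi" "b \<le> h t" using gt al by (auto simp: b_def min_def)
  have "continuous_on {u..t} h" unfolding h_def
    by (intro continuous_intros continuous_on_subset[OF cont]) auto
  then obtain s where s: "u \<le> s" "s \<le> t" "h s = b"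
    using IVT'[of h u b t] b start t by (auto simp: h_def)
  have "cos (f s) = cos (f s - 2 * pi * of_int k)"
    by (simp add: cos_diff)
  also have "\<dots> = cos (h s)" by (simp add: h_def)
  also have "\<dots> < cos \<alpha>" unfolding s using b al by (intro cos_monotone_0_pi) auto
  finally show False using inv[of s] s by simp
qed

lemma osc_lt_2piI:
  assumes "\<And>t. t \<ge> T \<Longrightarrow> lo \<le> f t" "\<And>t. t \<ge> T \<Longrightarrow> f t \<le> hi" "hi - lo < 2 * pi"
  shows "osc_lt_2pi f T"
proof -
  have "(SUP t\<in>{T..}. f t) \<le> hi" by (rule cSUP_least) (use assms in auto)
  moreover have "(INF t\<in>{T..}. f t) \<ge> lo" by (rule cINF_greatest) (use assms in auto)
  ultimately show ?thesis unfolding osc_lt_2pi_def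
    using assms by (auto simp: bdd_above_def bdd_below_def)
qed

text \<open>Rational bounds turn the oscillation condition into a countable union of closed
  conditions, from which its measurability follows.\<close>

lemma osc_lt_2piD:
  assumes "osc_lt_2pi f T"
  shows "\<exists>lo\<in>\<rat>. \<exists>hi\<in>\<rat>. hi - lo < 2 * pi \<and> (\<forall>t\<ge>T. lo \<le> f t \<and> f t \<le> hi)"
proof -
  define S I d where "S = (SUP t\<in>{T..}. f t)" and "I = (INF t\<in>{T..}. f t)" and "d = (2 * pi - (S - I)) / 2"
  have d: "d > 0" "2 * d = 2 * pi - (S - I)" using assms by (auto simp: osc_lt_2pi_def S_def I_def d_def)
  obtain hi where hi: "hi \<in> \<rat>" "S < hi" "hi < S + d" using Rats_dense_in_real[of S "S + d"] d by auto
  obtain lo where lo: "lo \<in> \<rat>" "I - d < lo" "lo < I" using Rats_dense_in_real[of "I - d" I] d by auto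
  have "f t \<le> S" "I \<le> f t" if "t \<ge> T" for t
    using assms that unfolding osc_lt_2pi_def S_def I_def by (auto intro: cSUP_upper cINF_lower)
  then have "\<forall>t\<ge>T. lo \<le> f t \<and> f t \<le> hi" using hi lo by (meson less_imp_le order_trans)
  moreover have "hi - lo < 2 * pi" using hi lo d by linarith
  ultimately show ?thesis using hi(1) lo(1) by blast
qed

text \<open>The path starts in the gap between two consecutive arcs and meets the lower one. Before
  that it cannot have touched the upper arc, which would have captured it; afterwards it is captured
  by the lower arc.\<close>

lemma osc_lt_2pi_of_hit:
  fixes f :: "real \<Rightarrow> real"
  assumes cont: "continuous_on {T..} f" and al: "0 < \<alpha>" "\<alpha> < pi"
    and inv: "\<And>u t. u \<ge> T \<Longrightarrow> cos (f u) \<ge> cos \<alpha> \<Longrightarrow> t \<ge> u \<Longrightarrow> cos (f t) \<ge> cos \<alpha>"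
    and gap: "2 * pi * of_int k + \<alpha> < f T" "f T < 2 * pi * of_int k + (2 * pi - \<alpha>)"
    and hit: "u \<ge> T" "f u \<le> 2 * pi * of_int k + \<alpha>"
  shows "osc_lt_2pi f T"
proof -
  let ?K = "2 * pi * of_int k"
  have cosK: "cos (?K + x) = cos x" "cos (?K + (2 * pi - x)) = cos x" for x
    by (simp_all add: cos_add)
  have cs: "continuous_on {a..b} f" if "a \<ge> T" for a b
    using cont by (rule continuous_on_subset) (use that in auto)
  have cu: "continuous_on {s..} f" if "s \<ge> T" for s
    using cont by (rule continuous_on_subset) (use that in auto)
  have trap: "\<bar>f t - ?K\<bar> \<le> \<alpha>" if s: "s \<ge> T" "f s = ?K + \<alpha>" "t \<ge> s" for s t
  proof (rule cos_arc_trap[OF cu[OF s(1)] _ al(2) _ _ s(3)])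
    show "cos \<alpha> \<le> cos (f r)" if "r \<ge> s" for r
      using inv[OF s(1) _ that] s(2) cosK by simp
  qed (use al s in auto)
  have trap2: "\<bar>f t - 2 * pi * of_int (k + 1)\<bar> \<le> \<alpha>"
    if s: "s \<ge> T" "f s = ?K + (2 * pi - \<alpha>)" "t \<ge> s" for s t
  proof (rule cos_arc_trap[OF cu[OF s(1)] _ al(2) _ _ s(3)])
    show "cos \<alpha> \<le> cos (f r)" if "r \<ge> s" for r
      using inv[OF s(1) _ that] s(2) cosK by simp
    show "\<bar>f s - 2 * pi * of_int (k + 1)\<bar> \<le> \<alpha>"
      using al s(2) by (simp add: algebra_simps)
  qed (use al in auto)
  obtain s where s: "T \<le> s" "s \<le> u" "f s = ?K + \<alpha>"
    using IVT2'[of f u "?K + \<alpha>" T] gap hit cs[of T u] by auto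
  have up: "f t < ?K + (2 * pi - \<alpha>)" if ts: "T \<le> t" "t \<le> s" for t
  proof (rule ccontr)
    assume "\<not> ?thesis"
    then obtain r where r: "T \<le> r" "r \<le> t" "f r = ?K + (2 * pi - \<alpha>)"
      using IVT'[of f T "?K + (2 * pi - \<alpha>)" t] gap ts cs[of T t] by (auto simp: not_less)
    have "\<bar>f s - 2 * pi * of_int (k + 1)\<bar> \<le> \<alpha>" by (rule trap2[of r]) (use r ts in auto)
    then show False using s al by (auto simp: algebra_simps abs_le_iff)
  qed
  have low: "f t \<ge> ?K - \<alpha>" if ts: "T \<le> t" for t
  proof (rule ccontr)
    assume *: "\<not> ?thesis"
    then obtain r where r: "T \<le> r" "r \<le> t" "f r = ?K + \<alpha>"
      using IVT2'[of f t "?K + \<alpha>" T] gap ts al cs[of T t] by auto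
    show False using trap[of r t] r * by (auto simp: abs_le_iff)
  qed
  \<comment> \<open>The supremum before the capture is attained, hence strictly below the upper arc;
    this makes the oscillation strictly less than \<open>2 * pi\<close>.\<close>
  obtain m where m: "m \<in> {T..s}" "\<And>t. t \<in> {T..s} \<Longrightarrow> f t \<le> f m"
    using continuous_attains_sup[of "{T..s}" f] s cs[of T s] by auto
  show ?thesis
  proof (rule osc_lt_2piI[of T "?K - \<alpha>" f "max (f m) (?K + \<alpha>)"])
    show "f t \<le> max (f m) (?K + \<alpha>)" if "t \<ge> T" for t
      using m(2)[of t] trap[of s t] s that by (cases "t \<le> s") (auto simp: le_max_iff_disj abs_le_iff)
    show "max (f m) (?K + \<alpha>) - (?K - \<alpha>) < 2 * pi"
      using up[of m] m(1) al by (auto simp: max_def)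
  qed (use low in auto)
qed

lemma osc_lt_2pi_minus:
  assumes "osc_lt_2pi (\<lambda>t. - f t) T" shows "osc_lt_2pi f T"
proof -
  obtain lo hi where "hi - lo < 2 * pi" "\<forall>t\<ge>T. lo \<le> - f t \<and> - f t \<le> hi"
    using osc_lt_2piD[OF assms] by blast
  then show ?thesis by (intro osc_lt_2piI[of T "- hi" f "- lo"]) force+
qed

text \<open>The condition \<open>cos \<ge> a\<close> describes disjoint arcs of length
  \<open>2 * \<alpha>\<close>, separated by gaps of length \<open>2 * pi - 2 * \<alpha>\<close>,
  both below \<open>2 * pi\<close>. A path stays in its arc, stays in its gap, or passes once from
  its gap into one of the two adjacent arcs.\<close>

lemma osc_lt_2pi_of_invariant_arc:
  fixes f :: "real \<Rightarrow> real"
  assumes cont: "continuous_on {T..} f" and a: "- 1 < a" "a < 1"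
    and inv: "\<And>u t. u \<ge> T \<Longrightarrow> cos (f u) \<ge> a \<Longrightarrow> t \<ge> u \<Longrightarrow> cos (f t) \<ge> a"
  shows "osc_lt_2pi f T"
proof -
  define \<alpha> where "\<alpha> = arccos a"
  have al: "0 < \<alpha>" "\<alpha> < pi" and ca: "cos \<alpha> = a"
    using a arccos_lt_bounded[of a] by (auto simp: \<alpha>_def cos_arccos)
  \<comment> \<open>Selects the period that begins at the left end of the arc around
    \<open>2 * pi * k\<close> and contains \<open>f T\<close>.\<close>
  define k where "k = \<lfloor>(f T + \<alpha>) / (2 * pi)\<rfloor>"
  let ?K = "2 * pi * of_int k"
  have "of_int k \<le> (f T + \<alpha>) / (2 * pi)" "(f T + \<alpha>) / (2 * pi) < of_int k + 1"
    by (simp_all add: k_def)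
  then have k: "?K - \<alpha> \<le> f T" "f T < ?K + (2 * pi - \<alpha>)"
    by (simp_all add: field_simps)
  have inv': "cos (f t) \<ge> cos \<alpha>" if "u \<ge> T" "cos (f u) \<ge> cos \<alpha>" "t \<ge> u" for u t
    using inv[of u t] that ca by simp
  have cosK: "cos x = cos (x - ?K)" for x
    by (simp add: cos_diff)
  consider (arc) "f T \<le> ?K + \<alpha>" | (lo) "f T > ?K + \<alpha>" "\<exists>u\<ge>T. f u \<le> ?K + \<alpha>"
    | (hi) "f T > ?K + \<alpha>" "\<exists>u\<ge>T. f u \<ge> ?K + (2 * pi - \<alpha>)"
    | (stay) "f T > ?K + \<alpha>" "\<forall>u\<ge>T. f u \<in> {?K + \<alpha>..?K + (2 * pi - \<alpha>)}"
    by force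
  then show ?thesis
  proof cases
    case arc
    then have st: "\<bar>f T - ?K\<bar> \<le> \<alpha>" using k by (auto simp: abs_le_iff)
    have "cos (f T) = cos \<bar>f T - ?K\<bar>" by (simp add: cosK[of "f T"])
    also have "\<dots> \<ge> cos \<alpha>" using st al by (intro cos_monotone_0_pi_le) auto
    finally have "cos (f T) \<ge> cos \<alpha>" .
    then have "cos (f t) \<ge> cos \<alpha>" if "t \<ge> T" for t using inv'[of T t] that by blast
    then have *: "\<bar>f t - ?K\<bar> \<le> \<alpha>" if "t \<ge> T" for t
      using cos_arc_trap[OF cont _ al(2) st _ that] al by simp
    show ?thesis
      by (rule osc_lt_2piI[of T "?K - \<alpha>" f "?K + \<alpha>"]) (use * al in \<open>force simp: abs_le_iff\<close>)+
  next
    case lo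
    then obtain u where "u \<ge> T" "f u \<le> ?K + \<alpha>" by blast
    from osc_lt_2pi_of_hit[OF cont al _ lo(1) k(2) this] inv' show ?thesis by blast
  next
    case hi
    then obtain u where u: "u \<ge> T" "f u \<ge> ?K + (2 * pi - \<alpha>)" by auto
    show ?thesis
    \<comment> \<open>Reflection turns the upper arc, centred at \<open>2 * pi * (k + 1)\<close>,
      into the lower arc of \<open>- f\<close>, whose index is \<open>- k - 1\<close>.\<close>
    proof (rule osc_lt_2pi_minus, rule osc_lt_2pi_of_hit[where k = "- k - 1" and u = u])
      show "continuous_on {T..} (\<lambda>t. - f t)" using cont by (intro continuous_intros)
      show "cos (- f t) \<ge> cos \<alpha>" if "r \<ge> T" "cos (- f r) \<ge> cos \<alpha>" "t \<ge> r" for r t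
        using inv'[of r t] that by simp
    qed (use al u k hi in \<open>auto simp: algebra_simps\<close>)
  next
    case stay
    then show ?thesis
      by (intro osc_lt_2piI[of T "?K + \<alpha>" f "?K + (2 * pi - \<alpha>)"]) (use al in auto)
  qed
qed

section \<open>Persistence of the order parameter\<close>

definition solves_from :: "real^'n \<Rightarrow> real \<Rightarrow> (real \<Rightarrow> real^'n) \<Rightarrow> bool" where
  "solves_from w \<kappa> y \<longleftrightarrow>
     (\<forall>t\<ge>0. (y has_vector_derivative kfield w \<kappa> (y t)) (at t within {0..}))"

lemma kfield_nth: "kfield w \<kappa> x $ i = w $ i - \<kappa> * orderR x * sin (x $ i)"
  by (simp add: kfield_def orderR_def)

lemma omega_norm_bound: "\<bar>w $ i\<bar> \<le> omega_norm w"
  by (auto simp: omega_norm_def intro!: Max_ge)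

lemma omega_norm_nonneg: "0 \<le> omega_norm w"
  using omega_norm_bound[of w undefined] by linarith

lemma orderR_eq: "orderR (x :: real^'n) = 1 + (\<Sum>j\<in>UNIV. cos (x $ j)) / real CARD('n)"
  by (simp add: orderR_def sum.distrib add_divide_distrib)

lemma orderR_bounds: "0 \<le> orderR x" "orderR x \<le> 2"
proof -
  have "(\<Sum>j\<in>UNIV. 1 + cos (x $ j)) \<le> (\<Sum>j\<in>(UNIV :: 'a set). 2)"
    by (intro sum_mono) (simp add: add_le_cancel_left[of 1 "cos _" 1, simplified])
  moreover have "0 \<le> (\<Sum>j\<in>UNIV. 1 + cos (x $ j))"
    by (intro sum_nonneg) (metis add.commute cos_ge_minus_one le_minus_iff minus_le_iff diff_ge_0_iff_ge diff_minus_eq_add)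
  ultimately show "0 \<le> orderR x" "orderR x \<le> 2" by (auto simp: orderR_def field_simps)
qed

lemma continuous_on_orderR: "continuous_on S orderR"
  unfolding orderR_def by (intro continuous_intros) auto

lemma abs_sin_gt:
  fixes x c :: real
  assumes "\<bar>cos x\<bar> < c"
  shows "\<bar>sin x\<bar> > sqrt (1 - c\<^sup>2)"
proof -
  have "(cos x)\<^sup>2 < c\<^sup>2" using assms by (metis abs_ge_zero power2_abs power_strict_mono zero_less_numeral)
  then have "1 - c\<^sup>2 < (sin x)\<^sup>2" by (simp add: sin_squared_eq)
  then have "sqrt (1 - c\<^sup>2) < sqrt ((sin x)\<^sup>2)" by (rule real_sqrt_less_mono)
  then show ?thesis by simp
qed

text \<open>For \<open>s = sin \<theta>\<^sub>i\<close>, \<open>\<omega> = w $ i\<close> and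
  \<open>k = \<kappa> * R\<close> the left-hand side is the time derivative of
  \<open>cos \<theta>\<^sub>i\<close>.\<close>

lemma drift_lower_bound:
  fixes s \<omega> W k b :: real
  assumes "\<bar>\<omega>\<bar> \<le> W" "b \<le> \<bar>s\<bar>" "0 \<le> k"
  shows "k * s\<^sup>2 - \<omega> * s \<ge> \<bar>s\<bar> * (k * b - W)"
proof -
  have "\<bar>s\<bar> * (k * b - W) \<le> \<bar>s\<bar> * (k * \<bar>s\<bar>) - \<bar>s\<bar> * W"
    using assms by (simp add: right_diff_distrib mult_left_mono)
  moreover have "\<omega> * s \<le> \<bar>s\<bar> * W"
    by (metis abs_ge_zero abs_le_D1 abs_mult assms(1) mult.commute mult_left_mono)
  moreover have "\<bar>s\<bar> * (k * \<bar>s\<bar>) = k * s\<^sup>2" by (simp add: power2_eq_square abs_mult_self_eq mult.left_commute)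
  ultimately show ?thesis by linarith
qed

context
  fixes w :: "real^'n" and \<kappa> :: real and y :: "real \<Rightarrow> real^'n"
  assumes kpos: "\<kappa> > 0" and sol: "solves_from w \<kappa> y"
begin

lemma sol_continuous: "continuous_on {0..} y"
  using sol by (auto simp: solves_from_def continuous_on_eq_continuous_within
      intro!: has_vector_derivative_continuous)

lemma sol_nth_continuous: "continuous_on {0..} (\<lambda>t. y t $ i)"
  using sol_continuous by (intro continuous_intros)

lemma order_continuous: "continuous_on {0..} (\<lambda>t. orderR (y t))"
  by (rule continuous_on_compose2[OF continuous_on_orderR[of UNIV] sol_continuous]) auto

lemma sol_nth_deriv:
  assumes "t \<ge> 0"
  shows "((\<lambda>t. y t $ i) has_real_derivative w $ i - \<kappa> * orderR (y t) * sin (y t $ i)) (at t within {0..})"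
proof -
  have "(y has_vector_derivative kfield w \<kappa> (y t)) (at t within {0..})"
    using sol assms by (simp add: solves_from_def)
  from bounded_linear.has_vector_derivative[OF bounded_linear_vec_nth this, of i]
  show ?thesis by (simp add: has_real_derivative_iff_has_vector_derivative kfield_nth)
qed

lemma cos_nth_deriv:
  assumes "u \<ge> 0" "t \<ge> u"
  shows "((\<lambda>t. cos (y t $ i)) has_real_derivative
     \<kappa> * orderR (y t) * (sin (y t $ i))\<^sup>2 - w $ i * sin (y t $ i)) (at t within {u..v})"
proof (rule DERIV_subset[where t = "{u..v}" and s = "{0..}"])
  show "((\<lambda>t. cos (y t $ i)) has_real_derivative
     \<kappa> * orderR (y t) * (sin (y t $ i))\<^sup>2 - w $ i * sin (y t $ i)) (at t within {0..})"
    by (rule derivative_eq_intros sol_nth_deriv refl)+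
      (use assms in \<open>auto simp: power2_eq_square algebra_simps\<close>)
qed (use assms in auto)

text \<open>\<open>\<bar>cos\<bar> < c\<close> forces
  \<open>\<bar>sin\<bar> > sqrt (1 - c\<^sup>2)\<close>, and then the coupling outweighs every
  natural frequency as soon as the order parameter is at least \<open>r\<close>.\<close>

lemma cos_deriv_nonneg:
  assumes "\<bar>cos (y t $ i)\<bar> < c" "\<kappa> * sqrt (1 - c\<^sup>2) * r \<ge> omega_norm w" "orderR (y t) \<ge> r" "c < 1"
  shows "\<kappa> * orderR (y t) * (sin (y t $ i))\<^sup>2 - w $ i * sin (y t $ i) \<ge> 0"
proof -
  have c: "0 \<le> sqrt (1 - c\<^sup>2)"
    using assms by (auto simp: abs_square_le_1)
  have "\<kappa> * sqrt (1 - c\<^sup>2) * r \<le> \<kappa> * sqrt (1 - c\<^sup>2) * orderR (y t)"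
    by (rule mult_left_mono[OF assms(3)]) (use c kpos in auto)
  then have "omega_norm w \<le> \<kappa> * orderR (y t) * sqrt (1 - c\<^sup>2)"
    using assms(2) by (simp add: mult.assoc mult.left_commute mult.commute)
  then have "0 \<le> \<bar>sin (y t $ i)\<bar> * (\<kappa> * orderR (y t) * sqrt (1 - c\<^sup>2) - omega_norm w)"
    by simp
  also have "\<dots> \<le> \<kappa> * orderR (y t) * (sin (y t $ i))\<^sup>2 - w $ i * sin (y t $ i)"
    using abs_sin_gt[OF assms(1)] kpos orderR_bounds(1)[of "y t"]
    by (intro drift_lower_bound omega_norm_bound) auto
  finally show ?thesis .
qed

lemma cos_level_invariant:
  assumes "0 \<le> u" "u \<le> v" "c < 1"
    and "\<And>t. u \<le> t \<Longrightarrow> t \<le> v \<Longrightarrow> orderR (y t) \<ge> r"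
    and "\<kappa> * sqrt (1 - c\<^sup>2) * r \<ge> omega_norm w"
    and "- c < a" "a \<le> c" "cos (y u $ i) \<ge> a"
  shows "cos (y v $ i) \<ge> a"
  by (rule upper_level_invariant[OF cos_nth_deriv cos_deriv_nonneg]) (use assms in auto)

lemma order_drop:
  assumes "0 \<le> u" "u \<le> v" "0 < c" "c < 1"
    and R: "\<And>t. u \<le> t \<Longrightarrow> t \<le> v \<Longrightarrow> orderR (y t) \<ge> r"
    and "\<kappa> * sqrt (1 - c\<^sup>2) * r \<ge> omega_norm w"
  shows "orderR (y v) \<ge> orderR (y u) - (1 - c)"
proof -
  have "cos (y v $ i) \<ge> cos (y u $ i) - (1 - c)" for i
    by (rule drop_bounded[OF cos_nth_deriv cos_deriv_nonneg]) (use assms in auto)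
  then have "(\<Sum>i\<in>UNIV. cos (y u $ i) - (1 - c)) \<le> (\<Sum>i\<in>UNIV. cos (y v $ i))"
    by (intro sum_mono)
  then have "(\<Sum>i\<in>UNIV. cos (y u $ i)) - real CARD('n) * (1 - c) \<le> (\<Sum>i\<in>UNIV. cos (y v $ i))"
    by (simp add: sum_subtractf)
  then have "((\<Sum>i\<in>UNIV. cos (y u $ i)) - real CARD('n) * (1 - c)) / real CARD('n)
      \<le> (\<Sum>i\<in>UNIV. cos (y v $ i)) / real CARD('n)" by (rule divide_right_mono) simp
  then show ?thesis by (simp add: orderR_eq diff_divide_distrib)
qed

text \<open>The drift estimate only needs \<^term>\<open>orderR\<close> slightly below the bound that it yields, so
  the set of times at which the bound holds is both closed and open.\<close>

lemma order_persists:
  assumes u: "0 \<le> u" "u \<le> v" and c: "0 < c" "c < 1"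
    and big: "\<kappa> * sqrt (1 - c\<^sup>2) * (orderR (y u) - (1 - c)) > omega_norm w"
  shows "orderR (y v) \<ge> orderR (y u) - (1 - c)"
proof (rule ccontr)
  define f where "f = (\<lambda>t. orderR (y t))"
  define r where "r = f u - (1 - c)"
  assume "\<not> ?thesis"
  then have fv: "f v < r" by (simp add: f_def r_def)
  define q where "q = \<kappa> * sqrt (1 - c\<^sup>2)"
  have q: "q > 0" using c kpos by (simp add: q_def abs_square_less_1)
  \<comment> \<open>\<open>e\<close> is the order parameter at which the drift estimate becomes
    available. The level \<open>b\<close> is above \<open>e\<close> and below the claimed bound
    \<open>r\<close>; up to the first time \<open>s\<close> at which \<open>f\<close> comes down to
    \<open>b\<close>, the estimate applies with \<open>b\<close> and gives
    \<open>f s \<ge> r\<close>.\<close>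
  define e where "e = omega_norm w / q"
  define b where "b = max (f v) ((e + r) / 2)"
  have "e < r" unfolding e_def
    using big q by (simp only: pos_divide_less_eq mult.commute r_def f_def q_def)
  then have b: "b < r" "f v \<le> b" "e < b" using fv by (auto simp: b_def less_max_iff_disj)
  have cont: "continuous_on {u..v} f" unfolding f_def
    using order_continuous by (rule continuous_on_subset) (use u in auto)
  define B where "B = {u..v} \<inter> f -` {..b}"
  have "closed B" unfolding B_def by (rule continuous_closed_preimage[OF cont]) auto
  then have "compact B" unfolding B_def by (metis bounded_closed_interval bounded_Int compact_eq_bounded_closed)
  moreover have "v \<in> B" using b u by (auto simp: B_def)
  ultimately obtain s where s: "s \<in> B" "\<And>t. t \<in> B \<Longrightarrow> s \<le> t"
    by (metis compact_attains_inf empty_iff)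
  have s': "u \<le> s" "s \<le> v" "f s \<le> b" using s(1) by (auto simp: B_def)
  have before: "f t > b" if "u \<le> t" "t < s" for t using s(2)[of t] that s' by (force simp: B_def)
  have "f s = b"
  proof (rule ccontr)
    assume "f s \<noteq> b"
    then have "f s < b" using s' by simp
    moreover have "f u > b" using b c by (simp add: r_def)
    moreover have "continuous_on {u..s} f" using cont by (rule continuous_on_subset) (use s' in auto)
    ultimately obtain r where "u \<le> r" "r \<le> s" "f r = b" using IVT2'[of f s b u] s' by auto
    then show False using before[of r] \<open>f s \<noteq> b\<close> by (cases "r = s") auto
  qed
  then have "f t \<ge> b" if "u \<le> t" "t \<le> s" for t using before[of t] that by (cases "t = s") auto
  moreover have "omega_norm w \<le> \<kappa> * sqrt (1 - c\<^sup>2) * b" using b q by (simp add: e_def pos_divide_less_eq q_def mult.commute)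
  ultimately have "f s \<ge> r"
    using order_drop[of u s c b] u s' c by (simp add: r_def f_def)
  then show False using \<open>f s = b\<close> b by simp
qed

text \<open>The half circle \<open>cos \<ge> 0\<close> is an invariant arc, because the level 0 lies
  inside the band given by \<open>c\<close>.\<close>

lemma osc_lt_2pi_of_order:
  assumes "0 \<le> T" "0 < c" "c < 1"
    and "\<And>t. T \<le> t \<Longrightarrow> orderR (y t) \<ge> r"
    and "\<kappa> * sqrt (1 - c\<^sup>2) * r \<ge> omega_norm w"
  shows "osc_lt_2pi (\<lambda>t. y t $ i) T"
proof (rule osc_lt_2pi_of_invariant_arc[of _ _ 0])
  show "continuous_on {T..} (\<lambda>t. y t $ i)"
    using sol_nth_continuous by (rule continuous_on_subset) (use assms in auto)
  show "0 \<le> cos (y t $ i)" if "T \<le> u" "0 \<le> cos (y u $ i)" "u \<le> t" for u t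
    by (rule cos_level_invariant[of u t c r]) (use assms that in auto)
qed auto

text \<open>While the cosine is within \<open>1 / sqrt 2\<close> of 0, the angle
  \<open>arccos (cos \<theta>\<^sub>i)\<close> shrinks at speed at least
  \<open>v = \<kappa> * r / sqrt 2 - omega_norm w\<close>. It has to go from at most
  \<open>3 * pi / 4\<close> down to \<open>pi / 4\<close>, a distance of at most
  \<open>pi / 2\<close>; once there it stays by invariance of the level.\<close>

lemma cos_reaches:
  assumes t0: "0 \<le> t0" and "\<tau> \<ge> 0"
    and R: "\<And>t. t0 \<le> t \<Longrightarrow> orderR (y t) \<ge> r"
    and c: "1 / sqrt 2 < c" "c < 1"
    and big: "\<kappa> * sqrt (1 - c\<^sup>2) * r \<ge> omega_norm w"
    and speed: "(\<kappa> * r / sqrt 2 - omega_norm w) * \<tau> \<ge> pi / 2"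
    and start: "cos (y t0 $ i) \<ge> - 1 / sqrt 2" and t: "t \<ge> t0 + \<tau>"
  shows "cos (y t $ i) \<ge> 1 / sqrt 2"
proof (cases "\<exists>u\<in>{t0..t0 + \<tau>}. cos (y u $ i) \<ge> 1 / sqrt 2")
  case True
  then obtain u where u: "t0 \<le> u" "u \<le> t0 + \<tau>" "cos (y u $ i) \<ge> 1 / sqrt 2" by auto
  have p: "0 < 1 / sqrt 2" by simp
  have cc: "- c < 1 / sqrt 2" using c p by linarith
  show ?thesis by (rule cos_level_invariant[of u t c r]) (use u t t0 c R big cc in auto)
next
  case False
  define v where "v = \<kappa> * r / sqrt 2 - omega_norm w"
  \<comment> \<open>Nonincreasing exactly when the angle shrinks at speed at least \<open>v\<close>.
    Folding by \<open>arccos\<close> makes the argument independent of the side of the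
    circle.\<close>
  define A where "A = (\<lambda>t. arccos (cos (y t $ i)) + v * t)"
  have p: "0 < 1 / sqrt 2" by simp
  then have cc: "- 1 / sqrt 2 \<le> c" using c by linarith
  have low: "cos (y u $ i) \<ge> - 1 / sqrt 2" if "t0 \<le> u" for u
    by (rule cos_level_invariant[of t0 u c r]) (use that t0 c cc R big start in auto)
  have cb: "\<bar>cos (y u $ i)\<bar> \<le> 1 / sqrt 2" "cos (y u $ i) < 1 / sqrt 2" if "t0 \<le> u" "u \<le> t0 + \<tau>" for u
    using low[of u] False that by (auto simp: abs_le_iff not_le minus_le_iff less_imp_le)
  have s2: "1 / sqrt 2 < 1" by simp
  have a45: "arccos (1 / sqrt 2) = pi / 4"
    by (rule arccos_unique) (auto simp: cos_45 field_simps)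
  have "A (t0 + \<tau>) \<le> A t0"
  proof (rule DERIV_nonpos_imp_decreasing_open[of t0 "t0 + \<tau>" A])
    show "t0 \<le> t0 + \<tau>" using assms by simp
    show "continuous_on {t0..t0 + \<tau>} A" unfolding A_def
      by (intro continuous_intros continuous_on_subset[OF sol_nth_continuous]) (use t0 in auto)
    fix u assume u: "t0 < u" "u < t0 + \<tau>"
    define g where "g = cos (y u $ i)"
    define s where "s = \<bar>sin (y u $ i)\<bar>"
    define d where "d = \<kappa> * orderR (y u) * (sin (y u $ i))\<^sup>2 - w $ i * sin (y u $ i)"
    have g: "\<bar>g\<bar> \<le> 1 / sqrt 2" using cb u by (simp add: g_def)
    have "g\<^sup>2 \<le> (1 / sqrt 2)\<^sup>2" using g by (metis abs_ge_zero power2_abs power_mono)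
    then have g2: "g\<^sup>2 \<le> 1 / 2" by (simp add: power_divide)
    have ss: "s = sqrt (1 - g\<^sup>2)" by (simp add: s_def g_def sin_squared_eq[symmetric])
    have s1: "s \<ge> 1 / sqrt 2"
    proof -
      have "sqrt (1 / 2) \<le> s" unfolding ss using g2 by (intro real_sqrt_le_mono) simp
      then show ?thesis by (simp add: real_sqrt_divide)
    qed
    have s0: "s > 0" using s1 by (smt (verit) divide_pos_pos real_sqrt_gt_zero)
    have "u \<ge> 0" using u t0 by simp
    have "((\<lambda>t. cos (y t $ i)) has_real_derivative d) (at u within {t0..t0 + \<tau>})"
      unfolding d_def by (rule cos_nth_deriv) (use u t0 in auto)
    then have dg: "((\<lambda>t. cos (y t $ i)) has_real_derivative d) (at u)"
      using at_within_interior[of u "{t0..t0 + \<tau>}"] u by auto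
    have "-1 < g" "g < 1" using g s2 by linarith+
    have "(A has_real_derivative (inverse (- sqrt (1 - g\<^sup>2)) * d + v)) (at u)"
      unfolding A_def
      by (rule derivative_eq_intros DERIV_chain2[OF DERIV_arccos] dg refl)+
        (use \<open>-1 < g\<close> \<open>g < 1\<close> dg in \<open>auto simp: g_def\<close>)
    moreover have "d \<ge> s * v"
    proof -
      have "v \<le> \<kappa> * orderR (y u) * (1 / sqrt 2) - omega_norm w"
        using mult_left_mono[OF R[of u], of \<kappa>] u kpos by (simp add: v_def divide_right_mono)
      then have "s * v \<le> s * (\<kappa> * orderR (y u) * (1 / sqrt 2) - omega_norm w)"
        using s0 by (intro mult_left_mono) auto
      also have "\<dots> \<le> d" unfolding d_def s_def
        using s1 kpos orderR_bounds(1)[of "y u"]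
        by (intro drift_lower_bound omega_norm_bound) (auto simp: s_def)
      finally show ?thesis .
    qed
    then have "inverse (- sqrt (1 - g\<^sup>2)) * d + v \<le> 0"
      using s0 unfolding ss[symmetric] by (simp add: field_simps)
    ultimately show "\<exists>y. (A has_real_derivative y) (at u) \<and> y \<le> 0" by blast
  qed
  then have "arccos (cos (y (t0 + \<tau>) $ i)) \<le> arccos (cos (y t0 $ i)) - v * \<tau>"
    by (simp add: A_def algebra_simps)
  moreover have "arccos (cos (y t0 $ i)) \<le> 3 * pi / 4"
  proof -
    have "arccos (cos (y t0 $ i)) \<le> arccos (- (1 / sqrt 2))"
      using start s2 by (intro arccos_le_arccos) auto
    also have "\<dots> = pi - pi / 4"
      using p s2 a45 by (subst arccos_minus) linarith+
    finally show ?thesis by simp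
  qed
  moreover have "arccos (cos (y (t0 + \<tau>) $ i)) > pi / 4"
  proof -
    have "arccos (1 / sqrt 2) < arccos (cos (y (t0 + \<tau>) $ i))"
      using cb[of "t0 + \<tau>"] assms(2) s2 by (intro arccos_less_arccos) (auto simp del: arccos_cos)
    then show ?thesis using a45 by simp
  qed
  ultimately have "v * \<tau> < pi / 2" by simp
  then show ?thesis using speed by (simp add: v_def)
qed

end

section \<open>The Euler scheme\<close>

lemma norm_le_card_mult:
  fixes x :: "real^'n"
  assumes "\<And>i. \<bar>x $ i\<bar> \<le> b"
  shows "norm x \<le> real CARD('n) * b"
proof -
  have "norm x \<le> (\<Sum>i\<in>UNIV. \<bar>x $ i\<bar>)" by (rule norm_le_l1_cart)
  also have "\<dots> \<le> (\<Sum>i\<in>(UNIV::'n set). b)" using assms by (intro sum_mono) auto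
  finally show ?thesis by simp
qed

lemma abs_cos_diff_le: "\<bar>cos x - cos y\<bar> \<le> \<bar>x - y :: real\<bar>"
proof -
  have "\<bar>sin ((x + y) / 2)\<bar> * \<bar>sin ((y - x) / 2)\<bar> \<le> 1 * \<bar>(y - x) / 2\<bar>"
    using abs_sin_x_le_abs_x[of "(y - x) / 2"] by (intro mult_mono) auto
  then have "2 * (\<bar>sin ((x + y) / 2)\<bar> * \<bar>sin ((y - x) / 2)\<bar>) \<le> \<bar>y - x\<bar>" by simp
  then show ?thesis by (simp add: cos_diff_cos abs_mult mult.assoc abs_minus_commute)
qed

lemma abs_sin_diff_le: "\<bar>sin x - sin y\<bar> \<le> \<bar>x - y :: real\<bar>"
  using abs_cos_diff_le[of "pi / 2 - x" "pi / 2 - y"] by (simp only: sin_cos_eq) (simp add: abs_minus_commute)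

lemma orderR_lipschitz: "\<bar>orderR x - orderR y\<bar> \<le> norm (x - y)"
  for x y :: "real^'n"
proof -
  have "\<bar>\<Sum>j\<in>UNIV. cos (x $ j) - cos (y $ j)\<bar> \<le> (\<Sum>j\<in>(UNIV::'n set). norm (x - y))"
  proof (rule order_trans[OF sum_abs sum_mono])
    fix j
    show "\<bar>cos (x $ j) - cos (y $ j)\<bar> \<le> norm (x - y)"
      using abs_cos_diff_le[of "x $ j" "y $ j"] component_le_norm_cart[of "x - y" j] by simp
  qed
  then show ?thesis
    by (simp add: orderR_eq diff_divide_distrib[symmetric] sum_subtractf[symmetric] field_simps)
qed

text \<open>The 3 is 1 + 2: \<open>orderR\<close> is 1-Lipschitz and bounded by 2, while
  \<open>sin\<close> is 1-Lipschitz and bounded by 1. The factor \<open>CARD('n)\<close> is the cost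
  of passing from components to the Euclidean norm.\<close>

lemma kfield_lipschitz:
  fixes x y w :: "real^'n"
  assumes "\<kappa> \<ge> 0"
  shows "norm (kfield w \<kappa> x - kfield w \<kappa> y) \<le> 3 * \<kappa> * real CARD('n) * norm (x - y)"
proof -
  have "\<bar>(kfield w \<kappa> x - kfield w \<kappa> y) $ i\<bar> \<le> 3 * \<kappa> * norm (x - y)" for i
  proof -
    have "\<bar>orderR x * sin (x $ i) - orderR y * sin (y $ i)\<bar>
        = \<bar>(orderR x - orderR y) * sin (x $ i) + orderR y * (sin (x $ i) - sin (y $ i))\<bar>"
      by (simp add: algebra_simps)
    also have "\<dots> \<le> \<bar>orderR x - orderR y\<bar> * \<bar>sin (x $ i)\<bar> + \<bar>orderR y\<bar> * \<bar>sin (x $ i) - sin (y $ i)\<bar>"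
      by (metis abs_mult abs_triangle_ineq)
    also have "\<dots> \<le> norm (x - y) * 1 + 2 * norm (x - y)"
      using orderR_lipschitz[of x y] orderR_bounds[of y] abs_sin_diff_le[of "x $ i" "y $ i"]
        component_le_norm_cart[of "x - y" i]
      by (intro add_mono mult_mono) auto
    finally have "\<bar>orderR x * sin (x $ i) - orderR y * sin (y $ i)\<bar> \<le> 3 * norm (x - y)" by simp
    then have "\<kappa> * \<bar>orderR y * sin (y $ i) - orderR x * sin (x $ i)\<bar> \<le> \<kappa> * (3 * norm (x - y))"
      using assms by (intro mult_left_mono) (auto simp: abs_minus_commute)
    moreover have "\<bar>(kfield w \<kappa> x - kfield w \<kappa> y) $ i\<bar>
        = \<kappa> * \<bar>orderR y * sin (y $ i) - orderR x * sin (x $ i)\<bar>"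
    proof -
      have "(kfield w \<kappa> x - kfield w \<kappa> y) $ i = \<kappa> * (orderR y * sin (y $ i) - orderR x * sin (x $ i))"
        by (simp add: kfield_nth right_diff_distrib mult.assoc)
      then show ?thesis using assms by (simp add: abs_mult)
    qed
    ultimately show ?thesis by simp
  qed
  from norm_le_card_mult[of _ "3 * \<kappa> * norm (x - y)", OF this] show ?thesis by (simp add: mult_ac)
qed

lemma kfield_bounded:
  fixes x w :: "real^'n"
  assumes "\<kappa> \<ge> 0"
  shows "norm (kfield w \<kappa> x) \<le> real CARD('n) * (omega_norm w + 2 * \<kappa>)"
proof (rule norm_le_card_mult)
  fix i
  have "\<bar>\<kappa> * orderR x * sin (x $ i)\<bar> \<le> \<kappa> * 2 * 1"
    unfolding abs_mult using assms orderR_bounds[of x] by (intro mult_mono) auto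
  then show "\<bar>kfield w \<kappa> x $ i\<bar> \<le> omega_norm w + 2 * \<kappa>"
    using omega_norm_bound[of w i] by (simp add: kfield_nth)
qed

section \<open>Convergence of the Euler scheme for a bounded Lipschitz field\<close>

definition euler :: "('a::real_vector \<Rightarrow> 'a) \<Rightarrow> real \<Rightarrow> 'a \<Rightarrow> 'a" where
  "euler F h x = x + h *\<^sub>R F x"

context
  fixes F :: "'a::real_normed_vector \<Rightarrow> 'a" and L K :: real
  assumes lip: "\<And>x y. norm (F x - F y) \<le> L * norm (x - y)"
    and bnd: "\<And>x. norm (F x) \<le> K" and L0: "L \<ge> 0" and K0: "K \<ge> 0"
begin

lemma euler_lipschitz:
  assumes "h \<ge> 0"
  shows "norm (euler F h x - euler F h y) \<le> (1 + h * L) * norm (x - y)"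
proof -
  have "norm (euler F h x - euler F h y) = norm ((x - y) + h *\<^sub>R (F x - F y))"
    by (simp add: euler_def algebra_simps)
  also have "\<dots> \<le> norm (x - y) + h * norm (F x - F y)"
    using norm_triangle_ineq[of "x - y" "h *\<^sub>R (F x - F y)"] assms by simp
  also have "\<dots> \<le> norm (x - y) + h * (L * norm (x - y))"
    using assms lip by (intro add_left_mono mult_left_mono)
  finally show ?thesis by (simp add: algebra_simps)
qed

lemma euler_funpow_lipschitz:
  assumes "h \<ge> 0"
  shows "norm ((euler F h ^^ k) x - (euler F h ^^ k) y) \<le> (1 + h * L) ^ k * norm (x - y)"
proof (induction k)
  case (Suc k)
  have "norm ((euler F h ^^ Suc k) x - (euler F h ^^ Suc k) y)
      \<le> (1 + h * L) * norm ((euler F h ^^ k) x - (euler F h ^^ k) y)"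
    using euler_lipschitz[OF assms] by simp
  also have "\<dots> \<le> (1 + h * L) * ((1 + h * L) ^ k * norm (x - y))"
    using Suc assms L0 by (intro mult_left_mono) auto
  finally show ?case by (simp add: mult.assoc)
qed simp

context
  fixes y :: "real \<Rightarrow> 'a"
  assumes sol: "\<And>t. t \<ge> 0 \<Longrightarrow> (y has_vector_derivative F (y t)) (at t within {0..})"
begin

lemma solution_speed:
  assumes "0 \<le> s" "s \<le> t"
  shows "norm (y t - y s) \<le> K * (t - s)"
proof -
  have "norm (y t - y s) \<le> K * norm (t - s)"
  proof (rule differentiable_bound[of "{s..t}" y "\<lambda>r d. d *\<^sub>R F (y r)"])
    fix r assume r: "r \<in> {s..t}"
    show "(y has_derivative (\<lambda>d. d *\<^sub>R F (y r))) (at r within {s..t})"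
      using has_vector_derivative_within_subset[OF sol[of r], of "{s..t}"] r assms
      by (auto simp: has_vector_derivative_def)
    show "onorm (\<lambda>d. d *\<^sub>R F (y r)) \<le> K"
      by (rule onorm_le) (simp add: mult.commute[of K] mult_left_mono bnd)
  qed (use assms in auto)
  then show ?thesis using assms by simp
qed

text \<open>The derivative of \<open>z\<close> compares the field along the solution with its value
  at the start. Within time \<open>h\<close> the solution moves by at most \<open>K * h\<close>, so
  this derivative is at most \<open>L * K * h\<close>.\<close>

lemma euler_local_error:
  assumes "0 \<le> t" "0 \<le> h"
  shows "norm (y (t + h) - euler F h (y t)) \<le> L * K * h\<^sup>2"
proof -
  define z where "z = (\<lambda>s. y s - (s - t) *\<^sub>R F (y t))"
  have "norm (z (t + h) - z t) \<le> L * K * h * norm (t + h - t)"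
  proof (rule differentiable_bound[of "{t..t + h}" z "\<lambda>r d. d *\<^sub>R (F (y r) - F (y t))"])
    fix r assume r: "r \<in> {t..t + h}"
    have "(y has_vector_derivative F (y r)) (at r within {t..t + h})"
      using has_vector_derivative_within_subset[OF sol[of r], of "{t..t + h}"] r assms by auto
    then have "(z has_vector_derivative F (y r) - F (y t)) (at r within {t..t + h})"
      unfolding z_def by (auto intro!: derivative_eq_intros)
    then show "(z has_derivative (\<lambda>d. d *\<^sub>R (F (y r) - F (y t)))) (at r within {t..t + h})"
      by (simp add: has_vector_derivative_def)
    have "norm (F (y r) - F (y t)) \<le> L * (K * (r - t))"
      using lip[of "y r" "y t"] mult_left_mono[OF solution_speed[of t r] L0] r assms by auto
    also have "\<dots> \<le> L * (K * h)" using r L0 K0 by (intro mult_left_mono) auto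
    finally show "onorm (\<lambda>d. d *\<^sub>R (F (y r) - F (y t))) \<le> L * K * h"
      by (intro onorm_le) (auto simp: mult.commute[of _ "\<bar>_\<bar>"] mult.assoc intro!: mult_left_mono)
  qed (use assms in auto)
  then show ?thesis using assms
    by (simp add: z_def euler_def power2_eq_square algebra_simps)
qed

text \<open>The error recursion \<open>e' \<le> (1 + h * L) * e + L * K * h\<^sup>2\<close>, started
  at 0 and taken with equality, has this right-hand side as its exact solution.\<close>

lemma euler_global_error:
  assumes "0 \<le> h"
  shows "norm ((euler F h ^^ k) (y 0) - y (real k * h)) \<le> ((1 + h * L) ^ k - 1) * (K * h)"
proof (induction k)
  case (Suc k)
  have e: "real (Suc k) * h = real k * h + h" by (simp add: algebra_simps)
  have "norm ((euler F h ^^ Suc k) (y 0) - y (real (Suc k) * h))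
      \<le> norm (euler F h ((euler F h ^^ k) (y 0)) - euler F h (y (real k * h)))
        + norm (y (real k * h + h) - euler F h (y (real k * h)))"
    unfolding e using norm_triangle_ineq4[of "euler F h ((euler F h ^^ k) (y 0)) - euler F h (y (real k * h))"
        "y (real k * h + h) - euler F h (y (real k * h))"] by simp
  also have "\<dots> \<le> (1 + h * L) * (((1 + h * L) ^ k - 1) * (K * h)) + L * K * h\<^sup>2"
    using Suc euler_local_error[of "real k * h" h] assms L0
    by (intro add_mono order_trans[OF euler_lipschitz] mult_left_mono) auto
  also have "\<dots> = ((1 + h * L) ^ Suc k - 1) * (K * h)"
    by (simp add: algebra_simps power2_eq_square)
  finally show ?case .
qed simp

lemma euler_error:
  assumes "0 \<le> h" "real k * h \<le> T"
  shows "norm ((euler F h ^^ k) (y 0) - y (real k * h)) \<le> exp (L * T) * K * h"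
proof -
  have "(1 + h * L) ^ k \<le> exp (h * L) ^ k"
    using assms L0 by (intro power_mono exp_ge_add_one_self) auto
  also have "\<dots> = exp (L * (real k * h))" by (simp add: exp_of_nat_mult[symmetric] mult_ac)
  also have "\<dots> \<le> exp (L * T)" using assms L0 by (simp add: mult_left_mono)
  finally have "((1 + h * L) ^ k - 1) * (K * h) \<le> exp (L * T) * (K * h)"
    using K0 assms by (intro mult_right_mono) auto
  then show ?thesis using euler_global_error[OF assms(1), of k] by (simp add: mult.assoc)
qed

lemma euler_tendsto:
  assumes "t \<ge> 0"
  shows "(\<lambda>n. (euler F (t / real n) ^^ n) (y 0)) \<longlonglongrightarrow> y t"
proof -
  have "(\<lambda>n. exp (L * t) * K * (t / real n)) \<longlonglongrightarrow> 0" by real_asymp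
  moreover have "\<forall>\<^sub>F n in sequentially.
      norm ((euler F (t / real n) ^^ n) (y 0) - y t) \<le> exp (L * t) * K * (t / real n)"
    using eventually_gt_at_top[of "0::nat"]
  proof eventually_elim
    case (elim n)
    show ?case using euler_error[of "t / real n" n t] elim assms by simp
  qed
  ultimately have "(\<lambda>n. (euler F (t / real n) ^^ n) (y 0) - y t) \<longlonglongrightarrow> 0"
    by (rule Lim_null_comparison[rotated])
  then show ?thesis by (simp add: LIM_zero_iff)
qed

end

text \<open>The Gronwall estimate, as the limit of the Lipschitz bounds for the Euler iterates.
  Equal initial values give uniqueness.\<close>

lemma solution_lipschitz:
  assumes y: "\<And>t. t \<ge> 0 \<Longrightarrow> (y has_vector_derivative F (y t)) (at t within {0..})"
    and z: "\<And>t. t \<ge> 0 \<Longrightarrow> (z has_vector_derivative F (z t)) (at t within {0..})"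
    and t: "t \<ge> 0"
  shows "norm (y t - z t) \<le> exp (L * t) * norm (y 0 - z 0)"
proof (rule tendsto_upperbound)
  show "(\<lambda>n. norm ((euler F (t / real n) ^^ n) (y 0) - (euler F (t / real n) ^^ n) (z 0)))
      \<longlonglongrightarrow> norm (y t - z t)"
    by (intro tendsto_intros euler_tendsto y z t)
  show "\<forall>\<^sub>F n in sequentially. norm ((euler F (t / real n) ^^ n) (y 0) - (euler F (t / real n) ^^ n) (z 0))
      \<le> exp (L * t) * norm (y 0 - z 0)"
    using eventually_gt_at_top[of "0::nat"]
  proof eventually_elim
    case (elim n)
    have "(1 + t / real n * L) ^ n \<le> exp (t / real n * L) ^ n"
      using t L0 by (intro power_mono exp_ge_add_one_self) auto
    also have "\<dots> = exp (L * t)" using elim by (simp add: exp_of_nat_mult[symmetric] mult_ac)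
    finally have "(1 + t / real n * L) ^ n * norm (y 0 - z 0) \<le> exp (L * t) * norm (y 0 - z 0)"
      by (intro mult_right_mono) auto
    then show ?case using euler_funpow_lipschitz[of "t / real n" n "y 0" "z 0"] t by simp
  qed
qed simp

text \<open>Two points with the same image differ by \<open>h\<close> times the difference of the
  field values, which is a contraction when \<open>h * L < 1\<close>.\<close>

lemma euler_inj:
  assumes "0 \<le> h" "h * L < 1"
  shows "inj (euler F h)"
proof (rule injI)
  fix x y assume "euler F h x = euler F h y"
  then have "x - y = h *\<^sub>R (F y - F x)" by (simp add: euler_def algebra_simps)
  then have "norm (x - y) \<le> h * (L * norm (x - y))"
    using mult_left_mono[OF lip[of y x] assms(1)] assms(1) by (simp add: norm_minus_commute)
  then have "norm (x - y) * (1 - h * L) \<le> 0" by (simp add: algebra_simps)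
  then have "norm (x - y) \<le> 0" using assms by (simp add: mult_le_0_iff)
  then show "x = y" by simp
qed

end

section \<open>Volume of the sublevel sets of the order parameter\<close>

lemma cosh_even_series: "(\<lambda>k. x ^ (2 * k) / fact (2 * k)) sums cosh (x::real)"
proof -
  have "(\<lambda>k. if even (2 * k) then x ^ (2 * k) /\<^sub>R fact (2 * k) else 0) sums cosh x"
    using cosh_converges[of x] by (subst sums_mono_reindex[where g = "\<lambda>k. 2 * k"]) (auto simp: strict_mono_def)
  then show ?thesis by (simp add: divide_inverse mult.commute)
qed

lemma fact_double_ge: "2 ^ k * fact k \<le> (fact (2 * k) :: real)"
proof (induction k)
  case (Suc k)
  have "2 ^ Suc k * fact (Suc k) = (2 * (real k + 1)) * (2 ^ k * fact k)" by simp
  also have "\<dots> \<le> (2 * (real k + 1)) * ((2 * real k + 1) * fact (2 * k))"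
    using Suc by (intro mult_left_mono order_trans[OF Suc]) (auto simp: algebra_simps)
  also have "\<dots> = fact (2 * Suc k)" by (simp add: algebra_simps)
  finally show ?case .
qed simp

text \<open>The sub-Gaussian estimate, by comparing the two power series term by term.\<close>

lemma cosh_le_exp_half_square: "cosh x \<le> exp (x\<^sup>2 / 2)" for x :: real
proof (rule sums_le[OF _ cosh_even_series])
  show "(\<lambda>k. (x\<^sup>2 / 2) ^ k /\<^sub>R fact k) sums exp (x\<^sup>2 / 2)" by (rule exp_converges)
  fix k
  have "x ^ (2 * k) / fact (2 * k) \<le> x ^ (2 * k) / (2 ^ k * fact k)"
    using fact_double_ge[of k] by (intro divide_left_mono) auto
  also have "\<dots> = (x\<^sup>2 / 2) ^ k /\<^sub>R fact k"
    unfolding power_divide power_mult by (simp add: divide_inverse mult.commute)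
  finally show "x ^ (2 * k) / fact (2 * k) \<le> (x\<^sup>2 / 2) ^ k /\<^sub>R fact k" .
qed

text \<open>Term by term: for \<open>k \<ge> 1\<close> the even powers satisfy
  \<open>c ^ (2 * k) + s ^ (2 * k) \<le> c\<^sup>2 + s\<^sup>2 = 1\<close>; the additional 1 on the
  right pays for the two constant terms on the left.\<close>

lemma cosh_sum_le:
  fixes c s l :: real
  assumes "c\<^sup>2 + s\<^sup>2 = 1"
  shows "cosh (l * c) + cosh (l * s) \<le> 1 + cosh l"
proof (rule sums_le)
  show "(\<lambda>k. (l * c) ^ (2 * k) / fact (2 * k) + (l * s) ^ (2 * k) / fact (2 * k))
      sums (cosh (l * c) + cosh (l * s))"
    by (intro sums_add cosh_even_series)
  show "(\<lambda>k. (if k = 0 then 1 else 0) + l ^ (2 * k) / fact (2 * k)) sums (1 + cosh l)"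
    using sums_single[of 0 "\<lambda>_. 1::real"] by (intro sums_add cosh_even_series) simp
  fix k :: nat
  have p: "c ^ (2 * k) + s ^ (2 * k) \<le> 1" if "k > 0"
  proof -
    have "c\<^sup>2 \<le> 1" "s\<^sup>2 \<le> 1" using assms by (smt (verit) zero_le_power2)+
    then have "(c\<^sup>2) ^ k \<le> (c\<^sup>2) ^ 1" "(s\<^sup>2) ^ k \<le> (s\<^sup>2) ^ 1"
      using that by (intro power_decreasing; simp)+
    then show ?thesis using assms by (simp add: power_mult)
  qed
  show "(l * c) ^ (2 * k) / fact (2 * k) + (l * s) ^ (2 * k) / fact (2 * k)
      \<le> (if k = 0 then 1 else 0) + l ^ (2 * k) / fact (2 * k)"
  proof (cases "k = 0")
    case False
    then have "l ^ (2 * k) * (c ^ (2 * k) + s ^ (2 * k)) \<le> l ^ (2 * k) * 1"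
      using p by (intro mult_left_mono) auto
    then show ?thesis using False
      by (simp add: power_mult_distrib add_divide_distrib[symmetric] distrib_left[symmetric] divide_right_mono)
  qed simp
qed

lemma integral_periodic_shift:
  fixes f :: "real \<Rightarrow> real"
  assumes cont: "continuous_on UNIV f" and per: "\<And>x. f (x + 2 * pi) = f x" and c: "0 \<le> c" "c \<le> 2 * pi"
  shows "integral {-pi..pi} (\<lambda>x. f (x + c)) = integral {-pi..pi} f"
proof -
  have i: "f integrable_on {a..b}" for a b
    by (intro integrable_continuous_interval continuous_on_subset[OF cont]) auto
  have "integral {-pi..pi} (\<lambda>x. f (x + c)) = integral {-pi + c..pi + c} f"
    using integral_shift_real_ivl[of "-pi + c" c "pi + c" f] by simp
  also have "\<dots> = integral {-pi + c..pi} f + integral {pi..pi + c} f"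
    using c i by (intro Henstock_Kurzweil_Integration.integral_combine[symmetric]) auto
  also have "integral {pi..pi + c} f = integral {-pi..-pi + c} (\<lambda>x. f (x + 2 * pi))"
    using integral_shift_real_ivl[of pi "2 * pi" "pi + c" f] by (simp add: algebra_simps)
  also have "\<dots> = integral {-pi..-pi + c} f" by (simp add: per)
  also have "integral {-pi + c..pi} f + integral {-pi..-pi + c} f = integral {-pi..pi} f"
    using c i by (subst add.commute, intro Henstock_Kurzweil_Integration.integral_combine) auto
  finally show ?thesis .
qed

text \<open>Averaging over the four quarter turns reduces the bound to the pointwise estimate
  \<open>(cosh (l cos x) + cosh (l sin x)) / 2 \<le> cosh\<^sup>2 (l / 2) \<le> exp (l\<^sup>2 / 4)\<close>.\<close>

lemma integral_exp_cos_le: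
  fixes l :: real
  shows "integral {-pi..pi} (\<lambda>x. exp (l * cos x)) \<le> 2 * pi * exp (l\<^sup>2 / 4)"
proof -
  define f where "f = (\<lambda>x. exp (l * cos x))"
  have cont: "continuous_on S f" for S unfolding f_def by (intro continuous_intros)
  have per: "f (x + 2 * pi) = f x" for x by (simp add: f_def)
  have int: "(\<lambda>x. f (x + c)) integrable_on {-pi..pi}" for c
    unfolding f_def by (intro integrable_continuous_interval continuous_intros)
  have shift: "integral {-pi..pi} (\<lambda>x. f (x + c)) = integral {-pi..pi} f" if "0 \<le> c" "c \<le> 2 * pi" for c
    using integral_periodic_shift[OF cont per that] .
  have "4 * integral {-pi..pi} f = integral {-pi..pi}
      (\<lambda>x. ((f x + f (x + pi / 2)) + f (x + pi)) + f (x + 3 * pi / 2))"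
    using shift[of "pi / 2"] shift[of pi] shift[of "3 * pi / 2"] int[of 0] int
    by (subst Henstock_Kurzweil_Integration.integral_add; (intro Henstock_Kurzweil_Integration.integrable_add)?; simp)+
  also have "\<dots> \<le> integral {-pi..pi} (\<lambda>x. 4 * exp (l\<^sup>2 / 4))"
  proof (rule integral_le)
    show "(\<lambda>x. ((f x + f (x + pi / 2)) + f (x + pi)) + f (x + 3 * pi / 2)) integrable_on {-pi..pi}"
      using int[of 0] int by (intro Henstock_Kurzweil_Integration.integrable_add) auto
    fix x
    have "cos (x + 3 * pi / 2) = sin x"
      using cos_add[of "x + pi" "pi / 2"] by (simp add: add.assoc field_simps sin_add)
    then have "f x + f (x + pi / 2) + f (x + pi) + f (x + 3 * pi / 2)
        = 2 * (cosh (l * cos x) + cosh (l * sin x))"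
      by (simp add: f_def cosh_field_def cos_add add_divide_distrib)
    also have "\<dots> \<le> 2 * (1 + cosh l)" using cosh_sum_le[of "cos x" "sin x" l] by simp
    also have "\<dots> = 4 * (cosh (l / 2))\<^sup>2"
      using cosh_double_cosh[of "l / 2"] by simp
    also have "\<dots> \<le> 4 * (exp ((l / 2)\<^sup>2 / 2))\<^sup>2"
      using cosh_le_exp_half_square[of "l / 2"] by (intro mult_left_mono power_mono) auto
    also have "\<dots> = 4 * exp (l\<^sup>2 / 4)" by (simp add: power2_eq_square exp_add[symmetric])
    finally show "f x + f (x + pi / 2) + f (x + pi) + f (x + 3 * pi / 2) \<le> 4 * exp (l\<^sup>2 / 4)" .
  qed auto
  also have "\<dots> = 4 * (2 * pi * exp (l\<^sup>2 / 4))" by simp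
  finally show ?thesis by (simp add: f_def)
qed

text \<open>Jordan's inequality: a concave function lies above its chord, here the one over
  \<open>{0..pi / 2}\<close>.\<close>

lemma jordan_sin_ge:
  fixes x :: real
  assumes "0 \<le> x" "x \<le> pi / 2"
  shows "2 * x / pi \<le> sin x"
proof -
  have "convex_on {0..pi / 2} (\<lambda>x. - sin x)"
  proof (rule f''_ge0_imp_convex)
    show "((\<lambda>x. - sin x) has_real_derivative - cos x) (at x)" for x
      by (auto intro!: derivative_eq_intros)
    show "((\<lambda>x. - cos x) has_real_derivative sin x) (at x)" for x
      by (auto intro!: derivative_eq_intros)
  qed (auto intro!: sin_ge_zero)
  from convex_onD[OF this, of "2 * x / pi" 0 "pi / 2"] assms
  show ?thesis by (simp add: field_simps)
qed

text \<open>After a shift by \<open>pi\<close> the exponent is \<open>- l * (1 - cos x)\<close>,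
  where \<open>1 - cos x\<close> is twice the square of \<open>sin (x / 2)\<close>; Jordan's
  inequality bounds the exponent by \<open>- 2 * l * (x / pi)\<^sup>2\<close>. The resulting
  majorant is a Gaussian of standard deviation \<open>\<sigma>\<close> and total mass
  \<open>C\<close>.\<close>

lemma integral_exp_one_plus_cos_le:
  fixes l :: real
  assumes "l > 0"
  shows "integral {-pi..pi} (\<lambda>x. exp (- l * (1 + cos x))) \<le> pi * sqrt (pi / (2 * l))"
proof -
  define \<sigma> where "\<sigma> = pi / (2 * sqrt l)"
  have s: "\<sigma> > 0" using assms by (simp add: \<sigma>_def)
  have s2: "2 * \<sigma>\<^sup>2 = pi\<^sup>2 / (2 * l)" using assms by (simp add: \<sigma>_def power_divide power_mult_distrib)
  define C where "C = pi * sqrt (pi / (2 * l))"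
  have C: "sqrt (2 * pi * \<sigma>\<^sup>2) = C"
  proof -
    have "2 * pi * \<sigma>\<^sup>2 = pi\<^sup>2 * (pi / (2 * l))" using s2 by (simp add: field_simps)
    then show ?thesis unfolding C_def by (simp only: real_sqrt_mult real_sqrt_abs) simp
  qed
  define f where "f = (\<lambda>x. exp (- l * (1 + cos x)))"
  have cont: "continuous_on S f" for S unfolding f_def by (intro continuous_intros)
  have per: "f (x + 2 * pi) = f x" for x by (simp add: f_def)
  have gint: "((\<lambda>x. C * normal_density 0 \<sigma> x) has_integral C) UNIV"
  proof -
    have "has_bochner_integral lborel (normal_density 0 \<sigma>) 1"
      using s by (simp add: has_bochner_integral_iff)
    then have "(normal_density 0 \<sigma> has_integral 1) UNIV"
      using has_integral_integral_lborel[of "normal_density 0 \<sigma>"] by (simp add: has_bochner_integral_iff)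
    from has_integral_mult_right[OF this, of C] show ?thesis by simp
  qed
  have "integral {-pi..pi} f = integral {-pi..pi} (\<lambda>x. f (x + pi))"
    using integral_periodic_shift[OF cont per, of pi] by simp
  also have "\<dots> \<le> integral {-pi..pi} (\<lambda>x. C * normal_density 0 \<sigma> x)"
  proof (rule integral_le)
    show "(\<lambda>x. f (x + pi)) integrable_on {-pi..pi}"
      unfolding f_def by (intro integrable_continuous_interval continuous_intros)
    show "(\<lambda>x. C * normal_density 0 \<sigma> x) integrable_on {-pi..pi}"
      unfolding normal_density_def by (intro integrable_continuous_interval continuous_intros) (use s in auto)
    fix x assume x: "x \<in> {-pi..pi}"
    have jordan: "\<bar>x\<bar> / pi \<le> sin (\<bar>x\<bar> / 2)"
      using jordan_sin_ge[of "\<bar>x\<bar> / 2"] x by auto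
    have "(x / pi)\<^sup>2 = (\<bar>x\<bar> / pi)\<^sup>2" by (simp add: power_divide)
    also have "\<dots> \<le> (sin (\<bar>x\<bar> / 2))\<^sup>2" using jordan by (intro power_mono) auto
    also have "\<dots> = (sin (x / 2))\<^sup>2" by (cases "x \<ge> 0") auto
    finally have "2 * (x / pi)\<^sup>2 \<le> 1 - cos x" using cos_double_sin[of "x / 2"] by simp
    then have "l * (2 * (x / pi)\<^sup>2) \<le> l * (1 - cos x)" using assms by (intro mult_left_mono) auto
    moreover have "x\<^sup>2 / (2 * \<sigma>\<^sup>2) = l * (2 * (x / pi)\<^sup>2)"
      unfolding s2 using assms by (simp add: field_simps)
    ultimately have "f (x + pi) \<le> exp (- x\<^sup>2 / (2 * \<sigma>\<^sup>2))"
      by (simp add: f_def)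
    also have "\<dots> = C * normal_density 0 \<sigma> x"
      using s by (simp add: normal_density_def C[symmetric])
    finally show "f (x + pi) \<le> C * normal_density 0 \<sigma> x" .
  qed
  also have "\<dots> \<le> integral UNIV (\<lambda>x. C * normal_density 0 \<sigma> x)"
  proof (rule integral_subset_le)
    show "(\<lambda>x. C * normal_density 0 \<sigma> x) integrable_on {-pi..pi}"
      unfolding normal_density_def by (intro integrable_continuous_interval continuous_intros) (use s in auto)
    show "(\<lambda>x. C * normal_density 0 \<sigma> x) integrable_on UNIV" using gint by (rule has_integral_integrable)
  qed (use assms in \<open>auto simp: C_def\<close>)
  also have "\<dots> = C" using gint by (rule integral_unique)
  finally show ?thesis by (simp add: f_def C_def)
qed

section \<open>Exponential moments over the cube and Chernoff bounds\<close>

lemma nn_integral_cube_prod: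
  fixes f :: "real \<Rightarrow> real"
  assumes cont: "continuous_on UNIV f" and nn: "\<And>x. f x \<ge> 0"
  shows "(\<integral>\<^sup>+x\<in>(cube :: (real^'n) set). ennreal (\<Prod>i\<in>UNIV. f (x $ i)) \<partial>lborel)
      = ennreal (integral {-pi..pi} f ^ CARD('n))"
proof -
  define g where "g = (\<lambda>t. ennreal (f t) * indicator {-pi..pi} t)"
  have [measurable]: "f \<in> borel_measurable borel" using cont by (rule borel_measurable_continuous_onI)
  have B: "(Basis :: (real^'n) set) = (\<lambda>i. axis i 1) ` UNIV" by (auto simp: Basis_vec_def)
  have inj: "inj (\<lambda>i::'n. axis i (1::real))" by (auto simp: inj_on_def axis_eq_axis)
  have int: "f integrable_on {-pi..pi}"
    by (intro integrable_continuous_interval continuous_on_subset[OF cont]) auto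
  then have g: "(\<integral>\<^sup>+t. g t \<partial>lborel) = ennreal (integral {-pi..pi} f)"
    unfolding g_def by (intro nn_integral_has_integral_lebesgue') (auto simp: nn integrable_integral)
  have pw: "ennreal (\<Prod>i\<in>UNIV. f (x $ i)) * indicator cube x = (\<Prod>b\<in>Basis. g (x \<bullet> b))" for x :: "real^'n"
  proof -
    have "(\<Prod>b\<in>Basis. g (x \<bullet> b)) = (\<Prod>i\<in>UNIV. g (x $ i))"
      unfolding B by (subst prod.reindex[OF inj]) (simp add: inner_axis)
    also have "\<dots> = (\<Prod>i\<in>UNIV. ennreal (f (x $ i))) * (\<Prod>i\<in>UNIV. indicator {-pi..pi} (x $ i))"
      by (simp add: g_def prod.distrib)
    also have "(\<Prod>i\<in>UNIV. indicator {-pi..pi} (x $ i)) = (indicator cube x :: ennreal)"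
      by (auto simp: indicator_def cube_def prod_eq_1_iff)
    finally show ?thesis by (simp add: prod_ennreal nn)
  qed
  have "(\<integral>\<^sup>+x\<in>(cube :: (real^'n) set). ennreal (\<Prod>i\<in>UNIV. f (x $ i)) \<partial>lborel)
      = (\<Prod>b\<in>(Basis :: (real^'n) set). \<integral>\<^sup>+t. g t \<partial>lborel)"
    unfolding pw by (intro nn_integral_lborel_prod) (auto simp: g_def)
  also have "\<dots> = ennreal (integral {-pi..pi} f) ^ CARD('n)"
    unfolding g by simp
  also have "\<dots> = ennreal (integral {-pi..pi} f ^ CARD('n))"
    by (rule ennreal_power) (rule Henstock_Kurzweil_Integration.integral_nonneg[OF int nn])
  finally show ?thesis .
qed

text \<open>Half-open, so that its translates by \<open>2 * pi\<close> times integer vectors tile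
  the space; it has the same volume as \<open>cube\<close>.\<close>

definition torus_box :: "(real^'n) set" where
  "torus_box = {x. \<forall>i. x $ i \<in> {-pi..<pi}}"

lemma cube_eq_cbox: "cube = cbox (\<chi> i. - pi) (\<chi> i. pi)"
  by (auto simp: cube_def mem_box_cart)

lemma closed_cube: "closed cube" and cube_borel [measurable]: "cube \<in> sets borel"
  by (auto simp: cube_eq_cbox)

lemma measure_cube: "measure lebesgue (cube :: (real^'n) set) = (2 * pi) ^ CARD('n)"
  unfolding cube_eq_cbox
  by (subst measure_completion) (auto simp: content_cbox_cart interval_ne_empty_cart less_imp_le[OF pi_gt_zero])

lemma torus_box_borel [measurable]: "(torus_box :: (real^'n) set) \<in> sets borel"
proof -
  have m: "(\<lambda>x :: real^'n. x $ i) \<in> borel_measurable borel" for i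
    by (intro borel_measurable_continuous_onI continuous_intros)
  have "torus_box = (\<Inter>i. (\<lambda>x :: real^'n. x $ i) -` {-pi..<pi} \<inter> space borel)"
    by (auto simp: torus_box_def)
  also have "\<dots> \<in> sets borel" using measurable_sets[OF m, of "{-pi..<pi}"]
    by (intro sets.countable_INT') auto
  finally show ?thesis .
qed

lemma torus_box_subset_cube: "torus_box \<subseteq> cube"
  by (auto simp: torus_box_def cube_def less_imp_le)

lemma lmeasurable_cube: "cube \<in> lmeasurable" by (simp add: cube_eq_cbox)

lemma lmeasurable_torus_box: "torus_box \<in> lmeasurable"
  by (rule fmeasurableI2[OF lmeasurable_cube torus_box_subset_cube]) auto

lemma measure_torus_box: "measure lebesgue (torus_box :: (real^'n) set) = (2 * pi) ^ CARD('n)"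
proof -
  let ?b = "box (\<chi> i. - pi) (\<chi> i. pi) :: (real^'n) set"
  have "?b \<subseteq> torus_box" by (auto simp: torus_box_def mem_box_cart less_imp_le)
  then have "measure lebesgue ?b \<le> measure lebesgue (torus_box :: (real^'n) set)"
    by (intro measure_mono_fmeasurable lmeasurable_torus_box) auto
  moreover have "measure lebesgue ?b = measure lebesgue (cube :: (real^'n) set)"
    unfolding cube_eq_cbox by (simp add: measure_lborel_box_eq measure_lborel_cbox_eq)
  moreover have "measure lebesgue (torus_box :: (real^'n) set) \<le> measure lebesgue (cube :: (real^'n) set)"
    by (intro measure_mono_fmeasurable lmeasurable_cube torus_box_subset_cube) auto
  ultimately show ?thesis by (simp add: measure_cube)
qed

lemma nmeas_markov:
  fixes S :: "(real^'n) set"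
  assumes [measurable]: "S \<in> sets borel" and "S \<subseteq> cube"
    and ge: "\<And>x. x \<in> S \<Longrightarrow> 1 \<le> g x" and nn: "\<And>x. 0 \<le> g x" and "0 \<le> c"
    and int: "(\<integral>\<^sup>+x\<in>cube. ennreal (g x) \<partial>lborel) \<le> ennreal (c * (2 * pi) ^ CARD('n))"
  shows "nmeas S \<le> c"
proof -
  have "emeasure lborel S = (\<integral>\<^sup>+x. indicator S x \<partial>lborel)" by simp
  also have "\<dots> \<le> (\<integral>\<^sup>+x\<in>cube. ennreal (g x) \<partial>lborel)"
    using assms(2) ge by (intro nn_integral_mono) (auto simp: indicator_def)
  also note int
  finally have "emeasure lborel S \<le> ennreal (c * (2 * pi) ^ CARD('n))" .
  then have "measure lborel S \<le> c * (2 * pi) ^ CARD('n)"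
    using assms(5) unfolding measure_def
    by (metis enn2real_ennreal enn2real_mono ennreal_less_top mult_nonneg_nonneg pi_ge_zero zero_le_numeral zero_le_power)
  then show ?thesis by (simp add: nmeas_def field_simps)
qed

lemma nn_integral_cube_exp_cos:
  "(\<integral>\<^sup>+x\<in>(cube::(real^'n) set). ennreal (exp (l * (\<Sum>i\<in>UNIV. cos (x $ i)))) \<partial>lborel)
     \<le> ennreal ((2 * pi * exp (l\<^sup>2 / 4)) ^ CARD('n))"
proof -
  have "(\<integral>\<^sup>+x\<in>(cube::(real^'n) set). ennreal (exp (l * (\<Sum>i\<in>UNIV. cos (x $ i)))) \<partial>lborel)
      = (\<integral>\<^sup>+x\<in>(cube::(real^'n) set). ennreal (\<Prod>i\<in>UNIV. exp (l * cos (x $ i))) \<partial>lborel)"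
    by (simp add: exp_sum[symmetric] sum_distrib_left)
  also have "\<dots> = ennreal (integral {-pi..pi} (\<lambda>t. exp (l * cos t)) ^ CARD('n))"
    by (rule nn_integral_cube_prod) (auto intro!: continuous_intros)
  also have "\<dots> \<le> ennreal ((2 * pi * exp (l\<^sup>2 / 4)) ^ CARD('n))"
    by (intro ennreal_leI power_mono integral_exp_cos_le Henstock_Kurzweil_Integration.integral_nonneg
        integrable_continuous_interval continuous_intros) auto
  finally show ?thesis .
qed

lemma nn_integral_cube_exp_order:
  assumes "l > 0"
  shows "(\<integral>\<^sup>+x\<in>(cube::(real^'n) set). ennreal (exp (- l * real CARD('n) * orderR x)) \<partial>lborel)
     \<le> ennreal ((pi * sqrt (pi / (2 * l))) ^ CARD('n))"
proof -
  have "- l * real CARD('n) * orderR x = (\<Sum>i\<in>UNIV. - l * (1 + cos (x $ i)))" for x :: "real^'n"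
    by (simp add: orderR_def sum_negf) (simp add: sum_distrib_left)
  then have "(\<integral>\<^sup>+x\<in>(cube::(real^'n) set). ennreal (exp (- l * real CARD('n) * orderR x)) \<partial>lborel)
      = (\<integral>\<^sup>+x\<in>(cube::(real^'n) set). ennreal (\<Prod>i\<in>UNIV. exp (- l * (1 + cos (x $ i)))) \<partial>lborel)"
    by (simp only: exp_sum[OF finite])
  also have "\<dots> = ennreal (integral {-pi..pi} (\<lambda>t. exp (- l * (1 + cos t))) ^ CARD('n))"
    by (rule nn_integral_cube_prod) (auto intro!: continuous_intros)
  also have "\<dots> \<le> ennreal ((pi * sqrt (pi / (2 * l))) ^ CARD('n))"
    by (intro ennreal_leI power_mono integral_exp_one_plus_cos_le assms Henstock_Kurzweil_Integration.integral_nonneg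
        integrable_continuous_interval continuous_intros) auto
  finally show ?thesis .
qed

text \<open>The Chernoff bound for the volume of \<open>R \<le> s\<close>: the product of
  \<open>exp (N * l * s)\<close> and \<open>(sqrt (pi / (2 * l)) / 2) ^ N\<close> is smallest at
  \<open>l = 1 / (2 * s)\<close>, and this is its value there.\<close>

definition cap_bound :: "nat \<Rightarrow> real \<Rightarrow> real" where
  "cap_bound N s = (sqrt (pi * exp 1 * s) / 2) ^ N"

lemma cap_bound_nonneg: "s \<ge> 0 \<Longrightarrow> cap_bound N s \<ge> 0"
  by (simp add: cap_bound_def)

lemma cap_bound_laplace:
  assumes "s > 0"
  shows "exp (real N / 2) * (pi * sqrt (pi / (2 * (1 / (2 * s))))) ^ N = cap_bound N s * (2 * pi) ^ N"
proof -
  have "exp (real N / 2) = exp (1 / 2) ^ N" by (simp add: exp_of_nat_mult[symmetric])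
  moreover have "exp (1 / 2) = sqrt (exp (1::real))"
  proof -
    have "exp (1::real) = (exp (1 / 2))\<^sup>2" by (simp add: power2_eq_square exp_add[symmetric])
    then show ?thesis by simp
  qed
  moreover have "sqrt (exp 1) * (pi * sqrt (pi / (2 * (1 / (2 * s))))) = sqrt (pi * exp 1 * s) / 2 * (2 * pi)"
    using assms by (simp add: real_sqrt_mult)
  ultimately show ?thesis unfolding cap_bound_def by (simp only: power_mult_distrib[symmetric])
qed

lemma orderR_measurable [measurable]: "orderR \<in> borel_measurable borel"
  by (rule borel_measurable_continuous_onI[OF continuous_on_orderR])

lemma order_sublevel_borel [measurable]: "{x\<in>torus_box. orderR x \<le> a} \<in> sets borel"
  by (simp add: Collect_conj_eq)

text \<open>On the set the sum of the cosines is at most \<open>- N * \<delta>\<close>. The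
  exponential weight with parameter \<open>l\<close> bounds its volume by
  \<open>exp (N * (l\<^sup>2 / 4 - l * \<delta>))\<close>, which is smallest at
  \<open>l = 2 * \<delta>\<close>.\<close>

lemma nmeas_order_hoeffding:
  assumes "\<delta> \<ge> 0"
  shows "nmeas {x\<in>(torus_box::(real^'n) set). orderR x \<le> 1 - \<delta>} \<le> exp (- real CARD('n) * \<delta>\<^sup>2)"
proof (rule nmeas_markov[where g = "\<lambda>x. exp (- 2 * real CARD('n) * \<delta>\<^sup>2) * exp (- (2 * \<delta>) * (\<Sum>i\<in>UNIV. cos (x $ i)))"])
  fix x :: "real^'n" assume "x \<in> {x\<in>torus_box. orderR x \<le> 1 - \<delta>}"
  then have "(\<Sum>i\<in>UNIV. cos (x $ i)) \<le> - \<delta> * real CARD('n)" by (simp add: orderR_eq field_simps)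
  then have "(2 * \<delta>) * (\<Sum>i\<in>UNIV. cos (x $ i)) \<le> (2 * \<delta>) * (- \<delta> * real CARD('n))"
    using assms by (intro mult_left_mono) auto
  then show "1 \<le> exp (- 2 * real CARD('n) * \<delta>\<^sup>2) * exp (- (2 * \<delta>) * (\<Sum>i\<in>UNIV. cos (x $ i)))"
    by (simp add: exp_add[symmetric] power2_eq_square mult_ac)
next
  have "(\<integral>\<^sup>+x\<in>(cube::(real^'n) set). ennreal (exp (- 2 * real CARD('n) * \<delta>\<^sup>2) * exp (- (2 * \<delta>) * (\<Sum>i\<in>UNIV. cos (x $ i)))) \<partial>lborel)
      = ennreal (exp (- 2 * real CARD('n) * \<delta>\<^sup>2)) *
        (\<integral>\<^sup>+x\<in>(cube::(real^'n) set). ennreal (exp (- (2 * \<delta>) * (\<Sum>i\<in>UNIV. cos (x $ i)))) \<partial>lborel)"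
    by (subst nn_integral_cmult[symmetric]) (auto simp: ennreal_mult mult.assoc)
  also have "\<dots> \<le> ennreal (exp (- 2 * real CARD('n) * \<delta>\<^sup>2)) * ennreal ((2 * pi * exp ((- (2 * \<delta>))\<^sup>2 / 4)) ^ CARD('n))"
    by (intro mult_left_mono nn_integral_cube_exp_cos) auto
  also have "\<dots> = ennreal (exp (- real CARD('n) * \<delta>\<^sup>2) * (2 * pi) ^ CARD('n))"
    by (simp add: ennreal_mult[symmetric] power_mult_distrib exp_of_nat_mult[symmetric] exp_add[symmetric] mult_ac)
  finally show "(\<integral>\<^sup>+x\<in>(cube::(real^'n) set). ennreal (exp (- 2 * real CARD('n) * \<delta>\<^sup>2) * exp (- (2 * \<delta>) * (\<Sum>i\<in>UNIV. cos (x $ i)))) \<partial>lborel)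
      \<le> ennreal (exp (- real CARD('n) * \<delta>\<^sup>2) * (2 * pi) ^ CARD('n))" .
qed (use torus_box_subset_cube in auto)

text \<open>Any function dominated by the optimal weight of \<open>cap_bound\<close> inherits the
  bound. This serves both the volume of \<open>R \<le> s\<close> and the integrated deficit of
  \<open>R\<close> below \<open>s\<close>.\<close>

lemma nn_integral_order_cap:
  fixes g :: "real^'n \<Rightarrow> real"
  assumes "s > 0" "c \<ge> 0" and g: "\<And>x. g x \<le> c * (exp (real CARD('n) / 2) * exp (- (1 / (2 * s)) * real CARD('n) * orderR x))"
  shows "(\<integral>\<^sup>+x\<in>cube. ennreal (g x) \<partial>lborel) \<le> ennreal (c * cap_bound CARD('n) s * (2 * pi) ^ CARD('n))"
proof -
  let ?e = "\<lambda>x::real^'n. exp (- (1 / (2 * s)) * real CARD('n) * orderR x)"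
  have "(\<integral>\<^sup>+x\<in>cube. ennreal (g x) \<partial>lborel)
      \<le> (\<integral>\<^sup>+x. ennreal (c * exp (real CARD('n) / 2)) * (ennreal (?e x) * indicator cube x) \<partial>lborel)"
    using g assms by (intro nn_integral_mono) (auto simp: indicator_def ennreal_mult[symmetric] mult.assoc intro!: ennreal_leI)
  also have "\<dots> = ennreal (c * exp (real CARD('n) / 2)) * (\<integral>\<^sup>+x\<in>cube. ennreal (?e x) \<partial>lborel)"
    by (intro nn_integral_cmult) auto
  also have "\<dots> \<le> ennreal (c * exp (real CARD('n) / 2)) * ennreal ((pi * sqrt (pi / (2 * (1 / (2 * s))))) ^ CARD('n))"
    using assms by (intro mult_left_mono nn_integral_cube_exp_order) auto
  also have "\<dots> = ennreal (c * (exp (real CARD('n) / 2) * (pi * sqrt (pi / (2 * (1 / (2 * s))))) ^ CARD('n)))"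
    using assms by (subst ennreal_mult[symmetric]) (auto simp: mult.assoc)
  finally show ?thesis unfolding cap_bound_laplace[OF assms(1)] by (simp add: mult.assoc)
qed

lemma nmeas_order_cap:
  assumes "s > 0"
  shows "nmeas {x\<in>(torus_box::(real^'n) set). orderR x \<le> s} \<le> cap_bound CARD('n) s"
proof (rule nmeas_markov[where g = "\<lambda>x. exp (real CARD('n) / 2) * exp (- (1 / (2 * s)) * real CARD('n) * orderR x)"])
  fix x :: "real^'n" assume "x \<in> {x\<in>torus_box. orderR x \<le> s}"
  then have "orderR x / (2 * s) \<le> 1 / 2" using assms by (simp add: field_simps)
  then have "real CARD('n) * (orderR x / (2 * s)) \<le> real CARD('n) * (1 / 2)" by (intro mult_left_mono) auto
  then show "1 \<le> exp (real CARD('n) / 2) * exp (- (1 / (2 * s)) * real CARD('n) * orderR x)"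
    by (simp add: exp_add[symmetric] mult_ac)
next
  show "(\<integral>\<^sup>+x\<in>(cube::(real^'n) set). ennreal (exp (real CARD('n) / 2) * exp (- (1 / (2 * s)) * real CARD('n) * orderR x)) \<partial>lborel)
      \<le> ennreal (cap_bound CARD('n) s * (2 * pi) ^ CARD('n))"
    using nn_integral_order_cap[of s 1 "\<lambda>x::real^'n. exp (real CARD('n) / 2) * exp (- (1 / (2 * s)) * real CARD('n) * orderR x)", OF assms]
    by simp
qed (use torus_box_subset_cube assms cap_bound_nonneg in auto)

text \<open>A bound for the mean over the cube of the positive part of \<open>1 - R / s\<close>. The
  gain \<open>2 / (N * exp 1)\<close> over the volume bound keeps it well below the volume of the
  slow set in the power-law argument.\<close>

definition cap_deficit :: "nat \<Rightarrow> real \<Rightarrow> real" where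
  "cap_deficit N s = 2 / (real N * exp 1) * cap_bound N s"

lemma integral_order_deficit:
  assumes s: "s > 0"
  shows "integral (cube::(real^'n) set) (\<lambda>x. s - min (orderR x) s) \<le> s * cap_deficit CARD('n) s * (2 * pi) ^ CARD('n)"
proof -
  let ?N = "real CARD('n)"
  let ?g = "\<lambda>x::real^'n. s - min (orderR x) s"
  have int: "?g integrable_on cube" unfolding cube_eq_cbox
    by (intro integrable_continuous continuous_intros continuous_on_orderR)
  have "ennreal (integral cube ?g) = (\<integral>\<^sup>+x\<in>cube. ennreal (?g x) \<partial>lborel)"
    using int by (intro nn_integral_has_integral_lebesgue'[symmetric]) (auto simp: integrable_integral)
  also have "\<dots> \<le> ennreal (2 * s / (?N * exp 1) * cap_bound CARD('n) s * (2 * pi) ^ CARD('n))"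
  proof (rule nn_integral_order_cap[OF s])
    fix x :: "real^'n"
    \<comment> \<open>\<open>u \<le> exp (u - 1)\<close> for \<open>u = N (s - R) / (2 s)\<close>\<close>
    define u where "u = ?N * (s - orderR x) / (2 * s)"
    have u: "s - orderR x = 2 * s / ?N * u" using s by (simp add: u_def)
    have "u \<le> exp (u - 1)" using exp_ge_add_one_self[of "u - 1"] by simp
    then have "max 0 u \<le> exp (u - 1)" by (simp add: max_def)
    then have "2 * s / ?N * max 0 u \<le> 2 * s / ?N * exp (u - 1)"
      using s by (intro mult_left_mono) auto
    moreover have "?g x = 2 * s / ?N * max 0 u"
    proof (cases "orderR x \<le> s")
      case True
      then have "u \<ge> 0" using s by (simp add: u_def)
      then show ?thesis using True u by simp
    next
      case False
      then have "u \<le> 0" using s by (simp add: u_def field_simps mult_left_mono)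
      then show ?thesis using False by simp
    qed
    moreover have "exp (u - 1) = exp (?N / 2) * exp (- (1 / (2 * s)) * ?N * orderR x) / exp 1"
      unfolding exp_diff exp_add[symmetric] using s by (simp add: u_def field_simps)
    ultimately show "?g x \<le> 2 * s / (?N * exp 1) * (exp (?N / 2) * exp (- (1 / (2 * s)) * ?N * orderR x))"
      by simp
  qed (use s in auto)
  finally show ?thesis
    using s cap_bound_nonneg[of s "CARD('n)"] by (subst (asm) ennreal_le_iff) (auto simp: cap_deficit_def mult_ac)
qed

text \<open>The deficit of \<open>R\<close> below \<open>s\<close> is nonnegative, so over
  \<open>C\<close> it is at most what it is over the whole cube; the bound depends on
  \<open>C\<close> only through its volume.\<close>

lemma integral_min_order_ge:
  fixes C :: "(real^'n) set"
  assumes C: "C \<in> lmeasurable" "C \<subseteq> cube" and s: "s > 0"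
  shows "(\<lambda>x. min (orderR x) s) integrable_on C"
    and "integral C (\<lambda>x. min (orderR x) s) \<ge> s * (measure lebesgue C - cap_deficit CARD('n) s * (2 * pi) ^ CARD('n))"
proof -
  let ?g = "\<lambda>x::real^'n. s - min (orderR x) s"
  have gnn: "?g x \<ge> 0" for x by simp
  have int: "?g integrable_on cube" unfolding cube_eq_cbox
    by (intro integrable_continuous continuous_intros continuous_on_orderR)
  then have "?g absolutely_integrable_on cube" by (rule nonnegative_absolutely_integrable_1) auto
  then have "?g absolutely_integrable_on C" using fmeasurableD[OF C(1)] C(2) by (rule set_integrable_subset)
  then have gC: "?g integrable_on C" by (simp add: absolutely_integrable_on_def)
  have sC: "(\<lambda>x. s) integrable_on C" using C by (simp add: integrable_on_const)
  show mi: "(\<lambda>x. min (orderR x) s) integrable_on C"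
    using integrable_diff[OF sC gC] by simp
  have "integral C (\<lambda>x. s) = s * measure lebesgue C"
    using C lmeasure_integral[of C] integral_mult_right[of C s "\<lambda>x. 1"] by simp
  moreover have "integral C (\<lambda>x. s) - integral C (\<lambda>x. min (orderR x) s) = integral C ?g"
    using sC mi by (rule Henstock_Kurzweil_Integration.integral_diff[symmetric])
  moreover have "integral C ?g \<le> integral cube ?g" by (rule integral_subset_le) (use C gC int in auto)
  moreover note integral_order_deficit[OF s, where 'n = 'n]
  ultimately show "integral C (\<lambda>x. min (orderR x) s) \<ge> s * (measure lebesgue C - cap_deficit CARD('n) s * (2 * pi) ^ CARD('n))"
    by (simp add: algebra_simps)
qed

section \<open>The Jacobian of an Euler step\<close>

text \<open>The remainder constant depends only on \<open>K\<close> and \<open>S\<close>, so that it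
  serves all points of a set and all step sizes at once.\<close>

lemma prod_one_plus_expansion:
  fixes K :: real and S :: "'a set"
  assumes "finite S" "K \<ge> 0"
  shows "\<exists>C\<ge>0. \<forall>a h. 0 \<le> h \<and> h \<le> 1 \<and> (\<forall>i\<in>S. \<bar>a i\<bar> \<le> K)
    \<longrightarrow> \<bar>(\<Prod>i\<in>S. 1 + h * a i) - (1 + h * (\<Sum>i\<in>S. a i))\<bar> \<le> C * h\<^sup>2"
  using assms(1)
proof (induction S rule: finite_induct)
  case empty
  show ?case by (intro exI[of _ 0]) auto
next
  case (insert j S)
  then obtain C where C0: "C \<ge> 0" and C: "\<And>a h. 0 \<le> h \<Longrightarrow> h \<le> 1 \<Longrightarrow> (\<forall>i\<in>S. \<bar>a i\<bar> \<le> K)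
    \<Longrightarrow> \<bar>(\<Prod>i\<in>S. 1 + h * a i) - (1 + h * (\<Sum>i\<in>S. a i))\<bar> \<le> C * h\<^sup>2" by blast
  define D where "D = K * (real (card S) * K) + (1 + K) * C"
  have "\<bar>(\<Prod>i\<in>insert j S. 1 + h * a i) - (1 + h * (\<Sum>i\<in>insert j S. a i))\<bar> \<le> D * h\<^sup>2"
    if h: "0 \<le> h" "h \<le> 1" and a: "\<forall>i\<in>insert j S. \<bar>a i\<bar> \<le> K" for a :: "'a \<Rightarrow> real" and h :: real
  proof -
    define p s where "p = (\<Prod>i\<in>S. 1 + h * a i)" and "s = (\<Sum>i\<in>S. a i)"
    have e: "\<bar>p - (1 + h * s)\<bar> \<le> C * h\<^sup>2" unfolding p_def s_def using C[of h a] h a by auto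
    have s: "\<bar>s\<bar> \<le> real (card S) * K"
      unfolding s_def using a by (intro order_trans[OF sum_abs] sum_bounded_above) auto
    have "(\<Prod>i\<in>insert j S. 1 + h * a i) - (1 + h * (\<Sum>i\<in>insert j S. a i))
        = h\<^sup>2 * (a j * s) + (1 + h * a j) * (p - (1 + h * s))"
      using insert(1,2) by (simp add: p_def s_def algebra_simps power2_eq_square)
    also have "\<bar>\<dots>\<bar> \<le> h\<^sup>2 * (\<bar>a j\<bar> * \<bar>s\<bar>) + \<bar>1 + h * a j\<bar> * \<bar>p - (1 + h * s)\<bar>"
      by (rule order_trans[OF abs_triangle_ineq]) (simp add: abs_mult)
    also have "\<dots> \<le> h\<^sup>2 * (K * (real (card S) * K)) + (1 + K) * (C * h\<^sup>2)"
    proof (intro add_mono mult_left_mono mult_mono)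
      have "\<bar>h * a j\<bar> \<le> 1 * K" unfolding abs_mult using h a by (intro mult_mono) auto
      then show "\<bar>1 + h * a j\<bar> \<le> 1 + K" by linarith
    qed (use a s e assms in auto)
    also have "\<dots> = D * h\<^sup>2" by (simp add: D_def algebra_simps)
    finally show ?thesis .
  qed
  moreover have "D \<ge> 0" using C0 assms by (simp add: D_def)
  ultimately show ?case by blast
qed

text \<open>In the Leibniz formula every permutation except \<open>id\<close> moves at least two
  indices, and its product then has two off-diagonal factors of size \<open>O(h)\<close>. The
  diagonal product supplies the trace.\<close>

lemma det_expansion:
  fixes K :: real
  assumes K: "K \<ge> 0"
  shows "\<exists>C\<ge>0. \<forall>(A::real^'n^'n) h. 0 \<le> h \<and> h \<le> 1 \<and> (\<forall>i j. \<bar>A $ i $ j\<bar> \<le> K)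
    \<longrightarrow> \<bar>det (mat 1 + h *\<^sub>R A) - (1 + h * (\<Sum>i\<in>UNIV. A $ i $ i))\<bar> \<le> C * h\<^sup>2"
proof -
  obtain C where C0: "C \<ge> 0" and C: "\<And>a h. 0 \<le> h \<Longrightarrow> h \<le> 1 \<Longrightarrow> (\<forall>i\<in>(UNIV::'n set). \<bar>a i\<bar> \<le> K)
    \<Longrightarrow> \<bar>(\<Prod>i\<in>UNIV. 1 + h * a i) - (1 + h * (\<Sum>i\<in>UNIV. a i))\<bar> \<le> C * h\<^sup>2"
    using prod_one_plus_expansion[OF finite[of "UNIV::'n set"] K] by metis
  let ?P = "{p. p permutes (UNIV::'n set)}"
  define D where "D = C + real (card ?P) * (1 + K) ^ CARD('n)"
  have "\<bar>det (mat 1 + h *\<^sub>R A) - (1 + h * (\<Sum>i\<in>UNIV. A $ i $ i))\<bar> \<le> D * h\<^sup>2"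
    if h: "0 \<le> h" "h \<le> 1" and A: "\<forall>i j. \<bar>A $ i $ j\<bar> \<le> K" for A :: "real^'n^'n" and h
  proof -
    define M where "M = mat 1 + h *\<^sub>R A"
    define T where "T = (\<lambda>p. of_int (sign p) * (\<Prod>i\<in>UNIV. M $ i $ p i))"
    have fin: "finite ?P" by (rule finite_permutations) simp
    have M: "M $ i $ j = (if i = j then 1 else 0) + h * A $ i $ j" for i j by (simp add: M_def mat_def)
    have hA: "\<bar>h * A $ i $ j\<bar> \<le> h * (1 + K)" "\<bar>h * A $ i $ j\<bar> \<le> K" for i j
    proof -
      have "\<bar>A $ i $ j\<bar> \<le> 1 + K" using A[rule_format, of i j] by linarith
      then show "\<bar>h * A $ i $ j\<bar> \<le> h * (1 + K)" using h by (simp add: abs_mult mult_left_mono)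
      have "h * \<bar>A $ i $ j\<bar> \<le> 1 * K" using h A by (intro mult_mono) auto
      then show "\<bar>h * A $ i $ j\<bar> \<le> K" using h by (simp add: abs_mult)
    qed
    have Tp: "\<bar>T p\<bar> \<le> (1 + K) ^ CARD('n) * h\<^sup>2" if p: "p permutes UNIV" "p \<noteq> id" for p
    proof -
      obtain i where i: "p i \<noteq> i" using p by (auto simp: fun_eq_iff)
      \<comment> \<open>The image of a moved index is moved as well, by injectivity; this gives the
        second factor \<open>h\<close>.\<close>
      define j where "j = p i"
      have j: "p j \<noteq> j" "i \<noteq> j" using i permutes_inj[OF p(1)] by (auto simp: j_def inj_eq)
      have "\<bar>T p\<bar> = (\<Prod>k\<in>UNIV. \<bar>M $ k $ p k\<bar>)"
        by (simp add: T_def abs_mult abs_prod sign_def)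
      also have "\<dots> \<le> (\<Prod>k\<in>UNIV. (1 + K) * (if k \<in> {i, j} then h else 1))"
      proof (rule prod_mono, intro conjI)
        fix k
        show "\<bar>M $ k $ p k\<bar> \<le> (1 + K) * (if k \<in> {i, j} then h else 1)"
        proof (cases "k \<in> {i, j}")
          case True
          then have "p k \<noteq> k" using i j by auto
          then show ?thesis using True hA(1)[of k "p k"] by (auto simp: M mult.commute)
        next
          case False
          then show ?thesis using hA(2)[of k "p k"] by (auto simp: M)
        qed
      qed auto
      also have "\<dots> = (1 + K) ^ CARD('n) * (\<Prod>k\<in>UNIV. if k \<in> {i, j} then h else 1)"
        by (simp add: prod.distrib)
      also have "(\<Prod>k\<in>UNIV. if k \<in> {i, j} then h else 1) = (\<Prod>k\<in>{i, j}. h)"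
        by (subst prod.inter_restrict[symmetric]) auto
      also have "\<dots> = h\<^sup>2" using j by (simp add: power2_eq_square)
      finally show ?thesis .
    qed
    have "det M = T id + (\<Sum>p\<in>?P - {id}. T p)"
      unfolding det_def T_def[symmetric] using fin by (subst sum.remove[of _ id]) (auto simp: permutes_id)
    moreover have "\<bar>\<Sum>p\<in>?P - {id}. T p\<bar> \<le> real (card ?P) * ((1 + K) ^ CARD('n) * h\<^sup>2)"
    proof -
      have "\<bar>\<Sum>p\<in>?P - {id}. T p\<bar> \<le> (\<Sum>p\<in>?P - {id}. (1 + K) ^ CARD('n) * h\<^sup>2)"
        using Tp by (intro order_trans[OF sum_abs] sum_mono) auto
      also have "\<dots> \<le> (\<Sum>p\<in>?P. (1 + K) ^ CARD('n) * h\<^sup>2)"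
        using fin K by (intro sum_mono2) auto
      finally show ?thesis by simp
    qed
    moreover have "T id = (\<Prod>i\<in>UNIV. 1 + h * A $ i $ i)" by (simp add: T_def M)
    moreover have "\<bar>(\<Prod>i\<in>UNIV. 1 + h * A $ i $ i) - (1 + h * (\<Sum>i\<in>UNIV. A $ i $ i))\<bar> \<le> C * h\<^sup>2"
      using C[of h "\<lambda>i. A $ i $ i"] h A by auto
    ultimately show ?thesis unfolding M_def[symmetric] by (simp add: D_def algebra_simps)
  qed
  moreover have "D \<ge> 0" using C0 K by (simp add: D_def)
  ultimately show ?thesis by blast
qed

definition kjac :: "real \<Rightarrow> real^'n \<Rightarrow> real^'n^'n" where
  "kjac \<kappa> x = (\<chi> i j. (if i = j then - \<kappa> * orderR x * cos (x $ i) else 0)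
     + \<kappa> / real CARD('n) * sin (x $ i) * sin (x $ j))"

lemma kfield_has_derivative:
  fixes w :: "real^'n"
  shows "(kfield w \<kappa> has_derivative (\<lambda>v. kjac \<kappa> x *v v)) (at x within S)"
proof (subst has_derivative_componentwise_within, intro ballI)
  fix b :: "real^'n" assume "b \<in> Basis"
  then obtain i where b: "b = axis i 1" by (auto simp: Basis_vec_def)
  let ?N = "real CARD('n)"
  have nth: "((\<lambda>y. y $ j) has_derivative (\<lambda>v. v $ j)) (at x within S)" for j
    by (rule bounded_linear.has_derivative[OF bounded_linear_vec_nth has_derivative_ident])
  have "((\<lambda>y. w $ i - \<kappa> * ((\<Sum>j\<in>UNIV. 1 + cos (y $ j)) / ?N) * sin (y $ i)) has_derivative
      (\<lambda>v. - (\<kappa> * ((\<Sum>j\<in>UNIV. - sin (x $ j) * v $ j) / ?N) * sin (x $ i)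
        + \<kappa> * ((\<Sum>j\<in>UNIV. 1 + cos (x $ j)) / ?N) * (cos (x $ i) * v $ i)))) (at x within S)"
    by (rule derivative_eq_intros nth refl | simp add: fun_eq_iff algebra_simps)+
  moreover have "kfield w \<kappa> y \<bullet> b = w $ i - \<kappa> * ((\<Sum>j\<in>UNIV. 1 + cos (y $ j)) / ?N) * sin (y $ i)" for y
    by (simp add: b inner_axis kfield_nth orderR_def)
  moreover have "(kjac \<kappa> x *v v) \<bullet> b = - (\<kappa> * ((\<Sum>j\<in>UNIV. - sin (x $ j) * v $ j) / ?N) * sin (x $ i)
        + \<kappa> * ((\<Sum>j\<in>UNIV. 1 + cos (x $ j)) / ?N) * (cos (x $ i) * v $ i))" for v
  proof -
    have "(kjac \<kappa> x *v v) \<bullet> b = (\<Sum>j\<in>UNIV. (if i = j then - \<kappa> * orderR x * cos (x $ i) * v $ j else 0)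
        + \<kappa> / ?N * sin (x $ i) * (sin (x $ j) * v $ j))"
      by (simp add: b inner_axis matrix_vector_mult_def kjac_def) (intro sum.cong refl, simp add: algebra_simps)
    also have "\<dots> = - \<kappa> * orderR x * cos (x $ i) * v $ i + \<kappa> / ?N * sin (x $ i) * (\<Sum>j\<in>UNIV. sin (x $ j) * v $ j)"
      by (simp add: sum.distrib sum_distrib_left)
    finally show ?thesis by (simp add: orderR_def sum_negf algebra_simps)
  qed
  ultimately show "((\<lambda>y. kfield w \<kappa> y \<bullet> b) has_derivative (\<lambda>v. (kjac \<kappa> x *v v) \<bullet> b)) (at x within S)"
    by simp
qed

lemma euler_has_derivative:
  "(euler (kfield w \<kappa>) h has_derivative (\<lambda>v. (mat 1 + h *\<^sub>R kjac \<kappa> x) *v v)) (at x within S)"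
proof -
  have "((\<lambda>x. x + h *\<^sub>R kfield w \<kappa> x) has_derivative (\<lambda>v. v + h *\<^sub>R (kjac \<kappa> x *v v))) (at x within S)"
    by (intro derivative_intros kfield_has_derivative)
  then show ?thesis
    by (simp add: euler_def[abs_def] matrix_vector_mult_add_rdistrib scaleR_matrix_vector_assoc)
qed

lemma kjac_bound:
  assumes "\<kappa> \<ge> 0" shows "\<bar>kjac \<kappa> (x::real^'n) $ i $ j\<bar> \<le> 3 * \<kappa>"
proof -
  have "\<bar>\<kappa> * orderR x * cos (x $ i)\<bar> \<le> \<kappa> * 2 * 1"
    unfolding abs_mult using assms orderR_bounds[of x] by (intro mult_mono) auto
  moreover have "\<bar>\<kappa> / real CARD('n) * sin (x $ i) * sin (x $ j)\<bar> \<le> \<kappa> / 1 * 1 * 1"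
    unfolding abs_mult using assms
    by (intro mult_mono) (auto simp: field_simps mult_le_cancel_left1 Suc_le_eq)
  moreover have "kjac \<kappa> x $ i $ j = (if i = j then - (\<kappa> * orderR x * cos (x $ i)) else 0)
      + \<kappa> / real CARD('n) * sin (x $ i) * sin (x $ j)" by (simp add: kjac_def)
  moreover have "\<bar>(if i = j then - p else 0) + q\<bar> \<le> \<bar>p\<bar> + \<bar>q\<bar>" for p q :: real by (cases "i = j") auto
  ultimately show ?thesis
    by (smt (verit) mult.right_neutral div_by_1)
qed

lemma kjac_trace:
  assumes "\<kappa> \<ge> 0"
  shows "(\<Sum>i\<in>UNIV. kjac \<kappa> (x::real^'n) $ i $ i) \<ge> \<kappa> * real CARD('n) * (orderR x * (1 - orderR x))"
proof -
  have c: "(\<Sum>i\<in>UNIV. cos (x $ i)) = real CARD('n) * (orderR x - 1)" by (simp add: orderR_eq)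
  have "(\<Sum>i\<in>UNIV. kjac \<kappa> x $ i $ i)
      = - \<kappa> * orderR x * (\<Sum>i\<in>UNIV. cos (x $ i)) + \<kappa> / real CARD('n) * (\<Sum>i\<in>UNIV. sin (x $ i) * sin (x $ i))"
    by (simp add: kjac_def sum_distrib_left mult.assoc flip: sum.distrib sum_subtractf sum_negf)
  also have "\<dots> \<ge> - \<kappa> * orderR x * (\<Sum>i\<in>UNIV. cos (x $ i))"
    using assms by (simp add: sum_nonneg)
  finally show ?thesis unfolding c by (simp add: algebra_simps)
qed

lemma continuous_on_kjac_det: "continuous_on S (\<lambda>x. det (mat 1 + h *\<^sub>R kjac \<kappa> x))"
proof -
  have "continuous_on S (\<lambda>x. (mat 1 + h *\<^sub>R kjac \<kappa> x) $ i $ j)" for i j :: 'a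
    by (cases "i = j") (auto simp: kjac_def mat_def intro!: continuous_intros continuous_on_orderR)
  then show ?thesis unfolding det_def
    by (intro continuous_on_sum continuous_on_mult continuous_on_const continuous_on_prod)
qed

section \<open>Euler steps on the torus\<close>

definition lattice_vec :: "int^'n \<Rightarrow> real^'n" where
  "lattice_vec k = (\<chi> i. 2 * pi * of_int (k $ i))"

definition cell :: "real^'n \<Rightarrow> int^'n" where
  "cell x = (\<chi> i. \<lfloor>(x $ i + pi) / (2 * pi)\<rfloor>)"

definition wrap :: "real^'n \<Rightarrow> real^'n" where
  "wrap x = x - lattice_vec (cell x)"

lemma cell_iff: "cell x = k \<longleftrightarrow> x - lattice_vec k \<in> torus_box"
proof -
  have "\<lfloor>(x $ i + pi) / (2 * pi)\<rfloor> = k $ i \<longleftrightarrow>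
      - pi \<le> x $ i - 2 * pi * of_int (k $ i) \<and> x $ i - 2 * pi * of_int (k $ i) < pi" for i
    by (simp add: floor_eq_iff field_simps)
  then show ?thesis by (simp add: vec_eq_iff cell_def torus_box_def lattice_vec_def)
qed

lemma wrap_in_torus_box: "wrap x \<in> torus_box"
  using cell_iff[of x "cell x"] by (simp add: wrap_def)

lemma lattice_vec_0: "lattice_vec 0 = 0"
  by (simp add: lattice_vec_def vec_eq_iff)

lemma lattice_vec_add: "lattice_vec (j + k) = lattice_vec j + lattice_vec k"
  by (simp add: lattice_vec_def vec_eq_iff algebra_simps)

lemma lattice_vec_minus: "lattice_vec (- k) = - lattice_vec k"
  by (simp add: lattice_vec_def vec_eq_iff)

lemma lattice_vec_diff: "lattice_vec (j - k) = lattice_vec j - lattice_vec k"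
  by (simp add: lattice_vec_def vec_eq_iff algebra_simps)

lemma cell_add: "cell (x + lattice_vec k) = cell x + k"
proof -
  have "\<lfloor>(x $ i + 2 * pi * of_int (k $ i) + pi) / (2 * pi)\<rfloor> = \<lfloor>(x $ i + pi) / (2 * pi) + of_int (k $ i)\<rfloor>" for i
    by (simp add: field_simps)
  then show ?thesis by (simp add: cell_def vec_eq_iff lattice_vec_def)
qed

lemma wrap_id: "x \<in> torus_box \<Longrightarrow> wrap x = x"
  using cell_iff[of x 0] by (simp add: wrap_def lattice_vec_0)

lemma wrap_add: "wrap (x + lattice_vec k) = wrap x"
  by (simp add: wrap_def cell_add lattice_vec_add)

lemma cos_lattice: "cos ((x + lattice_vec k) $ i) = cos (x $ i)"
  and sin_lattice: "sin ((x + lattice_vec k) $ i) = sin (x $ i)"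
  by (simp_all add: lattice_vec_def cos_add sin_add)

lemma orderR_lattice: "orderR (x + lattice_vec k) = orderR x"
  unfolding orderR_def cos_lattice ..

lemma kfield_lattice: "kfield w \<kappa> (x + lattice_vec k) = kfield w \<kappa> x"
  unfolding vec_eq_iff kfield_nth orderR_lattice sin_lattice by simp

lemma euler_lattice: "euler (kfield w \<kappa>) h (x + lattice_vec k) = euler (kfield w \<kappa>) h x + lattice_vec k"
  by (simp add: euler_def kfield_lattice)

text \<open>Cutting \<open>B\<close> along the cells gives countably many pieces, each of which
  \<open>wrap\<close> translates by a fixed lattice vector. Injectivity keeps the translated pieces
  disjoint.\<close>

lemma measure_wrap_image:
  fixes B :: "(real^'n) set"
  assumes B: "B \<in> lmeasurable" and inj: "inj_on wrap B"
  shows "wrap ` B \<in> lmeasurable" "measure lebesgue (wrap ` B) = measure lebesgue B"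
proof -
  define P where "P = (\<lambda>k. B \<inter> (+) (lattice_vec k) ` torus_box)"
  have cellP: "x \<in> P k \<longleftrightarrow> x \<in> B \<and> cell x = k" for x k
    by (auto simp: P_def cell_iff image_iff) (metis add.commute diff_add_cancel)
  have Pm: "P k \<in> lmeasurable" for k
    unfolding P_def by (intro fmeasurable_Int_fmeasurable B fmeasurableD measurable_translation lmeasurable_torus_box)
  define W where "W = (\<lambda>k. (\<lambda>x. x - lattice_vec k) ` P k)"
  have Wm: "W k \<in> lmeasurable" for k unfolding W_def by (rule measurable_translation_subtract[OF Pm])
  have WP: "emeasure lebesgue (W k) = emeasure lebesgue (P k)" for k
    using measure_translation_subtract[of "lattice_vec k" "P k"] Pm[of k] Wm[of k]
    by (simp add: emeasure_eq_measure2 W_def)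
  have Wk: "W k = wrap ` P k" for k by (auto simp: W_def wrap_def cellP)
  have UP: "B = (\<Union>k. P k)" by (auto simp: cellP)
  have UW: "wrap ` B = (\<Union>k. W k)" unfolding Wk by (subst UP) auto
  have dP: "disjoint_family P" by (auto simp: disjoint_family_on_def cellP)
  have dW: "disjoint_family W"
    unfolding disjoint_family_on_def Wk using inj by (auto simp: cellP inj_on_def) metis
  have "emeasure lebesgue (wrap ` B) = (\<integral>\<^sup>+k. emeasure lebesgue (W k) \<partial>count_space UNIV)"
    unfolding UW by (rule emeasure_UN_countable) (use Wm dW in auto)
  also have "\<dots> = (\<integral>\<^sup>+k. emeasure lebesgue (P k) \<partial>count_space UNIV)" by (simp add: WP)
  also have "\<dots> = emeasure lebesgue (\<Union>k. P k)"
    by (rule emeasure_UN_countable[symmetric]) (use Pm dP in auto)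
  also note UP[symmetric]
  finally have e: "emeasure lebesgue (wrap ` B) = emeasure lebesgue B" .
  have "wrap ` B \<in> sets lebesgue" unfolding UW using Wm by (intro sets.countable_UN') auto
  then show "wrap ` B \<in> lmeasurable" using e B by (auto simp: fmeasurable_def)
  show "measure lebesgue (wrap ` B) = measure lebesgue B" using e by (simp add: measure_def)
qed

definition euler_step :: "real^'n \<Rightarrow> real \<Rightarrow> real \<Rightarrow> real^'n \<Rightarrow> real^'n" where
  "euler_step w \<kappa> h x = wrap (euler (kfield w \<kappa>) h x)"

text \<open>Equivariance under lattice translations lets all foldings be collected into one at the
  end.\<close>

lemma euler_step_funpow:
  "\<exists>k. (euler_step w \<kappa> h ^^ n) x = (euler (kfield w \<kappa>) h ^^ n) x + lattice_vec k"
proof (induction n)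
  case 0
  show ?case by (rule exI[of _ 0]) (simp add: lattice_vec_0)
next
  case (Suc n)
  then obtain k where k: "(euler_step w \<kappa> h ^^ n) x = (euler (kfield w \<kappa>) h ^^ n) x + lattice_vec k" by blast
  let ?y = "euler (kfield w \<kappa>) h ((euler (kfield w \<kappa>) h ^^ n) x)"
  have "(euler_step w \<kappa> h ^^ Suc n) x = wrap (euler (kfield w \<kappa>) h ((euler_step w \<kappa> h ^^ n) x))"
    by (simp add: euler_step_def)
  also have "\<dots> = ?y + lattice_vec (- cell ?y)"
    unfolding k euler_lattice wrap_add by (simp add: wrap_def lattice_vec_minus)
  finally show ?case by auto
qed

text \<open>If two images agree modulo the lattice, equivariance and injectivity of the Euler map
  make their preimages agree modulo the lattice, and \<open>torus_box\<close> holds one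
  representative of each class.\<close>

lemma inj_on_wrap_euler:
  assumes "inj (euler (kfield w \<kappa>) h)" "C \<subseteq> torus_box"
  shows "inj_on wrap (euler (kfield w \<kappa>) h ` C)"
proof (rule inj_onI, elim imageE)
  fix a b x y
  assume xy: "x \<in> C" "y \<in> C" "a = euler (kfield w \<kappa>) h x" "b = euler (kfield w \<kappa>) h y" and ab: "wrap a = wrap b"
  have "a = b + lattice_vec (cell a - cell b)"
    using ab by (simp add: wrap_def lattice_vec_diff algebra_simps)
  then have "x = y + lattice_vec (cell a - cell b)"
    using assms(1) xy by (metis euler_lattice injD)
  then have "wrap x = wrap y" by (simp add: wrap_add)
  then have "x = y" using xy assms(2) wrap_id by (metis subsetD)
  then show "a = b" using xy by simp
qed

text \<open>The bound on \<open>h\<close> is the contraction condition that makes the Euler map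
  injective, the field having Lipschitz constant \<open>3 * \<kappa> * CARD('n)\<close>.\<close>

lemma measure_euler_step:
  fixes C :: "(real^'n::{finite,wellorder}) set"
  assumes C: "C \<in> lmeasurable" "C \<subseteq> torus_box" and \<kappa>: "\<kappa> \<ge> 0"
    and h: "0 \<le> h" "h * (3 * \<kappa> * real CARD('n)) < 1"
  shows "euler_step w \<kappa> h ` C \<in> lmeasurable"
    and "(\<lambda>x. \<bar>det (mat 1 + h *\<^sub>R kjac \<kappa> x)\<bar>) integrable_on C"
    and "measure lebesgue (euler_step w \<kappa> h ` C) = integral C (\<lambda>x. \<bar>det (mat 1 + h *\<^sub>R kjac \<kappa> x)\<bar>)"
proof -
  let ?E = "euler (kfield w \<kappa>) h" and ?d = "\<lambda>x. \<bar>det (mat 1 + h *\<^sub>R kjac \<kappa> x)\<bar>"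
  have inj: "inj ?E"
    by (rule euler_inj[OF kfield_lipschitz[OF \<kappa>] kfield_bounded[OF \<kappa>]])
      (use h \<kappa> omega_norm_nonneg[of w] in auto)
  have "?d integrable_on cube" unfolding cube_eq_cbox
    by (intro integrable_continuous continuous_on_rabs continuous_on_kjac_det)
  then have "?d absolutely_integrable_on cube" by (rule nonnegative_absolutely_integrable_1) auto
  then have "?d absolutely_integrable_on C"
    using fmeasurableD[OF C(1)] order_trans[OF C(2) torus_box_subset_cube] by (rule set_integrable_subset)
  then show int: "?d integrable_on C" by (simp add: absolutely_integrable_on_def)
  have im: "?E ` C \<in> lmeasurable"
    by (rule measurable_differentiable_image[OF fmeasurableD[OF C(1)] euler_has_derivative]) (simp add: int)
  have "measure lebesgue (?E ` C) = integral C (\<lambda>x. \<bar>det (matrix (\<lambda>v. (mat 1 + h *\<^sub>R kjac \<kappa> x) *v v))\<bar>)"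
    by (rule measure_differentiable_image_eq[OF fmeasurableD[OF C(1)] euler_has_derivative])
      (use inj int in \<open>auto intro: inj_on_subset\<close>)
  moreover have eq: "euler_step w \<kappa> h ` C = wrap ` ?E ` C" by (auto simp: euler_step_def)
  ultimately show "euler_step w \<kappa> h ` C \<in> lmeasurable"
      "measure lebesgue (euler_step w \<kappa> h ` C) = integral C ?d"
    unfolding eq using measure_wrap_image[OF im inj_on_wrap_euler[OF inj C(2)]] by simp_all
qed

section \<open>Expansion of slow sets\<close>

definition slow_set :: "(real^'n \<Rightarrow> real \<Rightarrow> real^'n) \<Rightarrow> real \<Rightarrow> real \<Rightarrow> (real^'n) set" where
  "slow_set \<Phi> a t = {x\<in>torus_box. \<forall>\<sigma>\<in>{0..t}. orderR (\<Phi> x \<sigma>) \<le> a}"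

lemma slow_set_antimono: "t \<le> t' \<Longrightarrow> slow_set \<Phi> a t' \<subseteq> slow_set \<Phi> a t"
  by (auto simp: slow_set_def)

lemma slow_set_mono: "a \<le> a' \<Longrightarrow> slow_set \<Phi> a t \<subseteq> slow_set \<Phi> a' t"
  by (force simp: slow_set_def)

text \<open>For \<open>R \<le> s\<close> the factor \<open>1 - R\<close> is at least
  \<open>1 - \<mu>\<close>. For \<open>R > s\<close> the target is \<open>s * (1 - \<mu>)\<close>:
  if \<open>R \<le> \<mu>\<close>, both factors are bounded separately; otherwise \<open>R\<close>
  lies between \<open>\<mu>\<close> and \<open>1 - \<mu>\<close>, where the concave
  \<open>R * (1 - R)\<close> is at least its value at the ends.\<close>

lemma expansion_rate_lower_bound:
  fixes R s \<mu> :: real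
  assumes "0 \<le> R" "R \<le> 1 - \<mu>" "0 < s" "s \<le> \<mu>"
  shows "(1 - \<mu>) * min R s \<le> R * (1 - R)"
proof (cases "R \<le> s")
  case True
  then have "R * (1 - \<mu>) \<le> R * (1 - R)" using assms by (intro mult_left_mono) auto
  then show ?thesis using True by (simp add: mult.commute)
next
  case False
  show ?thesis
  proof (cases "R \<le> \<mu>")
    case True
    then have "s * (1 - \<mu>) \<le> R * (1 - R)" using assms False by (intro mult_mono) auto
    then show ?thesis using False by (simp add: mult.commute)
  next
    case mu: False
    have "0 \<le> (R - \<mu>) * (1 - \<mu> - R)" using mu assms by (intro mult_nonneg_nonneg) auto
    then have "\<mu> * (1 - \<mu>) \<le> R * (1 - R)" by (simp add: algebra_simps)
    moreover have "s * (1 - \<mu>) \<le> \<mu> * (1 - \<mu>)" using assms by (intro mult_right_mono) auto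
    ultimately show ?thesis using False by (simp add: mult.commute)
  qed
qed

text \<open>Euler points only approximate slow orbits, so \<open>R'\<close> may exceed
  \<open>1 - \<mu>\<close>. The 4 is 3 + 1: replacing \<open>R\<close> by \<open>R'\<close> changes
  \<open>R * (1 - R)\<close> by at most \<open>3 * d\<close> and
  \<open>(1 - \<mu>) * min R s\<close> by at most \<open>d\<close>.\<close>

lemma expansion_rate_perturbed:
  fixes R R' s \<mu> d :: real
  assumes "0 \<le> R" "R \<le> 1 - \<mu>" "0 < s" "s \<le> \<mu>" and R': "0 \<le> R'" "R' \<le> 2" and d: "\<bar>R' - R\<bar> \<le> d"
  shows "(1 - \<mu>) * min R' s - 4 * d \<le> R' * (1 - R')"
proof -
  have "\<bar>(R' - R) * (1 - R - R')\<bar> \<le> d * 3"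
    unfolding abs_mult using assms by (intro mult_mono) auto
  moreover have "R' * (1 - R') = R * (1 - R) + (R' - R) * (1 - R - R')" by (simp add: algebra_simps)
  moreover have "(1 - \<mu>) * (min R' s - min R s) \<le> 1 * d"
  proof (cases "min R' s \<le> min R s")
    case True
    then have "(1 - \<mu>) * (min R' s - min R s) \<le> 0" using assms by (intro mult_nonneg_nonpos) auto
    then show ?thesis using d by linarith
  next
    case False
    then show ?thesis using assms by (intro mult_mono) (auto simp: min_def abs_le_iff split: if_splits)
  qed
  ultimately show ?thesis
    using expansion_rate_lower_bound[OF assms(1-4)] by (simp add: algebra_simps)
qed

text \<open>Each loss \<open>b\<close> is amplified by at most \<open>q ^ n\<close>.
  \<open>D\<close> may be negative, as the volume can lie below the deficit.\<close>

lemma affine_recursion_lower_bound: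
  fixes D :: "nat \<Rightarrow> real"
  assumes step: "\<And>k. k < n \<Longrightarrow> D (Suc k) \<ge> q * D k - b" and q: "q \<ge> 1" and b: "b \<ge> 0"
  shows "D n \<ge> q ^ n * D 0 - real n * b * q ^ n"
proof -
  have "k \<le> n \<Longrightarrow> D k \<ge> q ^ k * D 0 - real k * b * q ^ k" for k
  proof (induction k)
    case (Suc k)
    have "q * (q ^ k * D 0 - real k * b * q ^ k) - b \<le> q * D k - b"
      using Suc q by (intro diff_right_mono mult_left_mono) auto
    moreover have "b * 1 \<le> b * q ^ Suc k" using b q by (intro mult_left_mono one_le_power) auto
    ultimately show ?case using step[of k] Suc.prems by (simp add: algebra_simps)
  qed simp
  then show ?thesis by blast
qed

context
  fixes w :: "real^'n" and \<kappa> :: real and \<Phi> :: "real^'n \<Rightarrow> real \<Rightarrow> real^'n"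
  assumes kpos: "\<kappa> > 0" and flow0: "\<And>x. \<Phi> x 0 = x" and flow: "\<And>x. solves_from w \<kappa> (\<Phi> x)"
begin

lemmas kfield_facts = kfield_lipschitz[OF less_imp_le[OF kpos]] kfield_bounded[OF less_imp_le[OF kpos]]

lemma flow_lipschitz:
  assumes "t \<ge> 0" "solves_from w \<kappa> y"
  shows "norm (\<Phi> x t - y t) \<le> exp (3 * \<kappa> * real CARD('n) * t) * norm (x - y 0)"
  using solution_lipschitz[OF kfield_facts[where w = w], of "\<Phi> x" y t] flow[of x] assms kpos omega_norm_nonneg[of w]
  by (simp add: solves_from_def flow0)

lemma continuous_on_flow:
  assumes "t \<ge> 0" shows "continuous_on S (\<lambda>x. \<Phi> x t)"
  by (rule lipschitz_on_continuous_on[of "exp (3 * \<kappa> * real CARD('n) * t)"], rule lipschitz_onI)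
    (use flow_lipschitz[OF assms flow] in \<open>auto simp: dist_norm flow0\<close>)

lemma slow_set_borel: "slow_set \<Phi> a t \<in> sets borel"
proof -
  have "closed {x. orderR (\<Phi> x \<sigma>) \<le> a}" if "\<sigma> \<ge> 0" for \<sigma>
    by (intro closed_Collect_le continuous_on_compose2[OF continuous_on_orderR[of UNIV] continuous_on_flow] continuous_intros)
      (use that in auto)
  then have "closed (\<Inter>\<sigma>\<in>{0..t}. {x. orderR (\<Phi> x \<sigma>) \<le> a})" by (intro closed_INT) auto
  moreover have "slow_set \<Phi> a t = torus_box \<inter> (\<Inter>\<sigma>\<in>{0..t}. {x. orderR (\<Phi> x \<sigma>) \<le> a})"
    by (auto simp: slow_set_def)
  ultimately show ?thesis by auto
qed

lemma slow_set_lmeasurable: "slow_set \<Phi> a t \<in> lmeasurable"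
  by (rule fmeasurableI2[OF lmeasurable_torus_box]) (use slow_set_borel in \<open>auto simp: slow_set_def\<close>)

text \<open>Continuity from above. It removes the enlargement of the threshold that the Euler error
  introduces.\<close>

lemma slow_set_tendsto:
  "(\<lambda>j. nmeas (slow_set \<Phi> (a + 1 / real (Suc j)) t)) \<longlonglongrightarrow> nmeas (slow_set \<Phi> a t)"
proof -
  let ?A = "\<lambda>j. slow_set \<Phi> (a + 1 / real (Suc j)) t"
  have "(\<Inter>j. ?A j) = slow_set \<Phi> a t"
  proof (intro antisym subsetI)
    fix x assume x: "x \<in> (\<Inter>j. ?A j)"
    have "orderR (\<Phi> x \<sigma>) \<le> a" if "\<sigma> \<in> {0..t}" for \<sigma>
    proof (rule field_le_epsilon)
      fix e :: real assume "e > 0"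
      then obtain j where "1 / real (Suc j) < e" using nat_approx_posE by blast
      moreover have "orderR (\<Phi> x \<sigma>) \<le> a + 1 / real (Suc j)" using x that by (auto simp: slow_set_def)
      ultimately show "orderR (\<Phi> x \<sigma>) \<le> a + e" by linarith
    qed
    then show "x \<in> slow_set \<Phi> a t" using x by (auto simp: slow_set_def)
  next
    fix x assume "x \<in> slow_set \<Phi> a t"
    then show "x \<in> (\<Inter>j. ?A j)" using slow_set_mono[of a "a + 1 / real (Suc _)" \<Phi> t] by auto
  qed
  moreover have "(\<lambda>j. measure lebesgue (?A j)) \<longlonglongrightarrow> measure lebesgue (\<Inter>j. ?A j)"
  proof (rule Lim_measure_decseq)
    show "decseq ?A" by (intro decseq_SucI slow_set_mono) (simp add: frac_le)
    show "range ?A \<subseteq> sets lebesgue" using slow_set_lmeasurable by (auto dest: fmeasurableD)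
    show "emeasure lebesgue (?A j) \<noteq> \<infinity>" for j
      using fmeasurableD2[OF slow_set_lmeasurable, of "a + 1 / real (Suc j)" t] by simp
  qed
  ultimately show ?thesis unfolding nmeas_def by (intro tendsto_intros) auto
qed

text \<open>The flow started at the Euler image of \<open>x\<close> is compared with this orbit,
  which passes through a lattice translate of \<open>\<Phi> x \<tau>\<close>.\<close>

lemma shifted_flow_solves:
  assumes "\<tau> \<ge> 0" shows "solves_from w \<kappa> (\<lambda>\<sigma>. \<Phi> x (\<tau> + \<sigma>) + lattice_vec k)"
  unfolding solves_from_def
proof (intro allI impI)
  fix t :: real assume t: "t \<ge> 0"
  have "(\<Phi> x has_vector_derivative kfield w \<kappa> (\<Phi> x (\<tau> + t))) (at (\<tau> + t) within {0..})"
    using flow[of x] assms t by (auto simp: solves_from_def)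
  then have "(\<Phi> x has_vector_derivative kfield w \<kappa> (\<Phi> x (\<tau> + t))) (at (\<tau> + t) within (\<lambda>s. \<tau> + s) ` {0..})"
    by (rule has_vector_derivative_within_subset) (use assms in auto)
  then have "((\<Phi> x \<circ> (\<lambda>s. \<tau> + s)) has_vector_derivative 1 *\<^sub>R kfield w \<kappa> (\<Phi> x (\<tau> + t))) (at t within {0..})"
    by (intro vector_diff_chain_within) (auto intro!: derivative_eq_intros)
  then show "((\<lambda>\<sigma>. \<Phi> x (\<tau> + \<sigma>) + lattice_vec k) has_vector_derivative
      kfield w \<kappa> (\<Phi> x (\<tau> + t) + lattice_vec k)) (at t within {0..})"
    unfolding kfield_lattice by (auto intro!: derivative_eq_intros simp: o_def)
qed

lemma euler_step_near_flow:
  assumes "0 \<le> h" "real k * h \<le> \<tau>"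
  obtains m where "norm ((euler_step w \<kappa> h ^^ k) x - (\<Phi> x (real k * h) + lattice_vec m))
    \<le> exp (3 * \<kappa> * real CARD('n) * \<tau>) * (real CARD('n) * (omega_norm w + 2 * \<kappa>)) * h"
proof -
  obtain m where m: "(euler_step w \<kappa> h ^^ k) x = (euler (kfield w \<kappa>) h ^^ k) x + lattice_vec m"
    using euler_step_funpow by blast
  have "norm ((euler (kfield w \<kappa>) h ^^ k) (\<Phi> x 0) - \<Phi> x (real k * h))
    \<le> exp (3 * \<kappa> * real CARD('n) * \<tau>) * (real CARD('n) * (omega_norm w + 2 * \<kappa>)) * h"
    by (rule euler_error[OF kfield_facts[where w = w]])
      (use flow[of x] assms kpos omega_norm_nonneg[of w] in \<open>auto simp: solves_from_def\<close>)
  then show ?thesis using that[of m] by (simp add: m flow0)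
qed

end

text \<open>The constant \<open>c\<close> is chosen before the set and the step size: over
  \<open>n\<close> steps of size \<open>\<tau> / n\<close> the errors \<open>c * h\<^sup>2\<close>
  then add up to \<open>O(1 / n)\<close>. The parameter \<open>e\<close> absorbs the deviation of
  the Euler points from slow orbits.\<close>

lemma euler_step_volume_growth:
  fixes w :: "real^'n::{finite,wellorder}"
  assumes \<kappa>: "\<kappa> > 0"
  obtains c where "c \<ge> 0"
    and "\<And>C h e s \<mu>. \<lbrakk>C \<in> lmeasurable; C \<subseteq> torus_box; 0 \<le> h; h \<le> 1; h * (3 * \<kappa> * real CARD('n)) < 1; 0 < s; 0 \<le> e;
        \<And>z. z \<in> C \<Longrightarrow> (1 - \<mu>) * min (orderR z) s - e \<le> orderR z * (1 - orderR z); \<mu> \<le> 1\<rbrakk>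
      \<Longrightarrow> nmeas (euler_step w \<kappa> h ` C) \<ge> nmeas C
        + h * (\<kappa> * real CARD('n) * (1 - \<mu>)) * s * (nmeas C - cap_deficit CARD('n) s)
        - (c * h\<^sup>2 + h * \<kappa> * real CARD('n) * e)"
proof -
  let ?N = "real CARD('n)"
  obtain c where c0: "c \<ge> 0" and c: "\<And>(A::real^'n::_^'n::_) h. 0 \<le> h \<Longrightarrow> h \<le> 1 \<Longrightarrow> \<forall>i j. \<bar>A $ i $ j\<bar> \<le> 3 * \<kappa>
    \<Longrightarrow> \<bar>det (mat 1 + h *\<^sub>R A) - (1 + h * (\<Sum>i\<in>UNIV. A $ i $ i))\<bar> \<le> c * h\<^sup>2"
    using det_expansion[of "3 * \<kappa>", where 'n = 'n] \<kappa> by auto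
  show ?thesis
  proof (rule that[OF c0])
    fix C :: "(real^'n::_) set" and h e s \<mu> :: real
    assume C: "C \<in> lmeasurable" "C \<subseteq> torus_box" and h: "0 \<le> h" "h \<le> 1" "h * (3 * \<kappa> * ?N) < 1" and s: "0 < s" and e: "0 \<le> e"
      and R: "\<And>z. z \<in> C \<Longrightarrow> (1 - \<mu>) * min (orderR z) s - e \<le> orderR z * (1 - orderR z)" and \<mu>: "\<mu> \<le> 1"
    define r where "r = c * h\<^sup>2 + h * \<kappa> * ?N * e"
    define g where "g = h * (\<kappa> * ?N * (1 - \<mu>))"
    have r: "r \<ge> 0" using c0 h e \<kappa> by (simp add: r_def)
    have g: "g \<ge> 0" using h \<mu> \<kappa> by (simp add: g_def)
    have Cc: "C \<subseteq> cube" using C(2) torus_box_subset_cube by blast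
    have det: "1 - r + g * min (orderR z) s \<le> \<bar>det (mat 1 + h *\<^sub>R kjac \<kappa> z)\<bar>" if "z \<in> C" for z
    proof -
      have "h * (\<kappa> * ?N * ((1 - \<mu>) * min (orderR z) s - e)) \<le> h * (\<kappa> * ?N * (orderR z * (1 - orderR z)))"
        using R[OF that] h \<kappa> by (intro mult_left_mono) auto
      also have "\<dots> \<le> h * (\<Sum>i\<in>UNIV. kjac \<kappa> z $ i $ i)"
        using kjac_trace[of \<kappa> z] h \<kappa> by (intro mult_left_mono) auto
      finally have "1 - r + g * min (orderR z) s \<le> 1 + h * (\<Sum>i\<in>UNIV. kjac \<kappa> z $ i $ i) - c * h\<^sup>2"
        by (simp add: r_def g_def algebra_simps)
      then show ?thesis using c[of h "kjac \<kappa> z"] h kjac_bound[of \<kappa> z] \<kappa> by fastforce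
    qed
    note mi = integral_min_order_ge[OF C(1) Cc s]
    have one: "(\<lambda>x. 1 - r) integrable_on C" using C by (simp add: integrable_on_const)
    have gi: "(\<lambda>x. g * min (orderR x) s) integrable_on C" using integrable_on_cmult_left[OF mi(1), of g] by simp
    have "measure lebesgue (euler_step w \<kappa> h ` C) = integral C (\<lambda>x. \<bar>det (mat 1 + h *\<^sub>R kjac \<kappa> x)\<bar>)"
      using measure_euler_step(3)[OF C _ h(1,3), of w] \<kappa> by simp
    also have "\<dots> \<ge> integral C (\<lambda>x. 1 - r + g * min (orderR x) s)"
      by (rule integral_le) (use one gi measure_euler_step(2)[OF C _ h(1,3)] \<kappa> det in \<open>auto intro: integrable_add\<close>)
    also have "integral C (\<lambda>x. 1 - r + g * min (orderR x) s) = integral C (\<lambda>x. 1 - r) + integral C (\<lambda>x. g * min (orderR x) s)"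
      by (rule Henstock_Kurzweil_Integration.integral_add[OF one gi])
    also have "integral C (\<lambda>x. 1 - r) = (1 - r) * measure lebesgue C"
      using C lmeasure_integral[of C] integral_mult_right[of C "1 - r" "\<lambda>x. 1"] by simp
    also have "integral C (\<lambda>x. g * min (orderR x) s) = g * integral C (\<lambda>x. min (orderR x) s)"
      by (rule integral_mult_right)
    finally have "(1 - r) * measure lebesgue C + g * integral C (\<lambda>x. min (orderR x) s)
        \<le> measure lebesgue (euler_step w \<kappa> h ` C)" .
    moreover have "g * (s * (measure lebesgue C - cap_deficit CARD('n) s * (2 * pi) ^ CARD('n)))
        \<le> g * integral C (\<lambda>x. min (orderR x) s)"
      using mi(2) g by (intro mult_left_mono)
    ultimately have *: "(1 - r) * measure lebesgue C + g * (s * (measure lebesgue C - cap_deficit CARD('n) s * (2 * pi) ^ CARD('n)))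
        \<le> measure lebesgue (euler_step w \<kappa> h ` C)" by simp
    have "measure lebesgue C \<le> (2 * pi) ^ CARD('n)"
      unfolding measure_torus_box[symmetric] using C by (intro measure_mono_fmeasurable lmeasurable_torus_box) auto
    then have "r * measure lebesgue C \<le> r * (2 * pi) ^ CARD('n)" using r by (rule mult_left_mono)
    with * have "measure lebesgue C + g * (s * (measure lebesgue C - cap_deficit CARD('n) s * (2 * pi) ^ CARD('n))) - r * (2 * pi) ^ CARD('n)
        \<le> measure lebesgue (euler_step w \<kappa> h ` C)" by (simp add: algebra_simps)
    then have "(measure lebesgue C + g * (s * (measure lebesgue C - cap_deficit CARD('n) s * (2 * pi) ^ CARD('n))) - r * (2 * pi) ^ CARD('n)) / (2 * pi) ^ CARD('n)
        \<le> nmeas (euler_step w \<kappa> h ` C)" unfolding nmeas_def by (rule divide_right_mono) simp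
    then show "nmeas (euler_step w \<kappa> h ` C) \<ge> nmeas C
        + h * (\<kappa> * ?N * (1 - \<mu>)) * s * (nmeas C - cap_deficit CARD('n) s)
        - (c * h\<^sup>2 + h * \<kappa> * ?N * e)"
      unfolding g_def[symmetric] r_def[symmetric]
      by (simp add: nmeas_def add_divide_distrib diff_divide_distrib right_diff_distrib mult.assoc)
  qed
qed

text \<open>The set that is slow up to \<open>t + \<tau>\<close> is pushed forward by
  \<open>n\<close> Euler steps of size \<open>\<tau> / n\<close>. Each step multiplies the excess of
  volume over the deficit by at least \<open>1 + h * g\<close>, up to \<open>O(h\<^sup>2)\<close>,
  and the final image is slow for the remaining time \<open>t\<close>, with a threshold enlarged by
  \<open>O(1 / n)\<close>.\<close>

lemma slow_set_expansion_wellorder: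
  fixes w :: "real^'n::{finite,wellorder}" and \<Phi> :: "real^'n::_ \<Rightarrow> real \<Rightarrow> real^'n::_"
  assumes \<kappa>: "\<kappa> > 0" and flow0: "\<And>x. \<Phi> x 0 = x" and flow: "\<And>x. solves_from w \<kappa> (\<Phi> x)"
    and t: "0 \<le> t" "0 \<le> \<tau>" and s: "0 < s" "s \<le> \<mu>" and \<mu>: "\<mu> \<le> 1" and a: "a \<le> 1 - \<mu>"
  shows "exp (\<tau> * (\<kappa> * real CARD('n) * (1 - \<mu>)) * s) * (nmeas (slow_set \<Phi> a (t + \<tau>)) - cap_deficit CARD('n) s)
    \<le> nmeas (slow_set \<Phi> a t) - cap_deficit CARD('n) s"
proof -
  let ?N = "real CARD('n)" and ?d = "cap_deficit CARD('n) s"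
  define g where "g = \<kappa> * ?N * (1 - \<mu>) * s"
  define L where "L = 3 * \<kappa> * ?N"
  define c1 where "c1 = exp (L * \<tau>) * (?N * (omega_norm w + 2 * \<kappa>))"
  define c2 where "c2 = exp (L * t) * c1"
  define D0 where "D0 = nmeas (slow_set \<Phi> a (t + \<tau>)) - ?d"
  have g: "g \<ge> 0" using \<kappa> \<mu> s by (simp add: g_def)
  have L: "L > 0" using \<kappa> by (simp add: L_def)
  have c1: "c1 \<ge> 0" using \<kappa> omega_norm_nonneg[of w] by (simp add: c1_def)
  obtain c where c: "c \<ge> 0" and grow: "\<And>C h e s \<mu>. \<lbrakk>C \<in> lmeasurable; C \<subseteq> torus_box; 0 \<le> h; h \<le> 1; h * (3 * \<kappa> * ?N) < 1; 0 < s; 0 \<le> e;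
        \<And>z. z \<in> C \<Longrightarrow> (1 - \<mu>) * min (orderR z) s - e \<le> orderR z * (1 - orderR z); \<mu> \<le> 1\<rbrakk>
      \<Longrightarrow> nmeas (euler_step w \<kappa> h ` C) \<ge> nmeas C
        + h * (\<kappa> * ?N * (1 - \<mu>)) * s * (nmeas C - cap_deficit CARD('n) s)
        - (c * h\<^sup>2 + h * \<kappa> * ?N * e)"
    using euler_step_volume_growth[OF \<kappa>, of w] by blast
  define c3 where "c3 = c + \<kappa> * ?N * (4 * c1)"
  have c3: "c3 \<ge> 0" using c c1 \<kappa> by (simp add: c3_def)
  have near: "\<exists>m. norm ((euler_step w \<kappa> h ^^ k) x - (\<Phi> x (real k * h) + lattice_vec m)) \<le> c1 * h"
    if "0 \<le> h" "real k * h \<le> \<tau>" for h k x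
    using euler_step_near_flow[OF \<kappa> flow0 flow that] unfolding c1_def L_def by metis
  have main: "(1 + \<tau> / real n * g) ^ n * D0 - c3 * \<tau>\<^sup>2 / real n * exp (g * \<tau>)
      \<le> nmeas (slow_set \<Phi> (a + c2 * (\<tau> / real n)) t) - ?d"
    if n: "n > 0" "\<tau> / real n \<le> 1" "\<tau> / real n * L < 1" for n
  proof -
    define h where "h = \<tau> / real n"
    have h: "0 \<le> h" "h \<le> 1" "h * L < 1" "real n * h = \<tau>" using n t by (auto simp: h_def)
    have kh: "real k * h \<le> \<tau>" if "k \<le> n" for k
      using mult_right_mono[of "real k" "real n" h] that h by simp
    define C where "C = (\<lambda>k. (euler_step w \<kappa> h ^^ k) ` slow_set \<Phi> a (t + \<tau>))"
    have CS: "C (Suc k) = euler_step w \<kappa> h ` C k" for k by (auto simp: C_def)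
    have Cbox: "C k \<subseteq> torus_box" for k
      by (cases k) (auto simp: CS euler_step_def wrap_in_torus_box C_def slow_set_def)
    have Cm: "C k \<in> lmeasurable" for k
    proof (induction k)
      case 0
      show ?case using slow_set_lmeasurable[OF \<kappa> flow0 flow] by (simp add: C_def)
    next
      case (Suc k)
      then show ?case unfolding CS using \<kappa> h
        by (intro measure_euler_step(1)[OF Suc Cbox]) (auto simp: L_def)
    qed
    have step: "nmeas (C (Suc k)) - ?d \<ge> (1 + h * g) * (nmeas (C k) - ?d) - c3 * h\<^sup>2" if k: "k < n" for k
    proof -
      have "nmeas (euler_step w \<kappa> h ` C k) \<ge> nmeas (C k) + h * (\<kappa> * ?N * (1 - \<mu>)) * s * (nmeas (C k) - ?d)
          - (c * h\<^sup>2 + h * \<kappa> * ?N * (4 * (c1 * h)))"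
      proof (rule grow[OF Cm Cbox h(1,2)])
        fix z assume "z \<in> C k"
        then obtain x where x: "x \<in> slow_set \<Phi> a (t + \<tau>)" "z = (euler_step w \<kappa> h ^^ k) x" by (auto simp: C_def)
        obtain m where m: "norm (z - (\<Phi> x (real k * h) + lattice_vec m)) \<le> c1 * h"
          using near[OF h(1) kh[OF less_imp_le[OF k]], of x] x by auto
        have "\<bar>orderR z - orderR (\<Phi> x (real k * h))\<bar> \<le> c1 * h"
          using orderR_lipschitz[of z "\<Phi> x (real k * h) + lattice_vec m"] m by (simp add: orderR_lattice)
        moreover have "orderR (\<Phi> x (real k * h)) \<le> 1 - \<mu>"
          using x(1) a kh[of k] k h t by (auto simp: slow_set_def intro!: order_trans[OF _ a])
        ultimately show "(1 - \<mu>) * min (orderR z) s - 4 * (c1 * h) \<le> orderR z * (1 - orderR z)"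
          using orderR_bounds s by (intro expansion_rate_perturbed) auto
      qed (use h s c1 \<mu> L_def in auto)
      then show ?thesis unfolding CS by (simp add: g_def c3_def power2_eq_square algebra_simps)
    qed
    have q: "(1 + h * g) ^ n \<le> exp (g * \<tau>)"
    proof -
      have "(1 + h * g) ^ n \<le> exp (h * g) ^ n" using h g by (intro power_mono exp_ge_add_one_self) auto
      also have "\<dots> = exp (g * (real n * h))" by (simp add: exp_of_nat_mult[symmetric] mult_ac)
      finally show ?thesis using h by simp
    qed
    have "(1 + h * g) ^ n * (nmeas (C 0) - ?d) - real n * (c3 * h\<^sup>2) * (1 + h * g) ^ n \<le> nmeas (C n) - ?d"
      by (rule affine_recursion_lower_bound[where D = "\<lambda>k. nmeas (C k) - ?d"]) (use step h g c3 in auto)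
    moreover have "real n * (c3 * h\<^sup>2) * (1 + h * g) ^ n \<le> real n * (c3 * h\<^sup>2) * exp (g * \<tau>)"
      using q c3 by (intro mult_left_mono) auto
    moreover have "real n * (c3 * h\<^sup>2) = c3 * \<tau>\<^sup>2 / real n" using n by (simp add: h_def power2_eq_square)
    moreover have "C 0 = slow_set \<Phi> a (t + \<tau>)" by (simp add: C_def)
    moreover have "nmeas (C n) \<le> nmeas (slow_set \<Phi> (a + c2 * h) t)"
    proof -
      have "C n \<subseteq> slow_set \<Phi> (a + c2 * h) t"
      proof
        fix z assume z: "z \<in> C n"
        then obtain x where x: "x \<in> slow_set \<Phi> a (t + \<tau>)" "z = (euler_step w \<kappa> h ^^ n) x" by (auto simp: C_def)
        obtain m where m: "norm (z - (\<Phi> x \<tau> + lattice_vec m)) \<le> c1 * h"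
          using near[OF h(1) kh[of n], of x] x h(4) by auto
        \<comment> \<open>Up to a lattice vector, the orbit of \<open>z\<close> stays within
          \<open>c2 * h\<close> of the orbit of \<open>x\<close> from time \<open>\<tau>\<close> on,
          and the latter is slow until \<open>t + \<tau>\<close>.\<close>
        have "orderR (\<Phi> z \<sigma>) \<le> a + c2 * h" if \<sigma>: "\<sigma> \<in> {0..t}" for \<sigma>
        proof -
          have "norm (\<Phi> z \<sigma> - (\<Phi> x (\<tau> + \<sigma>) + lattice_vec m)) \<le> exp (L * \<sigma>) * norm (z - (\<Phi> x \<tau> + lattice_vec m))"
            using flow_lipschitz[OF \<kappa> flow0 flow _ shifted_flow_solves[OF \<kappa> flow0 flow t(2)], of \<sigma> z x m] \<sigma>
            by (simp add: L_def)
          also have "\<dots> \<le> exp (L * t) * (c1 * h)" using m L \<sigma> by (intro mult_mono) auto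
          finally have "\<bar>orderR (\<Phi> z \<sigma>) - orderR (\<Phi> x (\<tau> + \<sigma>))\<bar> \<le> c2 * h"
            using orderR_lipschitz[of "\<Phi> z \<sigma>" "\<Phi> x (\<tau> + \<sigma>) + lattice_vec m"]
            by (simp add: orderR_lattice c2_def mult.assoc)
          moreover have "orderR (\<Phi> x (\<tau> + \<sigma>)) \<le> a" using x(1) \<sigma> t by (auto simp: slow_set_def)
          ultimately show ?thesis by linarith
        qed
        then show "z \<in> slow_set \<Phi> (a + c2 * h) t" using z Cbox by (auto simp: slow_set_def)
      qed
      then have "measure lebesgue (C n) \<le> measure lebesgue (slow_set \<Phi> (a + c2 * h) t)"
        using slow_set_lmeasurable[OF \<kappa> flow0 flow] Cm by (intro measure_mono_fmeasurable) (auto dest: fmeasurableD)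
      then show ?thesis unfolding nmeas_def by (rule divide_right_mono) simp
    qed
    ultimately show ?thesis unfolding D0_def h_def[symmetric] by simp
  qed
  \<comment> \<open>For fixed \<open>j\<close>, \<open>n\<close> tends to infinity, and the
    threshold \<open>a + c2 * \<tau> / n\<close> is eventually below \<open>a + 1 / (j + 1)\<close>;
    only then does \<open>j\<close> tend to infinity.\<close>
  have "exp (\<tau> * g) * D0 \<le> nmeas (slow_set \<Phi> (a + 1 / real (Suc j)) t) - ?d" for j
  proof (rule tendsto_upperbound)
    have "(\<lambda>n. (1 + \<tau> * g / real n) ^ n) \<longlonglongrightarrow> exp (\<tau> * g)" by (rule tendsto_exp_limit_sequentially)
    moreover have "(\<lambda>n. c3 * \<tau>\<^sup>2 / real n * exp (g * \<tau>)) \<longlonglongrightarrow> 0" by real_asymp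
    ultimately show "(\<lambda>n. (1 + \<tau> / real n * g) ^ n * D0 - c3 * \<tau>\<^sup>2 / real n * exp (g * \<tau>)) \<longlonglongrightarrow> exp (\<tau> * g) * D0"
      using tendsto_diff[OF tendsto_mult[OF _ tendsto_const]] by fastforce
    have z: "(\<lambda>n. \<tau> / real n) \<longlonglongrightarrow> 0" by real_asymp
    have z1: "(\<lambda>n. \<tau> / real n * L) \<longlonglongrightarrow> 0" "(\<lambda>n. c2 * (\<tau> / real n)) \<longlonglongrightarrow> 0" by real_asymp+
    have ev: "\<forall>\<^sub>F n in sequentially. \<tau> / real n < 1" "\<forall>\<^sub>F n in sequentially. \<tau> / real n * L < 1"
        "\<forall>\<^sub>F n in sequentially. c2 * (\<tau> / real n) < 1 / real (Suc j)"
      by (rule order_tendstoD(2)[OF z] order_tendstoD(2)[OF z1(1)] order_tendstoD(2)[OF z1(2)]; simp)+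
    show "\<forall>\<^sub>F n in sequentially. (1 + \<tau> / real n * g) ^ n * D0 - c3 * \<tau>\<^sup>2 / real n * exp (g * \<tau>)
        \<le> nmeas (slow_set \<Phi> (a + 1 / real (Suc j)) t) - ?d"
      using eventually_gt_at_top[of "0::nat"] ev
    proof eventually_elim
      case (elim n)
      have "measure lebesgue (slow_set \<Phi> (a + c2 * (\<tau> / real n)) t) \<le> measure lebesgue (slow_set \<Phi> (a + 1 / real (Suc j)) t)"
        using slow_set_lmeasurable[OF \<kappa> flow0 flow] elim
        by (intro measure_mono_fmeasurable slow_set_mono) (auto dest: fmeasurableD)
      then have "nmeas (slow_set \<Phi> (a + c2 * (\<tau> / real n)) t) \<le> nmeas (slow_set \<Phi> (a + 1 / real (Suc j)) t)"
        unfolding nmeas_def by (rule divide_right_mono) simp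
      then show ?case using main[of n] elim by simp
    qed
  qed simp
  moreover have "(\<lambda>j. nmeas (slow_set \<Phi> (a + 1 / real (Suc j)) t) - ?d) \<longlonglongrightarrow> nmeas (slow_set \<Phi> a t) - ?d"
    by (intro tendsto_diff slow_set_tendsto[OF \<kappa> flow0 flow] tendsto_const)
  ultimately have "exp (\<tau> * g) * D0 \<le> nmeas (slow_set \<Phi> a t) - ?d"
    by (intro LIMSEQ_le_const) auto
  then show ?thesis by (simp add: g_def D0_def mult_ac)
qed

text \<open>The change-of-variables theorems of the library are stated for well-ordered index types.
  An arbitrary finite index type is in bijection with the following one.\<close>

typedef 'n idx = "{..<CARD('n::finite)}"
  by (auto intro!: exI[of _ 0])

instantiation idx :: (finite) wellorder
begin

definition less_eq_idx :: "'a idx \<Rightarrow> 'a idx \<Rightarrow> bool" where "less_eq_idx x y \<longleftrightarrow> Rep_idx x \<le> Rep_idx y"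
definition less_idx :: "'a idx \<Rightarrow> 'a idx \<Rightarrow> bool" where "less_idx x y \<longleftrightarrow> Rep_idx x < Rep_idx y"

instance
proof
  fix P and a :: "'a idx"
  assume step: "\<And>x::'a idx. (\<And>y. y < x \<Longrightarrow> P y) \<Longrightarrow> P x"
  show "P a"
    by (induction a rule: measure_induct_rule[of Rep_idx]) (auto intro: step simp: less_idx_def)
qed (auto simp: less_eq_idx_def less_idx_def Rep_idx_inject)

end

lemma card_idx: "CARD('n::finite idx) = CARD('n)"
  using type_definition.card[OF type_definition_idx] by simp

instance idx :: (finite) finite
proof
  have "CARD('a idx) > 0" by (simp add: card_idx)
  then show "finite (UNIV :: 'a idx set)" by (rule card_ge_0_finite)
qed

section \<open>Transport along a bijection of index types\<close>

context
  fixes f :: "'m::finite \<Rightarrow> 'n::finite"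
  assumes bij: "bij f"
begin

definition relabel :: "real^'n \<Rightarrow> real^'m" where
  "relabel x = (\<chi> k. x $ f k)"

definition unlabel :: "real^'m \<Rightarrow> real^'n" where
  "unlabel z = (\<chi> i. z $ inv f i)"

lemma relabel_nth: "relabel x $ k = x $ f k" and unlabel_nth: "unlabel z $ i = z $ inv f i"
  by (simp_all add: relabel_def unlabel_def)

lemma unlabel_relabel: "unlabel (relabel x) = x" and relabel_unlabel: "relabel (unlabel z) = z"
  using bij by (simp_all add: vec_eq_iff relabel_nth unlabel_nth bij_def surj_f_inv_f)

lemma sum_relabel: "(\<Sum>k\<in>UNIV. g (f k)) = (\<Sum>i\<in>UNIV. g i)"
  using bij by (simp add: sum.reindex_bij_betw bij_betw_def bij_def)

lemma card_relabel: "CARD('m) = CARD('n)"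
  using bij by (simp add: bij_betw_same_card)

lemma orderR_relabel: "orderR (relabel x) = orderR x"
  unfolding orderR_def relabel_nth card_relabel
  using sum_relabel[of "\<lambda>i. 1 + cos (x $ i)"] by simp

lemma kfield_relabel: "kfield (relabel w) \<kappa> (relabel x) = relabel (kfield w \<kappa> x)"
  by (simp add: vec_eq_iff kfield_nth relabel_nth orderR_relabel)

lemma torus_box_relabel: "relabel x \<in> torus_box \<longleftrightarrow> x \<in> torus_box"
  using bij unfolding torus_box_def by (simp add: relabel_nth) (metis bij_pointE)

lemma bounded_linear_relabel: "bounded_linear relabel"
  by (intro linear_conv_bounded_linear[THEN iffD1] linearI) (auto simp: vec_eq_iff relabel_nth)

lemma relabel_measurable: "relabel \<in> borel_measurable borel"
  by (intro borel_measurable_continuous_onI linear_continuous_on bounded_linear_relabel)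

lemma distr_lborel_relabel: "distr lborel borel relabel = (lborel :: (real^'m) measure)"
proof (rule lborel_eqI[symmetric])
  fix l u :: "real^'m" assume lu: "\<And>b. b \<in> Basis \<Longrightarrow> l \<bullet> b \<le> u \<bullet> b"
  have BM: "(Basis :: (real^'m) set) = (\<lambda>i. axis i 1) ` UNIV" and BN: "(Basis :: (real^'n) set) = (\<lambda>i. axis i 1) ` UNIV"
    by (auto simp: Basis_vec_def)
  have injM: "inj (\<lambda>i::'m. axis i (1::real))" and injN: "inj (\<lambda>i::'n. axis i (1::real))"
    by (auto simp: inj_on_def axis_eq_axis)
  have pre: "relabel -` box l u = box (unlabel l) (unlabel u)"
  proof -
    have "(\<forall>k. l $ k < x $ f k \<and> x $ f k < u $ k) \<longleftrightarrow> (\<forall>i. l $ inv f i < x $ i \<and> x $ i < u $ inv f i)" for x :: "real^'n"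
      using bij by (metis bij_inv_eq_iff)
    then show ?thesis by (auto simp: mem_box_cart relabel_nth unlabel_nth)
  qed
  have le: "unlabel l \<bullet> b \<le> unlabel u \<bullet> b" if bB: "b \<in> Basis" for b
  proof -
    obtain i where b: "b = axis i 1" using bB by (auto simp: BN)
    have "axis (inv f i) 1 \<in> (Basis :: (real^'m) set)" by (simp add: BM)
    from lu[OF this] show ?thesis by (simp add: b inner_axis unlabel_nth)
  qed
  have "emeasure (distr lborel borel relabel) (box l u) = emeasure lborel (relabel -` box l u)"
    using relabel_measurable by (subst emeasure_distr) auto
  also have "\<dots> = ennreal (\<Prod>b\<in>Basis. (unlabel u - unlabel l) \<bullet> b)"
    unfolding pre using le by simp
  also have "(\<Prod>b\<in>Basis. (unlabel u - unlabel l) \<bullet> b) = (\<Prod>i\<in>UNIV. u $ inv f i - l $ inv f i)"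
    unfolding BN by (subst prod.reindex[OF injN]) (simp add: inner_axis unlabel_nth)
  also have "\<dots> = (\<Prod>k\<in>UNIV. u $ k - l $ k)"
    using prod.reindex_bij_betw[OF bij_imp_bij_inv[OF bij], of "\<lambda>k. u $ k - l $ k"] by simp
  also have "\<dots> = (\<Prod>b\<in>Basis. (u - l) \<bullet> b)"
    unfolding BM by (subst prod.reindex[OF injM]) (simp add: inner_axis)
  finally show "emeasure (distr lborel borel relabel) (box l u) = ennreal (\<Prod>b\<in>Basis. (u - l) \<bullet> b)" .
qed simp

lemma nmeas_relabel:
  assumes "S \<in> sets borel" shows "nmeas (relabel -` S) = nmeas S"
proof -
  have "emeasure lborel S = emeasure (distr lborel borel relabel) S" by (simp add: distr_lborel_relabel)
  also have "\<dots> = emeasure lborel (relabel -` S)"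
    using relabel_measurable assms by (subst emeasure_distr) auto
  finally have "measure lborel (relabel -` S) = measure lborel S" by (simp add: measure_def)
  moreover have "relabel -` S \<in> sets borel" using measurable_sets[OF relabel_measurable assms] by simp
  ultimately show ?thesis using assms by (simp add: nmeas_def card_relabel)
qed

end

lemma slow_set_expansion:
  fixes w :: "real^'n" and \<Phi> :: "real^'n \<Rightarrow> real \<Rightarrow> real^'n"
  assumes \<kappa>: "\<kappa> > 0" and flow0: "\<And>x. \<Phi> x 0 = x" and flow: "\<And>x. solves_from w \<kappa> (\<Phi> x)"
    and t: "0 \<le> t" "0 \<le> \<tau>" and s: "0 < s" "s \<le> \<mu>" and \<mu>: "\<mu> \<le> 1" and a: "a \<le> 1 - \<mu>"
  shows "exp (\<tau> * (\<kappa> * real CARD('n) * (1 - \<mu>)) * s) * (nmeas (slow_set \<Phi> a (t + \<tau>)) - cap_deficit CARD('n) s)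
    \<le> nmeas (slow_set \<Phi> a t) - cap_deficit CARD('n) s"
proof -
  obtain f :: "'n idx \<Rightarrow> 'n" where f: "bij f"
    using finite_same_card_bij[of "UNIV :: 'n idx set" "UNIV :: 'n set"] by (auto simp: card_idx)
  define \<Psi> where "\<Psi> = (\<lambda>z t. relabel f (\<Phi> (unlabel f z) t))"
  have 0: "\<Psi> z 0 = z" for z by (simp add: \<Psi>_def flow0 relabel_unlabel[OF f])
  have sol: "solves_from (relabel f w) \<kappa> (\<Psi> z)" for z
    unfolding solves_from_def
  proof (intro allI impI)
    fix t :: real assume "t \<ge> 0"
    then have "(\<Phi> (unlabel f z) has_vector_derivative kfield w \<kappa> (\<Phi> (unlabel f z) t)) (at t within {0..})"
      using flow by (simp add: solves_from_def)
    from bounded_linear.has_vector_derivative[OF bounded_linear_relabel[OF f] this]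
    show "(\<Psi> z has_vector_derivative kfield (relabel f w) \<kappa> (\<Psi> z t)) (at t within {0..})"
      by (simp add: \<Psi>_def kfield_relabel[OF f])
  qed
  have "slow_set \<Phi> a t = relabel f -` slow_set \<Psi> a t" for t
    by (auto simp: slow_set_def \<Psi>_def torus_box_relabel[OF f] unlabel_relabel[OF f] orderR_relabel[OF f])
  then have "nmeas (slow_set \<Phi> a t) = nmeas (slow_set \<Psi> a t)" for t
    using nmeas_relabel[OF f slow_set_borel[OF \<kappa> 0 sol]] by simp
  then show ?thesis
    using slow_set_expansion_wellorder[OF \<kappa> 0 sol t s \<mu> a] by (simp add: card_idx)
qed

section \<open>Decay of slow sets\<close>

lemma exp_1_ge: "exp (1::real) \<ge> 8 / 3"
proof -
  have "(8 / 3 :: real) \<le> (1 + 1 / real 30) ^ 30" by (simp add: power_divide)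
  also have "\<dots> \<le> exp 1" by (rule exp_ge_one_plus_x_over_n_power_n) auto
  finally show ?thesis .
qed

lemma cap_bound_powr:
  assumes "s > 0"
  shows "cap_bound N s = (pi * exp 1 / 4 * s) powr (real N / 2)"
proof -
  have "sqrt (pi * exp 1 * s) / 2 = sqrt (pi * exp 1 / 4 * s)" by (simp add: real_sqrt_mult real_sqrt_divide)
  also have "\<dots> = (pi * exp 1 / 4 * s) powr (1 / 2)" using assms by (simp add: powr_half_sqrt)
  finally have "cap_bound N s = ((pi * exp 1 / 4 * s) powr (1 / 2)) ^ N" by (simp add: cap_bound_def)
  also have "\<dots> = (pi * exp 1 / 4 * s) powr (real N / 2)"
    using assms by (simp add: powr_realpow[symmetric] powr_powr)
  finally show ?thesis .
qed

text \<open>With \<open>N = 2\<close> and \<open>8 / 3\<close> in place of \<open>exp 1\<close> the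
  bracket is \<open>5 / 8\<close>, and \<open>2 * (41 / 50 * (5 / 8)) - 1\<close> is exactly
  \<open>1 / 40\<close>. Positivity of this number is what closes \<open>decay_step\<close>.\<close>

lemma decay_numeric:
  fixes N :: real assumes "N \<ge> 2"
  shows "2 * (41 / 50 * (1 - 2 / (N * exp 1))) - 1 \<ge> 1 / 40" "41 / 50 * (1 - 2 / (N * exp 1)) \<le> 1"
    "0 \<le> 1 - 2 / (N * exp 1)"
proof -
  define q where "q = 2 / (N * exp 1)"
  have "N * exp 1 \<ge> 2 * (8 / 3)" using assms exp_1_ge by (intro mult_mono) auto
  then have "2 / (N * exp 1) \<le> 2 / (2 * (8 / 3))" by (intro divide_left_mono) auto
  then have q: "q \<le> 3 / 8" "q \<ge> 0" using assms by (simp_all add: q_def)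
  then show "2 * (41 / 50 * (1 - 2 / (N * exp 1))) - 1 \<ge> 1 / 40" "41 / 50 * (1 - 2 / (N * exp 1)) \<le> 1"
    "0 \<le> 1 - 2 / (N * exp 1)" unfolding q_def[symmetric] by simp_all
qed

section \<open>From linear inequalities for every \<open>s\<close> to a power law\<close>

context
  fixes M :: "real \<Rightarrow> real" and \<kappa> \<mu> y0 :: real and N :: nat
  assumes N: "N \<ge> 2" and \<kappa>: "\<kappa> > 0" and \<mu>: "0 < \<mu>" "\<mu> < 1"
    and anti: "\<And>t t'. 0 \<le> t \<Longrightarrow> t \<le> t' \<Longrightarrow> M t' \<le> M t"
    and expand: "\<And>t \<tau> s. \<lbrakk>0 \<le> t; 0 \<le> \<tau>; 0 < s; s \<le> \<mu>\<rbrakk> \<Longrightarrow>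
      exp (\<tau> * (\<kappa> * real N * (1 - \<mu>)) * s) * (M (t + \<tau>) - cap_deficit N s) \<le> M t - cap_deficit N s"
    and y0: "y0 > 0" "41 / 50 * (4 / (pi * exp 1)) \<le> \<mu> * y0"
begin

text \<open>One step of the differential inequality \<open>(M powr (- 2 / N))' \<ge> \<kappa> (1 - \<mu>) 4 / (\<pi> e)\<close>,
  obtained from the expansion of slow sets by letting \<open>s\<close> be proportional to \<open>M powr (2 / N)\<close>. The factor
  \<open>41 / 50\<close> keeps \<open>s \<le> \<mu>\<close> and still leaves room for the discretisation error.\<close>

lemma decay_step:
  assumes t: "0 \<le> t" and \<tau>: "0 < \<tau>" and y: "y \<ge> y0" and My: "M t \<le> y powr (- real N / 2)"
    and small: "\<kappa> * (1 - \<mu>) * (4 / (pi * exp 1)) * \<tau> * (1 + real N) \<le> y0 / 40"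
  shows "M (t + \<tau>) \<le> (y + \<kappa> * (1 - \<mu>) * (4 / (pi * exp 1)) * \<tau>) powr (- real N / 2)"
proof (rule ccontr)
  define B where "B = 4 / (pi * exp 1)"
  define G where "G = \<kappa> * (1 - \<mu>) * B"
  define p where "p = real N / 2"
  define m where "m = M (t + \<tau>)"
  \<comment> \<open>The coordinate in which the claim is linear:
    \<open>M (t + \<tau>) = Y powr (- N / 2)\<close>. Negating the claim gives
    \<open>y \<le> Y < y + G * \<tau>\<close>, the lower bound by monotonicity of
    \<open>M\<close>.\<close>
  define Y where "Y = m powr (- 1 / p)"
  define \<theta> where "\<theta> = 41 / 50 * (1 - 2 / (real N * exp 1))"
  have B: "B > 0" by (simp add: B_def)
  have G: "G > 0" using \<kappa> \<mu> B by (simp add: G_def)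
  have p: "p \<ge> 1" using N by (simp add: p_def)
  have th: "2 * \<theta> - 1 \<ge> 1 / 40" "\<theta> \<le> 1" using decay_numeric[of "real N"] N by (auto simp: \<theta>_def)
  have ypos: "y > 0" using y y0 by simp
  assume "\<not> ?thesis"
  then have mbig: "m > (y + G * \<tau>) powr (- p)" by (simp add: m_def G_def B_def p_def mult.assoc)
  moreover have "(y + G * \<tau>) powr (- p) \<ge> 0" by simp
  ultimately have m: "m > 0" by linarith
  have Y: "Y > 0" using m by (simp add: Y_def)
  have mY: "m = Y powr (- p)" using m p by (simp add: Y_def powr_powr)
  have lnm: "ln m = - p * ln Y" using Y by (simp add: mY ln_powr)
  have yG: "y + G * \<tau> > 0" using ypos G \<tau> by (simp add: add_pos_pos)
  have Yup: "Y < y + G * \<tau>"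
  proof -
    have "ln ((y + G * \<tau>) powr (- p)) < ln m" using mbig m yG by (subst ln_less_cancel_iff) auto
    then have "p * ln Y < p * ln (y + G * \<tau>)" using yG by (simp add: ln_powr lnm)
    then have "ln Y < ln (y + G * \<tau>)" using p by simp
    then show ?thesis using Y yG by simp
  qed
  have Mt: "M t > 0" using anti[OF t, of "t + \<tau>"] \<tau> m by (simp add: m_def)
  have lnMt: "ln (M t) \<le> - p * ln y"
    using My Mt ypos ln_mono[of "M t" "y powr (- p)"] by (simp add: ln_powr p_def)
  have Ylow: "y \<le> Y"
  proof -
    have "ln m \<le> ln (M t)" using anti[OF t, of "t + \<tau>"] \<tau> m Mt by (simp add: m_def)
    then have "p * ln y \<le> p * ln Y" using lnMt lnm by linarith
    then have "ln y \<le> ln Y" using p by simp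
    then show ?thesis using Y ypos by simp
  qed
  \<comment> \<open>With this \<open>s\<close> the base in \<open>cap_bound_powr\<close> is
    \<open>41 / 50 / Y\<close>, so the cap bound is at most \<open>m\<close>;
    \<open>s \<le> \<mu>\<close> follows from the hypothesis on \<open>y0\<close>, since
    \<open>Y \<ge> y0\<close>.\<close>
  define s where "s = 41 / 50 * B / Y"
  have s: "0 < s" using B Y by (simp add: s_def)
  have s\<mu>: "s \<le> \<mu>"
  proof -
    have "\<mu> * y0 \<le> \<mu> * Y" using y Ylow \<mu> by (intro mult_left_mono) auto
    with y0(2) have "41 / 50 * B \<le> \<mu> * Y" unfolding B_def by (rule order_trans)
    then show ?thesis using Y by (simp add: s_def field_simps)
  qed
  have cap: "cap_bound N s \<le> m"
  proof -
    have "pi * exp 1 / 4 * s = 41 / 50 / Y" by (simp add: s_def B_def)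
    then have "cap_bound N s = (41 / 50 / Y) powr p" using cap_bound_powr[OF s] by (simp add: p_def)
    also have "\<dots> \<le> (1 / Y) powr p" using Y p by (intro powr_mono2 divide_right_mono) auto
    also have "\<dots> = m" using Y by (simp add: mY powr_divide powr_minus_divide)
    finally show ?thesis .
  qed
  define g where "g = \<kappa> * real N * (1 - \<mu>)"
  have g: "g \<ge> 0" using \<kappa> \<mu> by (simp add: g_def)
  have d: "cap_deficit N s \<le> 2 / (real N * exp 1) * m"
    unfolding cap_deficit_def using cap by (intro mult_left_mono) auto
  have md: "m - cap_deficit N s \<ge> m * (1 - 2 / (real N * exp 1))" using d by (simp add: algebra_simps)
  moreover have "m * (1 - 2 / (real N * exp 1)) \<ge> 0" using m decay_numeric(3)[of "real N"] N by simp
  ultimately have md0: "m - cap_deficit N s \<ge> 0" by linarith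
  \<comment> \<open>A lower bound for the relative gain of volume in one step:
    \<open>m * (1 + x) \<le> M t\<close>. Taking logarithms turns it into
    \<open>ln (1 + x) \<le> p * ln (Y / y)\<close>.\<close>
  define x where "x = \<tau> * g * s * (1 - 2 / (real N * exp 1))"
  have xY: "x * Y = \<tau> * G * real N * \<theta>" using Y by (simp add: x_def s_def g_def G_def \<theta>_def)
  have x0: "x \<ge> 0" using \<tau> g s decay_numeric(3)[of "real N"] N by (simp add: x_def)
  have "m * (1 + x) \<le> M t"
  proof -
    have "(1 + \<tau> * g * s) * (m - cap_deficit N s) \<le> exp (\<tau> * g * s) * (m - cap_deficit N s)"
      using md0 by (intro mult_right_mono exp_ge_add_one_self)
    also have "\<dots> \<le> M t - cap_deficit N s" using expand[OF t _ s s\<mu>, of \<tau>] \<tau> by (simp add: g_def m_def)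
    finally have "m + \<tau> * g * s * (m - cap_deficit N s) \<le> M t" by (simp add: algebra_simps)
    moreover have "\<tau> * g * s * (m * (1 - 2 / (real N * exp 1))) \<le> \<tau> * g * s * (m - cap_deficit N s)"
      using md \<tau> g s by (intro mult_left_mono) auto
    ultimately show ?thesis by (simp add: x_def algebra_simps)
  qed
  then have "ln (m * (1 + x)) \<le> ln (M t)" using m x0 Mt by (intro ln_mono) auto
  then have "ln m + ln (1 + x) \<le> - p * ln y" using m x0 lnMt by (simp add: ln_mult)
  then have "ln (1 + x) \<le> p * (ln Y - ln y)" using lnm by (simp add: algebra_simps)
  also have "ln Y - ln y = ln (Y / y)" using Y ypos by (simp add: ln_div)
  also have "p * ln (Y / y) \<le> p * (Y / y - 1)" using Y ypos p by (intro mult_left_mono ln_le_minus_one) auto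
  finally have "ln (1 + x) \<le> p * (Y / y - 1)" .
  moreover have "1 - 1 / (1 + x) \<le> ln (1 + x)"
    using ln_le_minus_one[of "1 / (1 + x)"] x0 by (simp add: ln_div)
  moreover have "1 - 1 / (1 + x) = x / (1 + x)" using x0 by (simp add: field_simps)
  ultimately have "x / (1 + x) \<le> p * ((Y - y) / y)" using ypos by (simp add: diff_divide_distrib)
  also have "\<dots> \<le> p * (G * \<tau> / y)" using Yup ypos p by (intro mult_left_mono divide_right_mono) auto
  finally have "x * y \<le> p * G * \<tau> * (1 + x)" using ypos x0 by (simp add: field_simps)
  then have "x * y * Y \<le> p * G * \<tau> * (1 + x) * Y" using Y by (intro mult_right_mono) auto
  moreover have "x * y * Y = \<tau> * G * real N * \<theta> * y" using xY by (simp add: mult_ac)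
  moreover have "p * G * \<tau> * (1 + x) * Y = p * G * \<tau> * (Y + \<tau> * G * real N * \<theta>)"
    unfolding xY[symmetric] by (simp add: algebra_simps)
  moreover have "p * G * \<tau> * (2 * \<theta> * y) = \<tau> * G * real N * \<theta> * y" by (simp add: p_def mult_ac)
  ultimately have "p * G * \<tau> * (2 * \<theta> * y) \<le> p * G * \<tau> * (Y + \<tau> * G * real N * \<theta>)"
    by (simp only:)
  \<comment> \<open>To leading order this says \<open>2 * \<theta> \<le> Y / y\<close>, and
    \<open>Y / y\<close> is close to 1 for small \<open>\<tau>\<close>; this contradicts
    \<open>2 * \<theta> - 1 \<ge> 1 / 40\<close>.\<close>
  then have "2 * \<theta> * y \<le> Y + \<tau> * G * real N * \<theta>" using p G \<tau> by (subst (asm) mult_le_cancel_left_pos) auto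
  moreover have "\<tau> * G * real N * \<theta> \<le> \<tau> * G * real N * 1" using th \<tau> G by (intro mult_left_mono) auto
  ultimately have "(2 * \<theta> - 1) * y < G * \<tau> * (1 + real N)" using Yup by (simp add: algebra_simps)
  moreover have "1 / 40 * y0 \<le> (2 * \<theta> - 1) * y" using th y y0 by (intro mult_mono) auto
  moreover have "G * \<tau> * (1 + real N) \<le> y0 / 40" using small by (simp only: G_def B_def)
  ultimately show False by linarith
qed

text \<open>Along the iteration \<open>y\<close> only grows, so the smallness condition, stated with
  \<open>y0\<close>, allows one step size for the whole interval.\<close>

lemma decay:
  assumes t0: "0 \<le> t0" "t0 \<le> T" and M0: "M t0 \<le> y0 powr (- real N / 2)"
  shows "M T \<le> (y0 + \<kappa> * (1 - \<mu>) * (4 / (pi * exp 1)) * (T - t0)) powr (- real N / 2)"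
proof (cases "t0 = T")
  case False
  define G where "G = \<kappa> * (1 - \<mu>) * (4 / (pi * exp 1))"
  have G: "G > 0" using \<kappa> \<mu> by (simp add: G_def)
  obtain n :: nat where n: "real n > 40 * G * (T - t0) * (1 + real N) / y0" using reals_Archimedean2 by blast
  moreover have "40 * G * (T - t0) * (1 + real N) / y0 > 0" using G t0 False y0 by simp
  ultimately have n0: "real n > 0" by linarith
  define \<tau> where "\<tau> = (T - t0) / real n"
  have \<tau>: "\<tau> > 0" using n0 t0 False by (simp add: \<tau>_def)
  have "40 * (G * (T - t0) * (1 + real N)) < y0 * real n" using n y0 by (simp add: field_simps)
  then have small: "G * \<tau> * (1 + real N) \<le> y0 / 40" using n0 by (simp add: \<tau>_def field_simps)
  have "M (t0 + real k * \<tau>) \<le> (y0 + G * (real k * \<tau>)) powr (- real N / 2)" for k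
  proof (induction k)
    case (Suc k)
    have "y0 \<le> y0 + G * (real k * \<tau>)" "0 \<le> t0 + real k * \<tau>" using G \<tau> t0 by simp_all
    from decay_step[OF this(2) \<tau> this(1) Suc small[unfolded G_def]]
    have "M (t0 + real k * \<tau> + \<tau>) \<le> (y0 + G * (real k * \<tau>) + G * \<tau>) powr (- real N / 2)"
      by (simp add: G_def)
    then show ?case by (simp add: algebra_simps)
  qed (use M0 in simp)
  from this[of n] show ?thesis using n0 by (simp add: \<tau>_def G_def)
qed (use M0 in simp)

end

section \<open>The good sets\<close>

text \<open>The hypotheses fix \<open>sol\<close> only on the cube, while volumes are followed by a
  flow on the whole space; this extension commutes with lattice translations.\<close>

definition torus_flow :: "(real^'n \<Rightarrow> real \<Rightarrow> real^'n) \<Rightarrow> real^'n \<Rightarrow> real \<Rightarrow> real^'n" where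
  "torus_flow sol x t = sol (wrap x) t + lattice_vec (cell x)"

lemma torus_flow_on_box: "x \<in> torus_box \<Longrightarrow> torus_flow sol x = sol x"
  using cell_iff[of x 0] wrap_id[of x] by (simp add: fun_eq_iff torus_flow_def lattice_vec_0)

lemma nmeas_mono: "S \<in> lmeasurable \<Longrightarrow> S' \<in> lmeasurable \<Longrightarrow> S \<subseteq> S' \<Longrightarrow> nmeas S \<le> nmeas S'"
  unfolding nmeas_def by (intro divide_right_mono measure_mono_fmeasurable) (auto dest: fmeasurableD)

lemma nmeas_ge_compl:
  fixes E A :: "(real^'n) set"
  assumes "E \<in> lmeasurable" "A \<in> lmeasurable" "A \<subseteq> torus_box" "torus_box - A \<subseteq> E"
  shows "nmeas E \<ge> 1 - nmeas A"
proof -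
  have "measure lebesgue (torus_box - A) = (2 * pi) ^ CARD('n) - measure lebesgue A"
    using measurable_measure_Diff[OF lmeasurable_torus_box fmeasurableD[OF assms(2)] assms(3)]
    unfolding measure_torus_box .
  then have "nmeas (torus_box - A) = 1 - nmeas A" by (simp add: nmeas_def diff_divide_distrib)
  moreover have "nmeas (torus_box - A) \<le> nmeas E"
    using assms lmeasurable_torus_box by (intro nmeas_mono fmeasurable_Diff) (auto dest: fmeasurableD)
  ultimately show ?thesis by simp
qed

lemma sqrt_half_bounds: "7 / 10 \<le> 1 / sqrt 2" "1 / sqrt 2 \<le> 71 / 100" "(1 / sqrt 2)\<^sup>2 = 1 / 2"
proof -
  show s: "(1 / sqrt 2)\<^sup>2 = 1 / 2" by (simp add: power_divide)
  show "7 / 10 \<le> 1 / sqrt 2" by (rule power2_le_imp_le) (simp_all add: s, simp add: power_divide)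
  show "1 / sqrt 2 \<le> 71 / 100" by (rule power2_le_imp_le) (simp_all add: s, simp add: power_divide)
qed

text \<open>\<open>c\<close> bounds the band of monotone cosines and \<open>r\<close> is the order
  parameter kept forever. The last two claims turn
  \<open>\<kappa> > (2 + \<epsilon>) * omega_norm w\<close> into the drift conditions at the levels
  \<open>1 / sqrt 2\<close> and \<open>c\<close>. At \<open>\<epsilon> = 0\<close> both are
  equalities, so the terms linear in \<open>\<epsilon>\<close> decide.\<close>

lemma threshold_numeric:
  fixes \<epsilon> :: real
  assumes e: "0 < \<epsilon>" "\<epsilon> \<le> 1"
  defines "c \<equiv> 1 / sqrt 2 + \<epsilon> / 20" and "r \<equiv> 1 / sqrt 2 - 3 * \<epsilon> / 20"
  shows "1 / sqrt 2 < c" "c < 1" "0 < r" "(2 + \<epsilon>) * r * (1 / sqrt 2) \<ge> 1" "(2 + \<epsilon>) * (sqrt (1 - c\<^sup>2) * r) \<ge> 1"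
proof -
  define u :: real where "u = 1 / sqrt 2"
  have u: "7 / 10 \<le> u" "u \<le> 71 / 100" "u * u = 1 / 2"
    using sqrt_half_bounds by (simp_all add: u_def power2_eq_square)
  show "1 / sqrt 2 < c" using e by (simp add: c_def)
  show c1: "c < 1" using e u unfolding c_def u_def[symmetric] by simp
  show r0: "0 < r" using e u unfolding r_def u_def[symmetric] by simp
  have ee: "\<epsilon> * \<epsilon> \<le> \<epsilon>" using e mult_left_mono[of \<epsilon> 1 \<epsilon>] by simp
  have ue: "7 / 10 * \<epsilon> \<le> u * \<epsilon>" "u * \<epsilon> \<le> 71 / 100 * \<epsilon>" using u e by (intro mult_right_mono; simp)+
  have "(2 + \<epsilon>) * r = 2 * u + (u * \<epsilon> - 3 / 10 * \<epsilon>) - 3 / 20 * (\<epsilon> * \<epsilon>)"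
    unfolding r_def u_def[symmetric] by (simp add: algebra_simps)
  then have A: "(2 + \<epsilon>) * r \<ge> 2 * u + \<epsilon> / 4" using ee ue by linarith
  have "(2 * u + \<epsilon> / 4) * u = 1 + u * \<epsilon> / 4" using u(3) by (simp add: algebra_simps)
  also have "\<dots> \<ge> 1" using u e by simp
  finally have "1 \<le> (2 * u + \<epsilon> / 4) * u" .
  also have "\<dots> \<le> (2 + \<epsilon>) * r * u" using A u by (intro mult_right_mono) auto
  finally show "(2 + \<epsilon>) * r * (1 / sqrt 2) \<ge> 1" by (simp add: u_def)
  have cc: "1 - c\<^sup>2 = 1 / 2 - u * \<epsilon> / 10 - \<epsilon> * \<epsilon> / 400"
    unfolding c_def u_def[symmetric] using u(3) by (simp add: power2_eq_square algebra_simps)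
  then have C: "1 - c\<^sup>2 \<ge> 1 / 2 - 3 / 40 * \<epsilon>" using ee ue by linarith
  have "((2 + \<epsilon>) * r)\<^sup>2 \<ge> (2 * u + \<epsilon> / 4)\<^sup>2" using A u e by (intro power_mono) auto
  moreover have "(2 * u + \<epsilon> / 4)\<^sup>2 = 2 + u * \<epsilon> + \<epsilon> * \<epsilon> / 16" using u(3) by (simp add: power2_eq_square algebra_simps)
  moreover have "\<epsilon> * \<epsilon> \<ge> 0" by simp
  ultimately have B: "((2 + \<epsilon>) * r)\<^sup>2 \<ge> 2 + 7 / 10 * \<epsilon>" using ue by linarith
  have "1 \<le> (2 + 7 / 10 * \<epsilon>) * (1 / 2 - 3 / 40 * \<epsilon>)" using ee e by (simp add: algebra_simps)
  also have "\<dots> \<le> ((2 + \<epsilon>) * r)\<^sup>2 * (1 - c\<^sup>2)" using B C e by (intro mult_mono) auto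
  finally have "sqrt 1 \<le> sqrt (((2 + \<epsilon>) * r)\<^sup>2 * (1 - c\<^sup>2))" by (rule real_sqrt_le_mono)
  then have "1 \<le> \<bar>(2 + \<epsilon>) * r\<bar> * sqrt (1 - c\<^sup>2)" by (simp only: real_sqrt_mult real_sqrt_abs real_sqrt_one)
  then show "(2 + \<epsilon>) * (sqrt (1 - c\<^sup>2) * r) \<ge> 1" using r0 e by (simp add: abs_mult mult_ac)
qed

context
  fixes w :: "real^'n" and \<kappa> :: real and sol :: "real^'n \<Rightarrow> real \<Rightarrow> real^'n"
  assumes kpos: "\<kappa> > 0"
    and init: "\<And>x. x \<in> cube \<Longrightarrow> sol x 0 = x"
    and ode: "\<And>x. x \<in> cube \<Longrightarrow> solves_from w \<kappa> (sol x)"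
begin

lemma torus_flow_0: "torus_flow sol x 0 = x"
  using init[OF subsetD[OF torus_box_subset_cube wrap_in_torus_box[of x]]] by (simp add: torus_flow_def wrap_def)

lemma torus_flow_solves: "solves_from w \<kappa> (torus_flow sol x)"
proof -
  have "solves_from w \<kappa> (sol (wrap x))" by (intro ode subsetD[OF torus_box_subset_cube wrap_in_torus_box])
  then show ?thesis unfolding solves_from_def torus_flow_def kfield_lattice
    by (auto intro!: derivative_eq_intros)
qed

lemma continuous_on_sol:
  assumes "t \<ge> 0" shows "continuous_on cube (\<lambda>x. sol x t)"
proof (rule lipschitz_on_continuous_on, rule lipschitz_onI)
  fix x y :: "real^'n" assume xy: "x \<in> cube" "y \<in> cube"
  show "dist (sol x t) (sol y t) \<le> exp (3 * \<kappa> * real CARD('n) * t) * dist x y"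
    using solution_lipschitz[OF kfield_lipschitz[OF less_imp_le[OF kpos]] kfield_bounded[OF less_imp_le[OF kpos]],
        of w "sol x" "sol y" t] ode[OF xy(1)] ode[OF xy(2)] init xy assms kpos omega_norm_nonneg[of w]
    by (simp add: solves_from_def dist_norm)
qed simp

text \<open>The intersection over \<open>t\<close> is uncountable, but each set in it is closed by
  continuous dependence on the initial point.\<close>

lemma sol_preimage_closed:
  assumes "closed V" "T \<ge> 0" shows "closed {x\<in>cube. \<forall>t\<ge>T. sol x t \<in> V}"
proof -
  have "{x\<in>cube. \<forall>t\<ge>T. sol x t \<in> V} = (\<Inter>t\<in>{T..}. cube \<inter> (\<lambda>x. sol x t) -` V)" by auto
  moreover have "closed (\<Inter>t\<in>{T..}. cube \<inter> (\<lambda>x. sol x t) -` V)"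
  proof (intro closed_INT ballI)
    fix t assume "t \<in> {T..}"
    then show "closed (cube \<inter> (\<lambda>x. sol x t) -` V)"
      using assms by (intro continuous_closed_preimage continuous_on_sol closed_cube) auto
  qed
  ultimately show ?thesis by (simp only:)
qed

lemma sol_preimage_lmeasurable:
  assumes "closed V" "T \<ge> 0" shows "{x\<in>cube. \<forall>t\<ge>T. sol x t \<in> V} \<in> lmeasurable"
  by (rule fmeasurableI2[OF lmeasurable_cube]) (use sol_preimage_closed[OF assms] in auto)

lemma osc_set_lmeasurable:
  assumes T: "T \<ge> 0" shows "{x\<in>cube. \<forall>i. osc_lt_2pi (\<lambda>t. sol x t $ i) T} \<in> lmeasurable"
proof -
  define V :: "'n \<Rightarrow> real \<times> real \<Rightarrow> (real^'n) set" where "V = (\<lambda>i (lo, hi). {z. lo \<le> z $ i \<and> z $ i \<le> hi})"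
  define Q where "Q = {(lo, hi) \<in> \<rat> \<times> \<rat>. hi - lo < 2 * pi}"
  have cV: "closed (V i q)" for i q
    unfolding V_def by (cases q) (auto intro!: closed_Collect_conj closed_Collect_le continuous_intros)
  have "osc_lt_2pi f T \<longleftrightarrow> (\<exists>(lo, hi)\<in>Q. \<forall>t\<ge>T. lo \<le> f t \<and> f t \<le> hi)" for f
  proof
    assume "osc_lt_2pi f T"
    from osc_lt_2piD[OF this] show "\<exists>(lo, hi)\<in>Q. \<forall>t\<ge>T. lo \<le> f t \<and> f t \<le> hi"
      by (auto simp: Q_def)
  next
    assume "\<exists>(lo, hi)\<in>Q. \<forall>t\<ge>T. lo \<le> f t \<and> f t \<le> hi"
    then obtain lo hi where "hi - lo < 2 * pi" "\<forall>t\<ge>T. lo \<le> f t \<and> f t \<le> hi" by (auto simp: Q_def)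
    then show "osc_lt_2pi f T" by (intro osc_lt_2piI[of T lo f hi]) auto
  qed
  then have eq: "{x\<in>cube. \<forall>i. osc_lt_2pi (\<lambda>t. sol x t $ i) T}
      = (\<Inter>i. \<Union>q\<in>Q. {x\<in>cube. \<forall>t\<ge>T. sol x t \<in> V i q})"
    by (auto simp: V_def split: prod.splits)
  have "countable Q" unfolding Q_def
    by (rule countable_subset[of _ "\<rat> \<times> \<rat>"]) (auto simp: countable_rat)
  then have "(\<Inter>i. \<Union>q\<in>Q. {x\<in>cube. \<forall>t\<ge>T. sol x t \<in> V i q}) \<in> sets borel"
    using sol_preimage_closed[OF cV T] by (intro sets.countable_INT' sets.countable_UN') auto
  then show ?thesis by (intro fmeasurableI2[OF lmeasurable_cube]) (auto simp: eq[symmetric])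
qed

lemma slow_set_facts:
  "slow_set (torus_flow sol) a t \<in> lmeasurable"
  "t \<le> t' \<Longrightarrow> nmeas (slow_set (torus_flow sol) a t') \<le> nmeas (slow_set (torus_flow sol) a t)"
proof -
  show *: "slow_set (torus_flow sol) a t \<in> lmeasurable" for t
    by (rule slow_set_lmeasurable[OF kpos torus_flow_0 torus_flow_solves])
  show "t \<le> t' \<Longrightarrow> nmeas (slow_set (torus_flow sol) a t') \<le> nmeas (slow_set (torus_flow sol) a t)"
    by (intro nmeas_mono * slow_set_antimono)
qed

lemma slow_set_0: "slow_set (torus_flow sol) a 0 = {x\<in>torus_box. orderR x \<le> a}"
  by (auto simp: slow_set_def torus_flow_0)

lemma fast_time:
  assumes "x \<in> torus_box - slow_set (torus_flow sol) a T"
  obtains u where "0 \<le> u" "u \<le> T" "orderR (sol x u) > a"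
  using assms by (auto simp: slow_set_def torus_flow_on_box not_le)

text \<open>The threshold is fitted to the drop: \<open>1 - \<epsilon> / 5 - (1 - c)\<close> equals
  \<open>r\<close>.\<close>

lemma order_stays_high:
  assumes e: "0 < \<epsilon>" "\<epsilon> \<le> 1" and kbig: "\<kappa> > (2 + \<epsilon>) * omega_norm w"
    and x: "x \<in> cube" and u: "0 \<le> u" "u \<le> t" and R: "orderR (sol x u) \<ge> 1 - \<epsilon> / 5"
  shows "orderR (sol x t) \<ge> 1 / sqrt 2 - 3 * \<epsilon> / 20"
proof -
  define c where "c = 1 / sqrt 2 + \<epsilon> / 20"
  define r where "r = 1 / sqrt 2 - 3 * \<epsilon> / 20"
  note num = threshold_numeric[OF e, folded c_def r_def]
  have c0: "0 < c" using num(1) by (smt (verit) divide_pos_pos real_sqrt_gt_zero)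
  have q: "0 \<le> \<kappa> * sqrt (1 - c\<^sup>2)" using c0 num(2) kpos by (simp add: abs_square_le_1)
  have "omega_norm w < \<kappa> * sqrt (1 - c\<^sup>2) * r"
  proof -
    have "omega_norm w < \<kappa> / (2 + \<epsilon>)" using kbig e by (simp add: pos_less_divide_eq mult.commute)
    also have "\<dots> = \<kappa> * (1 / (2 + \<epsilon>))" by simp
    also have "\<dots> \<le> \<kappa> * (sqrt (1 - c\<^sup>2) * r)"
      using num(5) e kpos by (intro mult_left_mono) (auto simp: pos_divide_le_eq mult.commute)
    finally show ?thesis by (simp add: mult.assoc)
  qed
  also have "\<dots> \<le> \<kappa> * sqrt (1 - c\<^sup>2) * (orderR (sol x u) - (1 - c))"
    using R q by (intro mult_left_mono) (auto simp: r_def c_def)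
  finally have "orderR (sol x t) \<ge> orderR (sol x u) - (1 - c)"
    by (intro order_persists[OF kpos ode[OF x] u c0 num(2)])
  then show ?thesis using R by (simp add: c_def)
qed

lemma high_order_consequences:
  assumes e: "0 < \<epsilon>" "\<epsilon> \<le> 1" and kbig: "\<kappa> > (2 + \<epsilon>) * omega_norm w" and x: "x \<in> cube" and T: "0 \<le> T"
    and R: "\<And>t. t \<ge> T \<Longrightarrow> orderR (sol x t) \<ge> 1 / sqrt 2 - 3 * \<epsilon> / 20"
  shows "osc_lt_2pi (\<lambda>t. sol x t $ i) T"
    and "\<lbrakk>t0 \<ge> T; cos (sol x t0 $ i) \<ge> - 1 / sqrt 2; t \<ge> t0\<rbrakk> \<Longrightarrow> cos (sol x t $ i) \<ge> - 1 / sqrt 2"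
    and "\<lbrakk>t0 \<ge> T; cos (sol x t0 $ i) \<ge> - 1 / sqrt 2; t \<ge> t0 + (2 + \<epsilon>) * pi / (\<kappa> - (2 + \<epsilon>) * omega_norm w)\<rbrakk>
      \<Longrightarrow> cos (sol x t $ i) \<ge> 1 / sqrt 2"
proof -
  define c where "c = 1 / sqrt 2 + \<epsilon> / 20"
  define r where "r = 1 / sqrt 2 - 3 * \<epsilon> / 20"
  note num = threshold_numeric[OF e, folded c_def r_def]
  have p: "0 < 1 / sqrt (2::real)" by simp
  have c0: "0 < c" using num(1) p by linarith
  have Wk: "omega_norm w \<le> \<kappa> * (1 / (2 + \<epsilon>))" using kbig e by (simp add: pos_le_divide_eq mult.commute)
  have "\<kappa> * (1 / (2 + \<epsilon>)) \<le> \<kappa> * (sqrt (1 - c\<^sup>2) * r)"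
    using num(5) e kpos by (intro mult_left_mono) (auto simp: pos_divide_le_eq mult.commute)
  with Wk have W: "omega_norm w \<le> \<kappa> * sqrt (1 - c\<^sup>2) * r" by (simp add: mult.assoc)
  have Rr: "orderR (sol x t) \<ge> r" if "t \<ge> T" for t using R[OF that] by (simp add: r_def)
  show "osc_lt_2pi (\<lambda>t. sol x t $ i) T"
    by (rule osc_lt_2pi_of_order[OF kpos ode[OF x] T c0 num(2) Rr W])
  have cc: "- 1 / sqrt 2 \<le> c" using c0 p by linarith
  show "cos (sol x t $ i) \<ge> - 1 / sqrt 2" if "t0 \<ge> T" "cos (sol x t0 $ i) \<ge> - 1 / sqrt 2" "t \<ge> t0"
    by (rule cos_level_invariant[OF kpos ode[OF x], of t0 t c r]) (use that T num cc Rr W in auto)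
  let ?\<tau> = "(2 + \<epsilon>) * pi / (\<kappa> - (2 + \<epsilon>) * omega_norm w)"
  assume t: "t0 \<ge> T" "cos (sol x t0 $ i) \<ge> - 1 / sqrt 2" "t \<ge> t0 + ?\<tau>"
  have den: "\<kappa> - (2 + \<epsilon>) * omega_norm w > 0" using kbig by simp
  show "cos (sol x t $ i) \<ge> 1 / sqrt 2"
  proof (rule cos_reaches[OF kpos ode[OF x], of t0 ?\<tau> r c])
    \<comment> \<open>The speed is at least \<open>(\<kappa> - (2 + \<epsilon>) * omega_norm w) / (2
      + \<epsilon>)\<close>, so the waiting time of the theorem covers an angle of
      \<open>pi\<close>, twice the required \<open>pi / 2\<close>.\<close>
    have "\<kappa> * 1 \<le> \<kappa> * ((2 + \<epsilon>) * r * (1 / sqrt 2))" using num(4) kpos by (intro mult_left_mono) auto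
    then have "\<kappa> - (2 + \<epsilon>) * omega_norm w \<le> (\<kappa> * r / sqrt 2 - omega_norm w) * (2 + \<epsilon>)"
      by (simp add: algebra_simps add_divide_distrib)
    then have "1 \<le> (\<kappa> * r / sqrt 2 - omega_norm w) * (2 + \<epsilon>) / (\<kappa> - (2 + \<epsilon>) * omega_norm w)"
      using den by simp
    then have "pi * 1 \<le> pi * ((\<kappa> * r / sqrt 2 - omega_norm w) * (2 + \<epsilon>) / (\<kappa> - (2 + \<epsilon>) * omega_norm w))"
      by (intro mult_left_mono) auto
    then have "(\<kappa> * r / sqrt 2 - omega_norm w) * ?\<tau> \<ge> pi" by (simp add: mult_ac)
    then show "(\<kappa> * r / sqrt 2 - omega_norm w) * ?\<tau> \<ge> pi / 2" using pi_gt_zero by linarith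
  qed (use t T den e num W Rr in auto)
qed

text \<open>\<open>\<rho>\<close> solves
  \<open>\<kappa> * (\<rho> / 2) powr (3 / 2) = omega_norm w\<close>. With
  \<open>1 - c\<^sup>2 = \<rho> / 2\<close> the drop \<open>1 - c\<close> is at most
  \<open>\<rho> / 2\<close>, so from \<open>R > \<rho>\<close> more than \<open>\<rho> / 2\<close>
  survives, and the drift condition holds strictly.\<close>

lemma osc_of_order:
  assumes W: "omega_norm w > 0" and \<rho>: "\<rho> = (2 * sqrt 2 * omega_norm w / \<kappa>) powr (2 / 3)" and "\<rho> < 1"
    and x: "x \<in> cube" and u: "0 \<le> u" "u \<le> T" and R: "orderR (sol x u) > \<rho>"
  shows "osc_lt_2pi (\<lambda>t. sol x t $ i) T"
proof -
  have r0: "\<rho> > 0" using W kpos by (simp add: \<rho>)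
  define c where "c = sqrt (1 - \<rho> / 2)"
  have c2: "1 - c\<^sup>2 = \<rho> / 2" using \<open>\<rho> < 1\<close> by (simp add: c_def)
  have c: "0 < c" "c < 1" using \<open>\<rho> < 1\<close> r0 by (simp_all add: c_def)
  have "c\<^sup>2 \<le> c" using c by (simp add: power2_eq_square)
  then have half: "1 - c \<le> \<rho> / 2" using c2 by linarith
  have "\<kappa> * sqrt (\<rho> / 2) * (\<rho> / 2) = omega_norm w"
  proof -
    have "sqrt (\<rho> / 2) * (\<rho> / 2) = \<rho> powr (3 / 2) / (2 * sqrt 2)"
      using r0 powr_add[of \<rho> "1 / 2" 1] by (simp add: real_sqrt_divide powr_half_sqrt)
    also have "\<rho> powr (3 / 2) = 2 * sqrt 2 * omega_norm w / \<kappa>" using W kpos by (simp add: \<rho> powr_powr)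
    finally have "\<kappa> * (sqrt (\<rho> / 2) * (\<rho> / 2)) = omega_norm w" using kpos by simp
    then show ?thesis by (simp only: mult.assoc)
  qed
  moreover have "\<kappa> * sqrt (\<rho> / 2) * (\<rho> / 2) < \<kappa> * sqrt (\<rho> / 2) * (orderR (sol x u) - (1 - c))"
    using R half r0 kpos by (intro mult_strict_left_mono) auto
  ultimately have big: "\<kappa> * sqrt (1 - c\<^sup>2) * (orderR (sol x u) - (1 - c)) > omega_norm w" unfolding c2 by simp
  have "orderR (sol x t) \<ge> orderR (sol x u) - (1 - c)" if "t \<ge> T" for t
    by (rule order_persists[OF kpos ode[OF x] _ _ c big]) (use u that in auto)
  then show ?thesis
    using osc_lt_2pi_of_order[OF kpos ode[OF x] _ c _ less_imp_le[OF big], of T i] u by auto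
qed

end

section \<open>Numerical constants and the crossover time\<close>

lemma exp_three_halves_ge: "exp (3 / 2 :: real) \<ge> 35 / 8"
proof -
  have "(35 / 8 :: real) \<le> (1 + (3 / 2) / real 64) ^ 64" by (simp add: power_divide)
  also have "\<dots> \<le> exp (3 / 2)" by (rule exp_ge_one_plus_x_over_n_power_n) auto
  finally show ?thesis .
qed

text \<open>Source of the coefficient \<open>1 / (N / 2 + 1)\<close> in the theorem:
  \<open>N * exp 1 \<ge> 2 * N \<ge> N + 2\<close>.\<close>

lemma cap_deficit_le:
  assumes "N \<ge> 2" "s \<ge> 0"
  shows "cap_deficit N s \<le> 1 / (real N / 2 + 1) * cap_bound N s"
proof -
  have "real N * 2 \<le> real N * exp 1" using exp_1_ge by (intro mult_left_mono) auto
  then have "real N + 2 \<le> real N * exp 1" using assms by linarith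
  then have "2 / (real N * exp 1) \<le> 2 / (real N + 2)" using assms by (intro divide_left_mono mult_pos_pos) auto
  also have "\<dots> = 1 / (real N / 2 + 1)" by (simp add: field_simps)
  finally show ?thesis unfolding cap_deficit_def using cap_bound_nonneg[OF assms(2)] by (rule mult_right_mono)
qed

lemma cap_bound_eps: "cap_bound N (\<epsilon> / 5) = (sqrt (pi * exp 1 * \<epsilon>) / (2 * sqrt 5)) ^ N"
  by (simp add: cap_bound_def real_sqrt_divide mult_ac)

text \<open>Let \<open>k = 1 / (N / 2 + 1)\<close>, let \<open>1 / Z\<close> be the decay factor at
  \<open>T0\<close> and \<open>P * X\<close> the initial bound. The early bound equals
  \<open>P\<close> when \<open>k * (Z - 1) + X = Z\<close>, that is for
  \<open>Z = (1 + 2 / N) * X - 2 / N\<close>, whose logarithm gives \<open>T0\<close>. Here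
  \<open>P\<close> is the cap bound at \<open>\<epsilon> / 5\<close>.\<close>

lemma crossover_time:
  fixes \<epsilon> \<kappa> :: real and n :: nat
  assumes e: "0 < \<epsilon>" "\<epsilon> \<le> 1" and \<kappa>: "\<kappa> > 0" and n: "n \<ge> 2"
  defines "N \<equiv> real n" and "P \<equiv> (sqrt (pi * exp 1 * \<epsilon>) / (2 * sqrt 5)) ^ n"
  defines "T0 \<equiv> 25 / (\<kappa> * N * \<epsilon> * (5 - \<epsilon>)) *
     ln ((1 + 2 / N) * (2 * sqrt 5 / (sqrt (pi * \<epsilon>) * exp (1/2 + \<epsilon>^2 / 25))) ^ n - 2 / N)"
  shows "T0 \<ge> 0"
    and "1 / (N / 2 + 1) * P * (1 - exp (- (\<kappa> * N * \<epsilon> * (5 - \<epsilon>) * T0 / 25)))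
      + exp (- (N * \<epsilon>^2 / 25) - \<kappa> * N * \<epsilon> * (5 - \<epsilon>) * T0 / 25) = P"
proof -
  define x where "x = 2 * sqrt 5 / (sqrt (pi * \<epsilon>) * exp (1/2 + \<epsilon>^2 / 25))"
  define X where "X = x ^ n"
  define Z where "Z = (1 + 2 / N) * X - 2 / N"
  have N: "N > 0" using n by (simp add: N_def)
  \<comment> \<open>Makes the argument of the logarithm at least 1, hence
    \<open>T0 \<ge> 0\<close>.\<close>
  have "x \<ge> 1"
  proof -
    have "\<epsilon>\<^sup>2 \<le> 1" using e by (simp add: power_le_one)
    then have "exp (1/2 + \<epsilon>^2 / 25) \<le> exp (27 / 50 :: real)" by simp
    also have "\<dots> \<le> 1 + 27 / 50 + (27 / 50)\<^sup>2" by (rule exp_bound) auto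
    also have "\<dots> \<le> sqrt 5" by (rule real_le_rsqrt) (simp add: power2_eq_square)
    finally have "exp (1/2 + \<epsilon>^2 / 25) \<le> sqrt 5" .
    moreover have "pi * \<epsilon> \<le> 4 * 1" using e pi_less_4 by (intro mult_mono) auto
    then have "sqrt (pi * \<epsilon>) \<le> 2" using real_sqrt_le_mono[of "pi * \<epsilon>" 4] by simp
    ultimately have "sqrt (pi * \<epsilon>) * exp (1/2 + \<epsilon>^2 / 25) \<le> 2 * sqrt 5" using e by (intro mult_mono) auto
    then show ?thesis using e by (simp add: x_def)
  qed
  then have X1: "X \<ge> 1" by (simp add: X_def one_le_power)
  have "(1 + 2 / N) * 1 \<le> (1 + 2 / N) * X" using X1 N by (intro mult_left_mono) auto
  then have Z1: "Z \<ge> 1" by (simp add: Z_def)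
  have rate: "\<kappa> * N * \<epsilon> * (5 - \<epsilon>) > 0" using \<kappa> N e by simp
  have T0: "T0 = 25 / (\<kappa> * N * \<epsilon> * (5 - \<epsilon>)) * ln Z" by (simp add: T0_def Z_def X_def x_def)
  then show "T0 \<ge> 0" using Z1 rate by simp
  have rT: "\<kappa> * N * \<epsilon> * (5 - \<epsilon>) * T0 / 25 = ln Z"
  proof -
    have "q * (25 / q * l) / 25 = l" if "q > 0" for q l :: real using that by simp
    from this[OF rate] show ?thesis unfolding T0 .
  qed
  have ex: "exp (- (\<kappa> * N * \<epsilon> * (5 - \<epsilon>) * T0 / 25)) = 1 / Z"
    unfolding rT using Z1 by (simp add: exp_minus field_simps)
  have PX: "exp (- (N * \<epsilon>^2 / 25)) = P * X"
  proof -
    have sq: "sqrt (pi * exp 1 * \<epsilon>) = sqrt (pi * \<epsilon>) * exp (1 / 2)"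
    proof -
      have "exp (1::real) = (exp (1 / 2))\<^sup>2" by (simp add: power2_eq_square exp_add[symmetric])
      then have "pi * exp 1 * \<epsilon> = (pi * \<epsilon>) * (exp (1 / 2))\<^sup>2" by simp
      then show ?thesis by (simp only: real_sqrt_mult real_sqrt_abs) simp
    qed
    have "sqrt (pi * exp 1 * \<epsilon>) / (2 * sqrt 5) * x = exp (- (\<epsilon>^2 / 25))"
    proof -
      have "S * h / (2 * q) * (2 * q / (S * (h * k))) = 1 / k" if "S > 0" "h > 0" "q > 0" "k > 0" for S h q k :: real
        using that by simp
      from this[of "sqrt (pi * \<epsilon>)" "exp (1 / 2)" "sqrt 5" "exp (\<epsilon>^2 / 25)"] e sq
      show ?thesis unfolding x_def exp_add exp_minus inverse_eq_divide by (simp only:) simp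
    qed
    then have "P * X = exp (- (\<epsilon>^2 / 25)) ^ n" by (simp add: P_def X_def power_mult_distrib[symmetric])
    also have "\<dots> = exp (- (N * \<epsilon>^2 / 25))" by (simp add: exp_of_nat_mult[symmetric] N_def)
    finally show ?thesis by simp
  qed
  have "exp (- (N * \<epsilon>^2 / 25) - \<kappa> * N * \<epsilon> * (5 - \<epsilon>) * T0 / 25) = P * X * (1 / Z)"
    unfolding PX[symmetric] ex[symmetric] exp_add[symmetric] by simp
  moreover have "1 / (N / 2 + 1) * P * (1 - 1 / Z) + P * X * (1 / Z) = P"
  proof -
    have "1 / (N / 2 + 1) = 2 / (N + 2)" using N by (simp add: field_simps)
    moreover have "Z - 1 = (N + 2) / N * (X - 1)" using N by (simp add: Z_def field_simps)
    moreover have "2 / (N + 2) * ((N + 2) / N * (X - 1)) = 2 / N * (X - 1)" using N by simp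
    moreover have "2 / N * (X - 1) + X = Z" by (simp add: Z_def algebra_simps diff_divide_distrib)
    ultimately have "1 / (N / 2 + 1) * (Z - 1) + X = Z" by (simp only:)
    then have "P * (1 / (N / 2 + 1) * (Z - 1) + X) / Z = P" using Z1 by simp
    moreover have "P * (k * (Z - 1) + X) / Z = k * P * (1 - 1 / Z) + P * X * (1 / Z)" for k
      using Z1 by (simp add: field_simps)
    ultimately show ?thesis by (simp only:)
  qed
  ultimately show "1 / (N / 2 + 1) * P * (1 - exp (- (\<kappa> * N * \<epsilon> * (5 - \<epsilon>) * T0 / 25)))
      + exp (- (N * \<epsilon>^2 / 25) - \<kappa> * N * \<epsilon> * (5 - \<epsilon>) * T0 / 25) = P" unfolding ex by simp
qed


section \<open>Volume bounds for the slow sets of the given solutions\<close>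

context
  fixes w :: "real^'n" and \<kappa> :: real and sol :: "real^'n \<Rightarrow> real \<Rightarrow> real^'n"
  assumes kpos: "\<kappa> > 0" and N2: "CARD('n) \<ge> 2"
    and init: "\<And>x. x \<in> cube \<Longrightarrow> sol x 0 = x"
    and ode: "\<And>x. x \<in> cube \<Longrightarrow> solves_from w \<kappa> (sol x)"
begin

lemmas sol_facts = kpos init ode

lemma expansion:
  assumes "0 \<le> t" "0 \<le> \<tau>" "0 < s" "s \<le> \<mu>" "\<mu> \<le> 1" "a \<le> 1 - \<mu>"
  shows "exp (\<tau> * (\<kappa> * real CARD('n) * (1 - \<mu>)) * s) * (nmeas (slow_set (torus_flow sol) a (t + \<tau>)) - cap_deficit CARD('n) s)
    \<le> nmeas (slow_set (torus_flow sol) a t) - cap_deficit CARD('n) s"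
  by (rule slow_set_expansion[OF kpos torus_flow_0[OF sol_facts] torus_flow_solves[OF sol_facts] assms])

text \<open>The largest admissible \<open>s = \<mu> = \<epsilon> / 5\<close> is used on the whole
  interval, starting from the Hoeffding bound on \<open>R \<le> 1 - \<epsilon> / 5\<close>.\<close>

lemma slow_set_early_bound:
  assumes e: "0 < \<epsilon>" "\<epsilon> \<le> 1" and T: "T \<ge> 0"
  shows "nmeas (slow_set (torus_flow sol) (1 - \<epsilon> / 5) T)
    \<le> 1 / (real CARD('n) / 2 + 1) * (sqrt (pi * exp 1 * \<epsilon>) / (2 * sqrt 5)) ^ CARD('n)
          * (1 - exp (- (\<kappa> * real CARD('n) * \<epsilon> * (5 - \<epsilon>) * T / 25)))
      + exp (- (real CARD('n) * \<epsilon>^2 / 25) - \<kappa> * real CARD('n) * \<epsilon> * (5 - \<epsilon>) * T / 25)"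
proof -
  define M where "M = (\<lambda>t. nmeas (slow_set (torus_flow sol) (1 - \<epsilon> / 5) t))"
  define d where "d = cap_deficit CARD('n) (\<epsilon> / 5)"
  define E where "E = exp (- (\<kappa> * real CARD('n) * \<epsilon> * (5 - \<epsilon>) * T / 25))"
  define U where "U = exp (- (real CARD('n) * \<epsilon>^2 / 25))"
  have rate: "\<kappa> * real CARD('n) * \<epsilon> * (5 - \<epsilon>) * T / 25 = T * (\<kappa> * real CARD('n) * (1 - \<epsilon> / 5)) * (\<epsilon> / 5)"
  proof -
    have "1 - \<epsilon> / 5 = (5 - \<epsilon>) * (1 / 5)" by simp
    then show ?thesis by (simp only:) simp
  qed
  have EE: "exp (T * (\<kappa> * real CARD('n) * (1 - \<epsilon> / 5)) * (\<epsilon> / 5)) = 1 / E"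
    unfolding E_def rate exp_minus by (simp only: inverse_eq_divide[symmetric] inverse_inverse_eq)
  have E: "0 < E" "E \<le> 1" using kpos e T by (simp_all add: E_def)
  have "1 / E * (M T - d) \<le> M 0 - d"
    using expansion[of 0 T "\<epsilon> / 5" "\<epsilon> / 5" "1 - \<epsilon> / 5"] e T unfolding EE M_def d_def by simp
  then have "M T - d \<le> E * (M 0 - d)" using E by (simp add: pos_divide_le_eq mult.commute)
  moreover have "M 0 = nmeas {x\<in>(torus_box::(real^'n) set). orderR x \<le> 1 - \<epsilon> / 5}"
    by (simp add: M_def slow_set_0[OF sol_facts, of "1 - \<epsilon> / 5"])
  then have "M 0 \<le> U"
    using nmeas_order_hoeffding[of "\<epsilon> / 5", where 'n = 'n] e by (simp add: U_def power_divide)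
  then have "E * M 0 \<le> E * U" using E by (intro mult_left_mono) auto
  ultimately have "M T \<le> d * (1 - E) + E * U" by (simp add: algebra_simps)
  also have "d * (1 - E) \<le> 1 / (real CARD('n) / 2 + 1) * cap_bound CARD('n) (\<epsilon> / 5) * (1 - E)"
    using cap_deficit_le[OF N2, of "\<epsilon> / 5"] e E unfolding d_def by (intro mult_right_mono) auto
  also have "E * U = exp (- (real CARD('n) * \<epsilon>^2 / 25) - \<kappa> * real CARD('n) * \<epsilon> * (5 - \<epsilon>) * T / 25)"
    unfolding E_def U_def exp_add[symmetric] by simp
  finally show ?thesis unfolding M_def E_def cap_bound_eps by simp
qed

lemma slow_set_decay:
  assumes \<mu>: "0 < \<mu>" "\<mu> < 1" and a: "a \<le> 1 - \<mu>" and y0: "y0 > 0" "41 / 50 * (4 / (pi * exp 1)) \<le> \<mu> * y0"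
    and t0: "0 \<le> t0" "t0 \<le> T" and M0: "nmeas (slow_set (torus_flow sol) a t0) \<le> y0 powr (- real CARD('n) / 2)"
  shows "nmeas (slow_set (torus_flow sol) a T)
    \<le> (y0 + \<kappa> * (1 - \<mu>) * (4 / (pi * exp 1)) * (T - t0)) powr (- real CARD('n) / 2)"
proof (rule decay[where M = "\<lambda>t. nmeas (slow_set (torus_flow sol) a t)", OF N2 kpos \<mu> _ _ y0 t0 M0])
  show "nmeas (slow_set (torus_flow sol) a t') \<le> nmeas (slow_set (torus_flow sol) a t)" if "t \<le> t'" for t t'
    using slow_set_facts(2)[OF sol_facts that] .
qed (use expansion \<mu> a in auto)

end


theorem theorem1p7:
  fixes w :: "real^'n" and \<kappa> \<epsilon> :: real
    and sol :: "real^'n \<Rightarrow> real \<Rightarrow> real^'n"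
  assumes N2: "CARD('n) \<ge> 2"
    and kpos: "\<kappa> > 0"
    and eps: "0 < \<epsilon>" "\<epsilon> \<le> 1"
    and kbig: "\<kappa> > (2 + \<epsilon>) * omega_norm w"
    and init: "\<And>x. x \<in> cube \<Longrightarrow> sol x 0 = x"
    and ode: "\<And>x t. x \<in> cube \<Longrightarrow> t \<ge> 0 \<Longrightarrow>
               (sol x has_vector_derivative kfield w \<kappa> (sol x t)) (at t within {0..})"
  shows
   "(\<forall>T>0.
      let N = real CARD('n);
          T0 = 25 / (\<kappa> * N * \<epsilon> * (5 - \<epsilon>)) *
               ln ((1 + 2 / N) * (2 * sqrt 5 / (sqrt (pi * \<epsilon>) * exp (1/2 + \<epsilon>^2 / 25))) ^ CARD('n) - 2 / N);
          \<tau> = (2 + \<epsilon>) * pi / (\<kappa> - (2 + \<epsilon>) * omega_norm w);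
          E = {x \<in> cube.
                 (\<forall>t\<ge>T. orderR (sol x t) \<ge> 1 / sqrt 2 - 3 * \<epsilon> / 20)
               \<and> (\<forall>i. osc_lt_2pi (\<lambda>t. sol x t $ i) T)
               \<and> (\<forall>i. \<forall>t0\<ge>T. cos (sol x t0 $ i) \<ge> - 1 / sqrt 2 \<longrightarrow>
                      (\<forall>t\<ge>t0. cos (sol x t $ i) \<ge> - 1 / sqrt 2)
                    \<and> (\<forall>t\<ge>t0 + \<tau>. cos (sol x t $ i) \<ge> 1 / sqrt 2))}
      in nmeas E \<ge>
         (if T \<le> T0 then
            1 - 1 / (N / 2 + 1) * (sqrt (pi * exp 1 * \<epsilon>) / (2 * sqrt 5)) ^ CARD('n)
                  * (1 - exp (- (\<kappa> * N * \<epsilon> * (5 - \<epsilon>) * T / 25)))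
              - exp (- (N * \<epsilon>^2 / 25) - \<kappa> * N * \<epsilon> * (5 - \<epsilon>) * T / 25)
          else
            1 - (20 / (pi * exp 1 * \<epsilon>) + 4 * \<kappa> * (5 - \<epsilon>) / (5 * pi * exp 1) * (T - T0))
                  powr (- N / 2)))
  \<and> (\<kappa> > 8 * omega_norm w \<longrightarrow>
      (\<forall>T>0.
        let N = real CARD('n);
            W = omega_norm w;
            F = {x \<in> cube. \<forall>i. osc_lt_2pi (\<lambda>t. sol x t $ i) T}
        in nmeas F \<ge>
           (if W = 0 then 1
            else if \<kappa> \<le> 16 * sqrt 2 * W then
              1 - (exp (1/2) + 3 * \<kappa> * T / (pi * exp 1)) powr (- N / 2)
            else
              1 - (4 / (pi * exp 1) * (\<kappa> / (2 * sqrt 2 * W)) powr (2/3)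
                   + 3 * \<kappa> * T / (pi * exp 1)) powr (- N / 2))))"
proof (intro conjI allI impI)
  have sol: "solves_from w \<kappa> (sol x)" if "x \<in> cube" for x using ode[OF that] by (simp add: solves_from_def)
  note facts = kpos init sol
  define N where "N = real CARD('n)"
  define W where "W = omega_norm w"
  fix T :: real assume T: "T > 0"
  {
    define T0 where "T0 = 25 / (\<kappa> * N * \<epsilon> * (5 - \<epsilon>)) *
        ln ((1 + 2 / N) * (2 * sqrt 5 / (sqrt (pi * \<epsilon>) * exp (1/2 + \<epsilon>^2 / 25))) ^ CARD('n) - 2 / N)"
    define \<tau> where "\<tau> = (2 + \<epsilon>) * pi / (\<kappa> - (2 + \<epsilon>) * omega_norm w)"
    define E where "E = {x \<in> cube.
                 (\<forall>t\<ge>T. orderR (sol x t) \<ge> 1 / sqrt 2 - 3 * \<epsilon> / 20)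
               \<and> (\<forall>i. osc_lt_2pi (\<lambda>t. sol x t $ i) T)
               \<and> (\<forall>i. \<forall>t0\<ge>T. cos (sol x t0 $ i) \<ge> - 1 / sqrt 2 \<longrightarrow>
                      (\<forall>t\<ge>t0. cos (sol x t $ i) \<ge> - 1 / sqrt 2)
                    \<and> (\<forall>t\<ge>t0 + \<tau>. cos (sol x t $ i) \<ge> 1 / sqrt 2))}"
    define P where "P = (sqrt (pi * exp 1 * \<epsilon>) / (2 * sqrt 5)) ^ CARD('n)"
    define A where "A = slow_set (torus_flow sol) (1 - \<epsilon> / 5)"
    \<comment> \<open>The other conditions of the good set follow from the lower bound on the order
      parameter, so \<open>E\<close> is given by a closed condition and is measurable.\<close>
    have E_eq: "E = {x\<in>cube. \<forall>t\<ge>T. sol x t \<in> {z. orderR z \<ge> 1 / sqrt 2 - 3 * \<epsilon> / 20}}"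
    proof (intro antisym subsetI)
      fix x assume "x \<in> {x\<in>cube. \<forall>t\<ge>T. sol x t \<in> {z. orderR z \<ge> 1 / sqrt 2 - 3 * \<epsilon> / 20}}"
      then have xc: "x \<in> cube" and "\<forall>t\<ge>T. orderR (sol x t) \<ge> 1 / sqrt 2 - 3 * \<epsilon> / 20" by simp_all
      then have R: "orderR (sol x t) \<ge> 1 / sqrt 2 - 3 * \<epsilon> / 20" if "t \<ge> T" for t using that by blast
      note hc = high_order_consequences[OF facts eps kbig xc less_imp_le[OF T] R, folded \<tau>_def]
      show "x \<in> E" unfolding E_def
      proof (intro CollectI conjI allI impI)
        show "osc_lt_2pi (\<lambda>t. sol x t $ i) T" for i by (rule hc(1))
        show "cos (sol x t $ i) \<ge> - 1 / sqrt 2"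
          if "t0 \<ge> T" "cos (sol x t0 $ i) \<ge> - 1 / sqrt 2" "t \<ge> t0" for i t0 t by (rule hc(2)) (use that in auto)
        show "cos (sol x t $ i) \<ge> 1 / sqrt 2"
          if "t0 \<ge> T" "cos (sol x t0 $ i) \<ge> - 1 / sqrt 2" "t \<ge> t0 + \<tau>" for i t0 t by (rule hc(3)) (use that in auto)
      qed (use xc R in auto)
    qed (auto simp: E_def)
    have "closed {z::real^'n. orderR z \<ge> 1 / sqrt 2 - 3 * \<epsilon> / 20}"
      by (intro closed_Collect_le continuous_intros continuous_on_orderR)
    then have "E \<in> lmeasurable"
      unfolding E_eq using T by (intro sol_preimage_lmeasurable[OF facts]) auto
    moreover have "torus_box - A T \<subseteq> E"
    proof
      fix x assume x: "x \<in> torus_box - A T"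
      then obtain u where u: "0 \<le> u" "u \<le> T" "orderR (sol x u) > 1 - \<epsilon> / 5"
        using fast_time[OF facts, of x "1 - \<epsilon> / 5" T] by (auto simp: A_def)
      have xc: "x \<in> cube" using x torus_box_subset_cube by auto
      have "orderR (sol x t) \<ge> 1 / sqrt 2 - 3 * \<epsilon> / 20" if "t \<ge> T" for t
        by (rule order_stays_high[OF facts eps kbig xc u(1) _ less_imp_le[OF u(3)]]) (use u that in auto)
      then show "x \<in> E" using xc by (auto simp: E_eq)
    qed
    ultimately have nE: "nmeas E \<ge> 1 - nmeas (A T)"
      unfolding A_def by (intro nmeas_ge_compl slow_set_facts(1)[OF facts]) (auto simp: slow_set_def)
    have early: "nmeas (A t) \<le> 1 / (N / 2 + 1) * P * (1 - exp (- (\<kappa> * N * \<epsilon> * (5 - \<epsilon>) * t / 25)))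
        + exp (- (N * \<epsilon>^2 / 25) - \<kappa> * N * \<epsilon> * (5 - \<epsilon>) * t / 25)" if "t \<ge> 0" for t
      unfolding A_def N_def P_def by (rule slow_set_early_bound[OF kpos N2 init sol eps that])
    note cross = crossover_time[OF eps kpos N2, folded N_def, folded P_def T0_def]
    have late: "nmeas (A T) \<le> (20 / (pi * exp 1 * \<epsilon>) + 4 * \<kappa> * (5 - \<epsilon>) / (5 * pi * exp 1) * (T - T0)) powr (- N / 2)"
      if "T0 < T"
    proof -
      \<comment> \<open>Determined by
        \<open>y0 powr (- N / 2) = cap_bound N (\<epsilon> / 5)\<close>, the value reached at
        \<open>T0\<close>. Then \<open>\<epsilon> / 5 * y0\<close> is
        \<open>4 / (pi * exp 1)\<close>, which exceeds the amount that \<open>decay\<close>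
        requires.\<close>
      define y0 where "y0 = 20 / (pi * exp 1 * \<epsilon>)"
      have "nmeas (A T0) \<le> P" using early[OF cross(1)] cross(2) by linarith
      also have "P = cap_bound CARD('n) (\<epsilon> / 5)" by (simp add: P_def cap_bound_eps)
      also have "\<dots> = (1 / y0) powr (N / 2)" using cap_bound_powr[of "\<epsilon> / 5"] eps by (simp add: N_def y0_def mult_ac)
      also have "\<dots> = y0 powr (- N / 2)" using eps by (simp add: powr_divide powr_minus_divide y0_def)
      finally have "nmeas (A T0) \<le> y0 powr (- N / 2)" .
      moreover have "\<epsilon> / 5 * y0 = 4 / (pi * exp 1)" using eps by (simp add: y0_def)
      moreover have "41 / 50 * (4 / (pi * exp 1)) \<le> 1 * (4 / (pi * exp (1::real)))" by (rule mult_right_mono) auto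
      ultimately have "nmeas (A T) \<le> (y0 + \<kappa> * (1 - \<epsilon> / 5) * (4 / (pi * exp 1)) * (T - T0)) powr (- N / 2)"
        unfolding A_def N_def
        by (intro slow_set_decay[OF kpos N2 init sol]) (use eps cross(1) that in \<open>simp_all add: y0_def\<close>)
      also have "\<kappa> * (1 - \<epsilon> / 5) * (4 / (pi * exp 1)) = 4 * \<kappa> * (5 - \<epsilon>) / (5 * pi * exp 1)"
      proof -
        have h: "1 - \<epsilon> / 5 = (5 - \<epsilon>) / 5" by simp
        show ?thesis unfolding h by simp
      qed
      finally show ?thesis by (simp add: y0_def)
    qed
    have "nmeas E \<ge> (if T \<le> T0 then
            1 - 1 / (N / 2 + 1) * P * (1 - exp (- (\<kappa> * N * \<epsilon> * (5 - \<epsilon>) * T / 25)))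
              - exp (- (N * \<epsilon>^2 / 25) - \<kappa> * N * \<epsilon> * (5 - \<epsilon>) * T / 25)
          else 1 - (20 / (pi * exp 1 * \<epsilon>) + 4 * \<kappa> * (5 - \<epsilon>) / (5 * pi * exp 1) * (T - T0)) powr (- N / 2))"
      using nE early[of T] late T by (cases "T \<le> T0") auto
    then show "let N = real CARD('n);
          T0 = 25 / (\<kappa> * N * \<epsilon> * (5 - \<epsilon>)) *
               ln ((1 + 2 / N) * (2 * sqrt 5 / (sqrt (pi * \<epsilon>) * exp (1/2 + \<epsilon>^2 / 25))) ^ CARD('n) - 2 / N);
          \<tau> = (2 + \<epsilon>) * pi / (\<kappa> - (2 + \<epsilon>) * omega_norm w);
          E = {x \<in> cube.
                 (\<forall>t\<ge>T. orderR (sol x t) \<ge> 1 / sqrt 2 - 3 * \<epsilon> / 20)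
               \<and> (\<forall>i. osc_lt_2pi (\<lambda>t. sol x t $ i) T)
               \<and> (\<forall>i. \<forall>t0\<ge>T. cos (sol x t0 $ i) \<ge> - 1 / sqrt 2 \<longrightarrow>
                      (\<forall>t\<ge>t0. cos (sol x t $ i) \<ge> - 1 / sqrt 2)
                    \<and> (\<forall>t\<ge>t0 + \<tau>. cos (sol x t $ i) \<ge> 1 / sqrt 2))}
      in nmeas E \<ge>
         (if T \<le> T0 then
            1 - 1 / (N / 2 + 1) * (sqrt (pi * exp 1 * \<epsilon>) / (2 * sqrt 5)) ^ CARD('n)
                  * (1 - exp (- (\<kappa> * N * \<epsilon> * (5 - \<epsilon>) * T / 25)))
              - exp (- (N * \<epsilon>^2 / 25) - \<kappa> * N * \<epsilon> * (5 - \<epsilon>) * T / 25)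
          else
            1 - (20 / (pi * exp 1 * \<epsilon>) + 4 * \<kappa> * (5 - \<epsilon>) / (5 * pi * exp 1) * (T - T0))
                  powr (- N / 2))"
      unfolding Let_def N_def[symmetric] T0_def[symmetric] \<tau>_def[symmetric] E_def[symmetric] P_def[symmetric] .
  }
  {
    assume k8: "\<kappa> > 8 * omega_norm w"
    define F where "F = {x \<in> cube. \<forall>i. osc_lt_2pi (\<lambda>t. sol x t $ i) T}"
    \<comment> \<open>With zero frequencies the drift condition holds already for
      \<open>r = 0\<close>, so every point of the cube is good.\<close>
    have F1: "nmeas F \<ge> 1" if "W = 0"
    proof -
      have "osc_lt_2pi (\<lambda>t. sol x t $ i) T" if "x \<in> cube" for x i
        by (rule osc_lt_2pi_of_order[OF kpos sol[OF that], of T "1 / 2" 0])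
          (use T \<open>W = 0\<close> orderR_bounds in \<open>auto simp: W_def\<close>)
      then have "F = cube" by (auto simp: F_def)
      then show ?thesis by (simp add: nmeas_def measure_cube)
    qed
    \<comment> \<open>The two regimes differ only in the bound for the initial volume of
      \<open>R \<le> \<rho>\<close>, that is in \<open>y0\<close>; the decay afterwards is the
      same.\<close>
    have F2: "nmeas F \<ge> 1 - (y0 + 3 * \<kappa> * T / (pi * exp 1)) powr (- N / 2)"
      if W0: "W \<noteq> 0" and y0: "y0 = (if \<kappa> \<le> 16 * sqrt 2 * W then exp (1/2)
          else 4 / (pi * exp 1) * (\<kappa> / (2 * sqrt 2 * W)) powr (2/3))" for y0
    proof -
      have W: "W > 0" using W0 omega_norm_nonneg[of w] by (simp add: W_def)
      define \<rho> where "\<rho> = (2 * sqrt 2 * W / \<kappa>) powr (2 / 3)"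
      have \<rho>0: "\<rho> > 0" using W kpos by (simp add: \<rho>_def)
      have \<rho>_le: "\<rho> \<le> b powr (2 / 3)" if "2 * sqrt 2 * W \<le> b * \<kappa>" for b
        unfolding \<rho>_def using that W kpos by (intro powr_mono2) (auto simp: pos_divide_le_eq)
      define A where "A = slow_set (torus_flow sol) \<rho>"
      \<comment> \<open>By \<open>k8\<close>, \<open>2 * sqrt 2 * W / \<kappa>\<close> is below
        \<open>sqrt 2 / 4\<close>, which is \<open>(1 / 2) powr (3 / 2)\<close>.\<close>
      have half: "\<rho> \<le> 1 / 2"
      proof -
        have "sqrt 2 * (8 * W) \<le> sqrt 2 * \<kappa>" using k8 by (intro mult_left_mono) (auto simp: W_def)
        then have "\<rho> \<le> (sqrt 2 / 4) powr (2 / 3)" by (intro \<rho>_le) simp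
        also have "sqrt 2 / 4 = (1 / 2 :: real) powr (3 / 2)"
        proof -
          have "(1 / 2 :: real) powr (3 / 2) = (1 / 2) powr 1 * (1 / 2) powr (1 / 2)"
            by (subst powr_add[symmetric]) simp
          also have "\<dots> = 1 / (2 * sqrt 2)" by (simp add: powr_half_sqrt real_sqrt_divide)
          also have "\<dots> = sqrt 2 / 4" by (simp add: field_simps)
          finally show ?thesis by simp
        qed
        also have "\<dots> powr (2 / 3) = 1 / 2" by (simp add: powr_powr)
        finally show ?thesis .
      qed
      \<comment> \<open>The factor \<open>1 / 4\<close> is the value of \<open>\<mu>\<close> in the
        decay, which turns the rate into \<open>3 * \<kappa> / (pi * exp 1)\<close>.\<close>
      have ypos: "y0 > 0" and yc: "41 / 50 * (4 / (pi * exp 1)) \<le> 1 / 4 * y0" and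
        y1: "nmeas (A 0) \<le> y0 powr (- N / 2)"
      proof -
        have A0: "A 0 = {x\<in>torus_box. orderR x \<le> \<rho>}" by (simp add: A_def slow_set_0[OF facts, of \<rho>])
        consider (a) "\<kappa> \<le> 16 * sqrt 2 * W" | (b) "\<kappa> > 16 * sqrt 2 * W" by linarith
        then show "y0 > 0" "41 / 50 * (4 / (pi * exp 1)) \<le> 1 / 4 * y0" "nmeas (A 0) \<le> y0 powr (- N / 2)"
        proof (atomize(full), cases)
          case a
          then have y: "y0 = exp (1 / 2)" by (simp add: y0)
          \<comment> \<open>Barely enough: \<open>3 * (35 / 8) = 13.125\<close> against
            \<open>16 * (41 / 50) = 13.12\<close>.\<close>
          have "3 * (35 / 8) \<le> pi * exp (3 / 2)" using pi_gt3 exp_three_halves_ge by (intro mult_mono) auto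
          then have "16 * (41 / 50) \<le> pi * exp (3 / 2)" by simp
          also have "exp (3 / 2 :: real) = exp 1 * exp (1 / 2)" by (simp add: exp_add[symmetric])
          finally have "41 / 50 * (4 / (pi * exp 1)) \<le> 1 / 4 * y0" unfolding y by (simp add: field_simps)
          \<comment> \<open>The Hoeffding bound with \<open>\<delta> = 1 / 2\<close> gives
            \<open>exp (- N / 4)\<close>, which is \<open>exp (1 / 2) powr (- N / 2)\<close>; this
            is the origin of the starting value \<open>exp (1 / 2)\<close>.\<close>
          moreover have "nmeas (A 0) \<le> y0 powr (- N / 2)"
          proof -
            have "nmeas (A 0) \<le> nmeas {x\<in>(torus_box::(real^'n) set). orderR x \<le> 1 - 1 / 2}"
              unfolding A0 using half
              by (intro nmeas_mono fmeasurableI2[OF lmeasurable_torus_box]) auto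
            also have "\<dots> \<le> exp (- N * (1 / 2)\<^sup>2)" unfolding N_def by (rule nmeas_order_hoeffding) simp
            also have "\<dots> = y0 powr (- N / 2)" by (simp add: y powr_def power2_eq_square)
            finally show ?thesis .
          qed
          ultimately show "y0 > 0 \<and> 41 / 50 * (4 / (pi * exp 1)) \<le> 1 / 4 * y0 \<and> nmeas (A 0) \<le> y0 powr (- N / 2)"
            by (simp add: y)
        next
          case b
          \<comment> \<open>Here \<open>y0\<close> is the value with
            \<open>y0 powr (- N / 2) = cap_bound N \<rho>\<close>. The case bound on
            \<open>\<kappa>\<close> gives \<open>\<rho> \<le> 1 / 4\<close>, so that
            \<open>y0\<close> is large enough for \<open>decay\<close> with
            \<open>\<mu> = 1 / 4\<close>.\<close>
          have "\<rho> * (\<kappa> / (2 * sqrt 2 * W)) powr (2 / 3) = 1"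
            unfolding \<rho>_def using W kpos by (subst powr_mult[symmetric]) auto
          then have y: "y0 = 4 / (pi * exp 1) / \<rho>" using b \<rho>0 by (simp add: y0 field_simps)
          have "\<rho> \<le> (1 / 8) powr (2 / 3)"
          proof (rule \<rho>_le)
            show "2 * sqrt 2 * W \<le> 1 / 8 * \<kappa>" using b by simp
          qed
          also have "(1 / 8 :: real) = (1 / 2) powr 3" by (simp add: power3_eq_cube)
          also have "((1 / 2 :: real) powr 3) powr (2 / 3) = 1 / 4" by (subst powr_powr) (simp add: power2_eq_square)
          finally have \<rho>4: "\<rho> \<le> 1 / 4" .
          have "41 / 50 * (4 / (pi * exp 1)) \<le> 1 / 4 * y0"
          proof -
            have "41 / 50 * \<rho> \<le> 1 / 4" using \<rho>4 by simp
            then have "41 / 50 \<le> 1 / 4 / \<rho>" using \<rho>0 by (simp add: pos_le_divide_eq)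
            then have "41 / 50 * (4 / (pi * exp 1)) \<le> 1 / 4 / \<rho> * (4 / (pi * exp 1))" by (intro mult_right_mono) auto
            then show ?thesis unfolding y by (simp add: mult_ac)
          qed
          moreover have "nmeas (A 0) \<le> y0 powr (- N / 2)"
          proof -
            have "nmeas (A 0) \<le> cap_bound CARD('n) \<rho>" unfolding A0 by (rule nmeas_order_cap[OF \<rho>0])
            also have "\<dots> = (1 / y0) powr (N / 2)" using \<rho>0 by (simp add: cap_bound_powr y N_def mult_ac)
            also have "\<dots> = y0 powr (- N / 2)" using \<rho>0 by (simp add: powr_divide powr_minus_divide y)
            finally show ?thesis .
          qed
          moreover have "y0 > 0" using \<rho>0 by (simp add: y)
          ultimately show "y0 > 0 \<and> 41 / 50 * (4 / (pi * exp 1)) \<le> 1 / 4 * y0 \<and> nmeas (A 0) \<le> y0 powr (- N / 2)"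
            by blast
        qed
      qed
      have "nmeas (A T) \<le> (y0 + \<kappa> * (1 - 1 / 4) * (4 / (pi * exp 1)) * (T - 0)) powr (- N / 2)"
        unfolding A_def N_def
        by (intro slow_set_decay[OF kpos N2 init sol])
          (use T half ypos yc y1[unfolded A_def N_def] in auto)
      also have "\<kappa> * (1 - 1 / 4) * (4 / (pi * exp 1)) * (T - 0) = 3 * \<kappa> * T / (pi * exp 1)" by simp
      finally have "nmeas (A T) \<le> (y0 + 3 * \<kappa> * T / (pi * exp 1)) powr (- N / 2)" .
      moreover have "torus_box - A T \<subseteq> F"
      proof
        fix x assume x: "x \<in> torus_box - A T"
        then obtain u where u: "0 \<le> u" "u \<le> T" "orderR (sol x u) > \<rho>"
          using fast_time[OF facts, of x \<rho> T] by (auto simp: A_def)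
        have xc: "x \<in> cube" using x torus_box_subset_cube by auto
        have "osc_lt_2pi (\<lambda>t. sol x t $ i) T" for i
          by (rule osc_of_order[OF facts _ _ _ xc u]) (use W half in \<open>auto simp: \<rho>_def W_def\<close>)
        then show "x \<in> F" using xc by (simp add: F_def)
      qed
      then have "nmeas F \<ge> 1 - nmeas (A T)"
        unfolding A_def F_def using T
        by (intro nmeas_ge_compl slow_set_facts(1)[OF facts] osc_set_lmeasurable[OF facts]) (auto simp: slow_set_def)
      ultimately show ?thesis by linarith
    qed
    have "nmeas F \<ge> (if W = 0 then 1
            else if \<kappa> \<le> 16 * sqrt 2 * W then
              1 - (exp (1/2) + 3 * \<kappa> * T / (pi * exp 1)) powr (- N / 2)
            else
              1 - (4 / (pi * exp 1) * (\<kappa> / (2 * sqrt 2 * W)) powr (2/3)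
                   + 3 * \<kappa> * T / (pi * exp 1)) powr (- N / 2))"
      using F1 F2[OF _ refl] by (auto split: if_splits)
    then show "let N = real CARD('n);
            W = omega_norm w;
            F = {x \<in> cube. \<forall>i. osc_lt_2pi (\<lambda>t. sol x t $ i) T}
        in nmeas F \<ge>
           (if W = 0 then 1
            else if \<kappa> \<le> 16 * sqrt 2 * W then
              1 - (exp (1/2) + 3 * \<kappa> * T / (pi * exp 1)) powr (- N / 2)
            else
              1 - (4 / (pi * exp 1) * (\<kappa> / (2 * sqrt 2 * W)) powr (2/3)
                   + 3 * \<kappa> * T / (pi * exp 1)) powr (- N / 2))"
      unfolding Let_def N_def[symmetric] W_def[symmetric] F_def[symmetric] .
  }
qed

end
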